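(* For each $n\in\mathbb N$ let $\mathbf s_n=(N_n(i))_{i\ge0}$ be a sequence of non-negative integers with $\sum_{i\ge0}N_n(i)=1+\sum_{i\ge0}iN_n(i)<\infty$, let $|\mathbf s_n|:=\sum_{i\ge0}N_n(i)$ and $\sigma_n^2:=\sum_{i\ge1}i(i-1)N_n(i)$, and let $(b_n)$ be a sequence of non-negative real numbers such that $b_n\to\infty$, $|\mathbf s_n|/b_n\to\infty$ and $b_n/\sigma_n\to1$. Let $\mathcal T^{(n)}_{\mathbf s}$ be a random tree with given degree sequence $\mathbf s_n$, i.e. uniformly distributed on the set of rooted plane trees with $|\mathbf s_n|$ vertices amongst which exactly $N_n(i)$ have $i$ offspring, for every $i\ge0$. Conditioned on the tree, delete each edge $e$ at the random time $\widehat T_e=\frac{|\mathbf s_n|}{b_n}(1-U_e)$, where the $U_e$ are i.i.d. uniform on $(0,1)$, and let $\widehat X^{(n)}(\cdot)=(\widehat X^{(n)}_i(\cdot))_{i\ge1}$ be the associated fragmentation process of normalized component sizes. Then the family of processes $\widehat X^{(n)}(\cdot)$ is tight in $D(\mathbb R_+,\mathbb S^{\downarrow}_{\le1})$.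
   Context: $\mathbb R_+:=[0,\infty)$. $\mathbb S^{\downarrow}_{\le1}:=\{(x_i)_{i=1}^\infty: x_1\ge x_2\ge\dots\ge0,\ \sum_{i}x_i\le1\}$, with the product topology (as a subspace of $\mathbb R^\infty$). $D(\mathbb R_+,\mathbb S^{\downarrow}_{\le1})$ is the space of càdlàg functions $\mathbb R_+\to\mathbb S^{\downarrow}_{\le1}$ with the Skorohod $J_1$ topology. For $t\ge0$, $\widehat X^{(n)}(t)$ is the sequence of the numbers of vertices, divided by the total number of vertices $|\mathbf s_n|$, of the connected components of the forest obtained from $\mathcal T^{(n)}_{\mathbf s}$ by removing all edges with $\widehat T_e\le t$, arranged in decreasing order and extended by zeros. Only $n$ large enough that $b_n>0$ is considered. *)

theory Defs
  imports "HOL-Probability.Probability"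
begin

section \<open>Plane trees with a given degree sequence\<close>

text \<open>Summability in \<^typ>\<open>nat\<close> says that the sums are finite.\<close>

definition degree_sequence :: "(nat \<Rightarrow> nat) \<Rightarrow> bool" where
  "degree_sequence N \<longleftrightarrow>
     summable N \<and> summable (\<lambda>i. i * N i) \<and> (\<Sum>i. N i) = 1 + (\<Sum>i. i * N i)"

definition num_vertices :: "(nat \<Rightarrow> nat) \<Rightarrow> nat" where
  "num_vertices N = (\<Sum>i. N i)"

definition deg_sigma :: "(nat \<Rightarrow> nat) \<Rightarrow> real" where
  "deg_sigma N = sqrt (real (\<Sum>i. i * (i - 1) * N i))"

text \<open>A rooted plane tree is given by its vertex set in Ulam--Harris notation: the root is
  \<^term>\<open>[]\<close>, and the children of \<open>u\<close>, from left to right, are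
  \<open>u @ [0]\<close>, \<open>u @ [1]\<close>, \dots\<close>

definition plane_tree :: "nat list set \<Rightarrow> bool" where
  "plane_tree T \<longleftrightarrow> finite T \<and> [] \<in> T \<and>
     (\<forall>u i. u @ [i] \<in> T \<longrightarrow> u \<in> T \<and> (\<forall>j<i. u @ [j] \<in> T))"

definition num_offspring :: "nat list set \<Rightarrow> nat list \<Rightarrow> nat" where
  "num_offspring T u = card {i. u @ [i] \<in> T}"

definition trees_with_degrees :: "(nat \<Rightarrow> nat) \<Rightarrow> nat list set set" where
  "trees_with_degrees N =
     {T. plane_tree T \<and> (\<forall>i. card {u \<in> T. num_offspring T u = i} = N i)}"

type_synonym edge = "nat list \<times> nat list"

definition tree_edges :: "nat list set \<Rightarrow> edge set" where
  "tree_edges T = {(u, u @ [i]) | u i. u @ [i] \<in> T}"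


section \<open>The fragmentation process\<close>

definition conn_components :: "'v set \<Rightarrow> ('v \<times> 'v) set \<Rightarrow> 'v set set" where
  "conn_components V F = V // {(u, v). u \<in> V \<and> v \<in> V \<and> (u, v) \<in> (F \<union> F\<inverse>)\<^sup>*}"

text \<open>The sizes of the sets in a finite family, in decreasing order and extended by zeros.
  Sequences \<open>(x_1, x_2, \<dots>)\<close> are indexed from \<open>0\<close> throughout.\<close>

definition ranked_sizes :: "'v set set \<Rightarrow> nat \<Rightarrow> nat" where
  "ranked_sizes C i =
     (let L = rev (sorted_list_of_multiset (image_mset card (mset_set C)))
      in if i < length L then L ! i else 0)"

definition deletion_time :: "(nat \<Rightarrow> nat) \<Rightarrow> real \<Rightarrow> (edge \<Rightarrow> real) \<Rightarrow> edge \<Rightarrow> real" where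
  "deletion_time N b U e = real (num_vertices N) / b * (1 - U e)"

text \<open>The product carries marks for all conceivable edges, so that conditionally on the tree
  \<open>T\<close> the marks of the edges of \<open>T\<close> are i.i.d. uniform on \<open>(0,1)\<close>.\<close>

definition tree_marks_measure :: "(nat \<Rightarrow> nat) \<Rightarrow> (nat list set \<times> (edge \<Rightarrow> real)) measure" where
  "tree_marks_measure N =
     uniform_count_measure (trees_with_degrees N)
       \<Otimes>\<^sub>M (\<Pi>\<^sub>M e\<in>UNIV. uniform_measure lborel {0<..<1})"

definition fragmentation ::
    "(nat \<Rightarrow> nat) \<Rightarrow> real \<Rightarrow> nat list set \<times> (edge \<Rightarrow> real) \<Rightarrow> real \<Rightarrow> nat \<Rightarrow> real" where
  "fragmentation N b = (\<lambda>(T, U). \<lambda>t\<in>{0..}. \<lambda>i.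
     real (ranked_sizes
       (conn_components T {e \<in> tree_edges T. \<not> deletion_time N b U e \<le> t}) i)
     / real (num_vertices N))"

text \<open>The ambient type \<^typ>\<open>nat \<Rightarrow> real\<close> carries the product topology, and its library metric
  induces that topology.\<close>

definition mass_partitions :: "(nat \<Rightarrow> real) set" where
  "mass_partitions = {x. antimono x \<and> (\<forall>i. 0 \<le> x i) \<and> summable x \<and> (\<Sum>i. x i) \<le> 1}"


section \<open>The Skorohod \<open>J\<^sub>1\<close> topology on \<open>D([0,\<infinity>), S)\<close>\<close>

text \<open>Paths are made extensional, i.e. constantly \<^const>\<open>undefined\<close> at negative times.\<close>

definition cadlag :: "'a::topological_space set \<Rightarrow> (real \<Rightarrow> 'a) set" where
  "cadlag S = {x \<in> {0..} \<rightarrow>\<^sub>E S.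
     (\<forall>t\<ge>0. (x \<longlongrightarrow> x t) (at_right t)) \<and> (\<forall>t>0. \<exists>l\<in>S. (x \<longlongrightarrow> l) (at_left t))}"

text \<open>Increasing bijections of \<open>[0,\<infinity>)\<close>; these are automatically homeomorphisms.\<close>

definition time_changes :: "(real \<Rightarrow> real) set" where
  "time_changes = {l. strict_mono_on {0..} l \<and> l ` {0..} = {0..}}"

definition J1_nbhd :: "'a::metric_space set \<Rightarrow> (real \<Rightarrow> 'a) \<Rightarrow> real \<Rightarrow> real \<Rightarrow> (real \<Rightarrow> 'a) set" where
  "J1_nbhd S x T \<epsilon> = {y \<in> cadlag S.
     \<exists>l\<in>time_changes. \<forall>t\<in>{0..T}. \<bar>l t - t\<bar> < \<epsilon> \<and> dist (y (l t)) (x t) < \<epsilon>}"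

text \<open>\<open>y\<^sub>k \<rightarrow> x\<close> in \<open>J\<^sub>1\<close> iff for every \<open>T\<close> there are time changes \<open>l\<^sub>k\<close> with
  \<open>sup\<^bsub>t \<le> T\<^esub> \<bar>l\<^sub>k(t) - t\<bar> \<rightarrow> 0\<close> and \<open>sup\<^bsub>t \<le> T\<^esub> dist (y\<^sub>k(l\<^sub>k(t))) (x(t)) \<rightarrow> 0\<close>
  (Ethier--Kurtz, Markov Processes, Proposition 3.5.3 and Remark 3.5.4), that is, iff \<open>y\<^sub>k\<close> is
  eventually in every \<^term>\<open>J1_nbhd S x T \<epsilon>\<close>. As \<open>J\<^sub>1\<close> is metrizable and the sets
  \<^term>\<open>J1_nbhd S x k (1 / k)\<close>, \<open>k = 1, 2, \<dots>\<close>, decrease, they form a neighbourhood base of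
  \<open>x\<close> in \<open>J\<^sub>1\<close>.\<close>

definition skorohod_J1 :: "'a::metric_space set \<Rightarrow> (real \<Rightarrow> 'a) topology" where
  "skorohod_J1 S = topology (\<lambda>G. G \<subseteq> cadlag S \<and>
     (\<forall>x\<in>G. \<exists>T>0. \<exists>\<epsilon>>0. J1_nbhd S x T \<epsilon> \<subseteq> G))"

lemma J1_nbhd_mono:
  assumes "T \<le> T'" "\<epsilon>' \<le> \<epsilon>"
  shows "J1_nbhd S x T' \<epsilon>' \<subseteq> J1_nbhd S x T \<epsilon>"
proof
  fix y assume "y \<in> J1_nbhd S x T' \<epsilon>'"
  then obtain l where "y \<in> cadlag S" and l: "l \<in> time_changes"
      "\<forall>t\<in>{0..T'}. \<bar>l t - t\<bar> < \<epsilon>' \<and> dist (y (l t)) (x t) < \<epsilon>'"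
    unfolding J1_nbhd_def by blast
  moreover have "\<forall>t\<in>{0..T}. \<bar>l t - t\<bar> < \<epsilon> \<and> dist (y (l t)) (x t) < \<epsilon>"
    using l(2) assms by (meson atLeastAtMost_iff order.trans order_less_le_trans)
  ultimately show "y \<in> J1_nbhd S x T \<epsilon>"
    unfolding J1_nbhd_def by blast
qed

lemma openin_skorohod_J1:
  "openin (skorohod_J1 S) G \<longleftrightarrow>
     G \<subseteq> cadlag S \<and> (\<forall>x\<in>G. \<exists>T>0. \<exists>\<epsilon>>0. J1_nbhd S x T \<epsilon> \<subseteq> G)"
proof -
  let ?P = "\<lambda>G. G \<subseteq> cadlag S \<and> (\<forall>x\<in>G. \<exists>T>0. \<exists>\<epsilon>>0. J1_nbhd S x T \<epsilon> \<subseteq> G)"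
  have "?P (A \<inter> B)" if A: "?P A" and B: "?P B" for A B
  proof (intro conjI ballI)
    show "A \<inter> B \<subseteq> cadlag S" using A by blast
    fix x assume x: "x \<in> A \<inter> B"
    obtain T e where 1: "T > 0" "e > 0" "J1_nbhd S x T e \<subseteq> A" using A x by blast
    obtain T' e' where 2: "T' > 0" "e' > 0" "J1_nbhd S x T' e' \<subseteq> B" using B x by blast
    have "J1_nbhd S x (max T T') (min e e') \<subseteq> A \<inter> B"
      using 1(3) 2(3) J1_nbhd_mono[of T "max T T'" "min e e'" e S x]
        J1_nbhd_mono[of T' "max T T'" "min e e'" e' S x] by auto
    then show "\<exists>T>0. \<exists>\<epsilon>>0. J1_nbhd S x T \<epsilon> \<subseteq> A \<inter> B"
      using 1 2 by (meson less_max_iff_disj min_less_iff_conj)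
  qed
  moreover have "?P (\<Union>K)" if K: "\<forall>A\<in>K. ?P A" for K
  proof (intro conjI ballI)
    show "\<Union>K \<subseteq> cadlag S" using K by blast
    fix x assume "x \<in> \<Union>K"
    then obtain A where "A \<in> K" "x \<in> A" by blast
    then obtain T e where "T > 0" "e > 0" "J1_nbhd S x T e \<subseteq> A" using K by blast
    then show "\<exists>T>0. \<exists>\<epsilon>>0. J1_nbhd S x T \<epsilon> \<subseteq> \<Union>K" using \<open>A \<in> K\<close> by blast
  qed
  ultimately have "istopology ?P" unfolding istopology_def by blast
  then show ?thesis unfolding skorohod_J1_def by (simp add: topology_inverse')
qed

lemma topspace_skorohod_J1: "topspace (skorohod_J1 S) = cadlag S"
proof -
  have "J1_nbhd S x 1 1 \<subseteq> cadlag S" for x unfolding J1_nbhd_def by blast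
  then have "openin (skorohod_J1 S) (cadlag S)"
    unfolding openin_skorohod_J1 by (meson order_refl zero_less_one)
  then show ?thesis
    by (metis openin_skorohod_J1 openin_subset openin_topspace subset_antisym)
qed


section \<open>Tightness\<close>

definition borel_sets_of :: "'a topology \<Rightarrow> 'a measure" where
  "borel_sets_of X = sigma (topspace X) {G. openin X G}"

text \<open>The family \<open>(Y i)\<^sub>i\<^sub>\<in>\<^sub>I\<close> of random elements of \<open>X\<close>, where \<open>Y i\<close> is defined on \<open>M i\<close>,
  is tight.\<close>

definition tight_family ::
    "'a topology \<Rightarrow> 'i set \<Rightarrow> ('i \<Rightarrow> 'w measure) \<Rightarrow> ('i \<Rightarrow> 'w \<Rightarrow> 'a) \<Rightarrow> bool" where
  "tight_family X I M Y \<longleftrightarrow>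
     (\<forall>i\<in>I. prob_space (M i) \<and> Y i \<in> M i \<rightarrow>\<^sub>M borel_sets_of X) \<and>
     (\<forall>\<epsilon>>0. \<exists>K. compactin X K \<and>
        (\<forall>i\<in>I. measure (M i) {\<omega> \<in> space (M i). Y i \<omega> \<in> K} \<ge> 1 - \<epsilon>))"

end

theory Submission
  imports Defs "HOL-Combinatorics.Multiset_Permutations"
begin

text \<open>Let \<open>Q(t)\<close> be the probability that two independent uniform vertices are still connected at
  time \<open>t\<close>. The masses move by at most \<open>sqrt (Q(s) - Q(t))\<close> in each coordinate between \<open>s\<close> and \<open>t\<close>, and
  \<open>Q\<close> decreases from \<open>1\<close>, so that cutting time greedily whenever \<open>Q\<close> has dropped by \<open>\<kappa>\<close> gives at most
  \<open>1 / \<kappa>\<close> pieces. A short piece starting at a greedy time \<open>\<tau>\<close> forces many edges above vertices to be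
  deleted in \<open>(\<tau>, \<tau> + \<delta>]\<close>. For a fixed edge this has probability at most \<open>\<delta> b\<^sub>n / |s\<^sub>n|\<close>, since before
  the deletion of the edge \<open>\<tau>\<close> does not depend on its mark. Hence everything reduces to the bound
  \<open>O(|s\<^sub>n| / \<sigma>\<^sub>n)\<close> for the mean depth of a vertex. By the cycle lemma, reading the degrees in preorder
  from a uniform vertex on gives a uniform arrangement of the degree multiset, and the mean depth
  is the mean time that the corresponding exchangeable walk needs to go down by one; this is bounded
  by an explicit supersolution. The resulting uniform control of the partitions gives compactness in
  \<open>J\<^sub>1\<close>.\<close>

section \<open>Degree words and the cycle lemma\<close>

text \<open>\<open>Q\<close> controls every coordinate because a rank that moves by a mass
  \<open>m\<close> separates at least a fraction \<open>m^2\<close> of the ordered vertex pairs, so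
  one decreasing quantity replaces infinitely many. A fixed time grid would not do: jumps may fall
  anywhere and J1 tolerates them only at interval ends, so the cuts must follow the path. The price
  is that the cuts, and the windows behind them, depend on the marks. Freezing the time of one edge
  beyond the horizon gives a window independent of that edge, which agrees with the true one
  whenever the edge survives the cut. The mean depth suffices, rather than the height, because
  separated pairs are counted through the deleted edges above their two vertices, and expectations
  are linear. Compact sets in J1 are obtained as continuous images of a compact space of skeletons,
  which rests on the compactness of the space of mass partitions.\<close>

datatype rtree = Root "rtree list"

primrec degree_word :: "rtree \<Rightarrow> nat list" where
  "degree_word (Root ts) = length ts # concat (map degree_word ts)"

abbreviation forest_word :: "rtree list \<Rightarrow> nat list" where
  "forest_word ts \<equiv> concat (map degree_word ts)"

text \<open>Letters \<open>d\<close> are steps \<open>d - 1\<close> of the Lukasiewicz walk started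
  at height \<open>y\<close>. An exhausted word stops the clock, so a walk that never reaches 0 gets
  the length of the word.\<close>

primrec hitting_time :: "nat list \<Rightarrow> nat \<Rightarrow> nat" where
  "hitting_time [] y = 0"
| "hitting_time (d # w) y = (if y = 0 then 0 else Suc (hitting_time w (y - 1 + d)))"

definition excess :: "nat list \<Rightarrow> int" where
  "excess w = (\<Sum>d\<leftarrow>w. int d - 1)"

lemma excess_simps [simp]:
  "excess [] = 0" "excess (d # w) = int d - 1 + excess w" "excess (v @ w) = excess v + excess w"
  by (auto simp: excess_def)

lemma excess_degree_word [simp]: "excess (degree_word t) = - 1"
proof (induction t)
  case (Root ts)
  then have "excess (forest_word ts) = - int (length ts)" by (induction ts) auto
  then show ?case by simp
qed

lemma excess_forest_word [simp]: "excess (forest_word ts) = - int (length ts)"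
  by (induction ts) auto

lemma degree_word_not_Nil [simp]: "degree_word t \<noteq> []"
  by (cases t) simp

lemma forest_word_eq_Nil_iff [simp]: "forest_word ts = [] \<longleftrightarrow> ts = []"
  by (cases ts) auto

lemma forest_word_eq_Cons:
  assumes "forest_word ts = d # w"
  obtains us vs where "ts = Root us # vs" "length us = d" "w = forest_word (us @ vs)"
proof -
  obtain t vs where "ts = t # vs" using assms by (cases ts) auto
  moreover obtain us where "t = Root us" by (cases t)
  ultimately show thesis using assms that by auto
qed

text \<open>Decoding is forced: the first letter says how many of the trees encoded by the remaining
  word are the children of the first root, and the remaining word is again a forest word, one letter
  shorter.\<close>

lemma forest_word_inject: "forest_word ts = forest_word us \<longleftrightarrow> ts = us"
proof
  show "ts = us" if "forest_word ts = forest_word us" using that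
  proof (induction "forest_word ts" arbitrary: ts us)
    case (Cons d w)
    obtain a b where a: "ts = Root a # b" "length a = d" "w = forest_word (a @ b)"
      using Cons.hyps(2) forest_word_eq_Cons[of ts d w] by metis
    obtain c e where c: "us = Root c # e" "length c = d" "w = forest_word (c @ e)"
      using Cons.hyps(2) Cons.prems forest_word_eq_Cons[of us d w] by metis
    show ?case using Cons.hyps(1)[of "a @ b" "c @ e"] a c by simp
  qed auto
qed auto

lemma degree_word_inject: "degree_word t = degree_word u \<longleftrightarrow> t = u"
  using forest_word_inject[of "[t]" "[u]"] by simp

text \<open>Read from right to left, the word drives a stack of trees: a letter \<open>d\<close>
  pops \<open>d\<close> trees as children and pushes one tree. With \<open>k\<close> trees on the
  stack this needs \<open>d \<le> k\<close>, which says that the excess \<open>d - 1 - k\<close> is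
  negative.\<close>

lemma forest_word_iff_excess_neg:
  "(\<exists>ts. w = forest_word ts) \<longleftrightarrow> (\<forall>i<length w. excess (drop i w) < 0)"
proof (induction w)
  case Nil
  show ?case by (auto intro: exI[of _ "[]"])
next
  case (Cons d w)
  show ?case
  proof
    assume "\<exists>ts. d # w = forest_word ts"
    then obtain ts where ts: "d # w = forest_word ts" ..
    then obtain us vs where 1: "ts = Root us # vs" "w = forest_word (us @ vs)"
      using forest_word_eq_Cons[of ts d w] by metis
    show "\<forall>i<length (d # w). excess (drop i (d # w)) < 0"
    proof (intro allI impI)
      fix i assume i: "i < length (d # w)"
      show "excess (drop i (d # w)) < 0"
      proof (cases i)
        case 0
        then show ?thesis using 1 ts by simp
      next
        case (Suc j)
        have "\<forall>i<length w. excess (drop i w) < 0" using Cons.IH 1(2) by blast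
        then show ?thesis using Suc i by simp
      qed
    qed
  next
    assume *: "\<forall>i<length (d # w). excess (drop i (d # w)) < 0"
    have "\<forall>i<length w. excess (drop i w) < 0"
      using * by (metis Suc_less_eq drop_Suc_Cons length_Cons)
    then obtain us where us: "w = forest_word us" using Cons.IH by blast
    have "int d \<le> int (length us)" using *[rule_format, of 0] us by simp
    then have "d # w = forest_word (Root (take d us) # drop d us)"
      by (simp add: us flip: map_append concat_append)
    then show "\<exists>ts. d # w = forest_word ts" by blast
  qed
qed

text \<open>Each vertex opens as many pending subtrees as it has children, so the walk first goes
  below its starting height with the last letter of the tree.\<close>

lemma hitting_time_degree_word:
  "hitting_time (degree_word t @ w) (Suc y) = length (degree_word t) + hitting_time w y"
proof (induction t arbitrary: w y)
  case (Root ts)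
  then have "hitting_time (forest_word ts @ w) (y + length ts) = length (forest_word ts) + hitting_time w y"
    by (induction ts) auto
  then show ?case by simp
qed

lemma hitting_time_le_length: "hitting_time w y \<le> length w"
  by (induction w arbitrary: y) auto

section \<open>Vertex sets of trees and sums of depths\<close>

primrec nodes :: "rtree \<Rightarrow> nat list set" where
  "nodes (Root ts) = insert [] {i # u | i u. i < length ts \<and> u \<in> map nodes ts ! i}"

text \<open>The indexing through \<open>map nodes ts\<close> in the definition only serves primitive
  recursion over the nested type; this is the form to work with.\<close>

lemma nodes_Root:
  "nodes (Root ts) = insert [] (\<Union>i<length ts. (#) i ` nodes (ts ! i))"
  by (auto simp: image_iff)

declare nodes.simps [simp del]

lemma finite_nodes [simp]: "finite (nodes t)"
proof (induction t)
  case (Root ts)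
  then show ?case by (auto simp: nodes_Root)
qed

lemma sum_nodes_Root:
  fixes f :: "nat list \<Rightarrow> 'b::comm_monoid_add"
  shows "sum f (nodes (Root ts)) = f [] + (\<Sum>i<length ts. \<Sum>u\<in>nodes (ts ! i). f (i # u))"
proof -
  have "sum f (nodes (Root ts)) = f [] + sum f (\<Union>i<length ts. (#) i ` nodes (ts ! i))"
    unfolding nodes_Root by (subst sum.insert) auto
  also have "sum f (\<Union>i<length ts. (#) i ` nodes (ts ! i)) = (\<Sum>i<length ts. sum f ((#) i ` nodes (ts ! i)))"
    by (rule sum.UNION_disjoint) auto
  also have "\<dots> = (\<Sum>i<length ts. \<Sum>u\<in>nodes (ts ! i). f (i # u))"
    by (intro sum.cong refl sum.reindex_cong[of "(#) _"]) auto
  finally show ?thesis .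
qed

lemma card_nodes_Root: "card (nodes (Root ts)) = Suc (\<Sum>i<length ts. card (nodes (ts ! i)))"
  using sum_nodes_Root[of "\<lambda>_. 1::nat" ts] by simp

lemma card_nodes: "card (nodes t) = length (degree_word t)"
proof (induction t)
  case (Root ts)
  have "card (nodes (Root ts)) = 1 + (\<Sum>i<length ts. card (nodes (ts ! i)))"
    by (simp add: card_nodes_Root)
  also have "\<dots> = 1 + (\<Sum>i<length ts. length (degree_word (ts ! i)))"
    using Root by simp
  also have "\<dots> = length (degree_word (Root ts))"
    by (simp add: length_concat sum_list_sum_nth atLeast0LessThan comp_def)
  finally show ?case .
qed

lemma sum_length_nodes_Root:
  "(\<Sum>u\<in>nodes (Root ts). Suc (length u)) =
     length (degree_word (Root ts)) + (\<Sum>t\<leftarrow>ts. \<Sum>u\<in>nodes t. Suc (length u))"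
proof -
  have "(\<Sum>u\<in>nodes (Root ts). Suc (length u)) =
      (1 + (\<Sum>i<length ts. card (nodes (ts ! i)))) + (\<Sum>i<length ts. \<Sum>u\<in>nodes (ts ! i). Suc (length u))"
    using card_nodes_Root[of ts] by (simp add: sum_nodes_Root sum_Suc del: card_0_eq)
  also have "1 + (\<Sum>i<length ts. card (nodes (ts ! i))) = length (degree_word (Root ts))"
    using card_nodes_Root[of ts] card_nodes[of "Root ts"] by simp
  finally show ?thesis by (simp add: sum_list_sum_nth atLeast0LessThan)
qed

text \<open>The suffix that starts at a vertex first falls by one at the end of the word of its
  subtree, so the left side adds up subtree sizes. Counting pairs of a vertex and one of its
  ancestors, itself included, turns these into depths plus one.\<close>

lemma sum_hitting_time_forest_word:
  "(\<Sum>i<length (forest_word ts). hitting_time (drop i (forest_word ts)) 1) =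
     (\<Sum>t\<leftarrow>ts. \<Sum>u\<in>nodes t. Suc (length u))"
proof (induction "forest_word ts" arbitrary: ts)
  case (Cons d w)
  obtain us vs where 1: "ts = Root us # vs" "length us = d" "w = forest_word (us @ vs)"
    using Cons.hyps(2) forest_word_eq_Cons[of ts d w] by metis
  have "(\<Sum>i<length (d # w). hitting_time (drop i (d # w)) 1) =
      hitting_time (forest_word ts) 1 + (\<Sum>i<length w. hitting_time (drop i w) 1)"
    unfolding Cons.hyps(2)[symmetric] length_Cons sum.lessThan_Suc_shift by simp
  also have "hitting_time (forest_word ts) 1 = length (degree_word (Root us))"
    using hitting_time_degree_word[of "Root us" "forest_word vs" 0]
    by (simp add: 1(1)) (metis hitting_time.simps add_0_right neq_Nil_conv)
  also have "(\<Sum>i<length w. hitting_time (drop i w) 1) = (\<Sum>t\<leftarrow>us @ vs. \<Sum>u\<in>nodes t. Suc (length u))"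
    using Cons.hyps(1)[OF 1(3)] 1(3) by simp
  finally show ?case
    using Cons.hyps(2) 1(1) by (simp add: sum_length_nodes_Root del: degree_word.simps)
qed auto

text \<open>The word of the subtree at position \<open>i\<close> ends before the wrap-around, so the
  letters that the rotation appends are never read.\<close>

lemma hitting_time_rotate:
  assumes "i < length (degree_word t)"
  shows "hitting_time (rotate i (degree_word t)) 1 = hitting_time (drop i (degree_word t)) 1"
proof -
  let ?w = "degree_word t"
  have "\<forall>j<length ?w. excess (drop j ?w) < 0"
    using forest_word_iff_excess_neg[of ?w] by (metis append_Nil2 concat.simps list.simps(8,9))
  then have "\<forall>j<length (drop i ?w). excess (drop j (drop i ?w)) < 0"
    by (simp add: less_diff_conv add.commute)
  then obtain ts where ts: "drop i ?w = forest_word ts"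
    using forest_word_iff_excess_neg by blast
  moreover from this have "ts \<noteq> []" using assms by auto
  ultimately obtain u us where "drop i ?w = degree_word u @ forest_word us"
    by (cases ts) auto
  moreover have "rotate i ?w = drop i ?w @ take i ?w"
    using assms by (simp add: rotate_drop_take)
  moreover have "hitting_time v 0 = 0" for v by (cases v) auto
  ultimately show ?thesis
    using hitting_time_degree_word[of u "forest_word us" 0]
      hitting_time_degree_word[of u "forest_word us @ take i ?w" 0] by simp
qed

lemma sum_hitting_time_rotate:
  "(\<Sum>i<length (degree_word t). hitting_time (rotate i (degree_word t)) 1) = (\<Sum>u\<in>nodes t. Suc (length u))"
  using sum_hitting_time_forest_word[of "[t]"] by (simp add: hitting_time_rotate[unfolded One_nat_def])

text \<open>Cycle lemma: cut the word at the first maximum of the excess of its suffixes.\<close>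

lemma ex_rotate_degree_word:
  assumes "excess w = - 1"
  shows "\<exists>t i. i < length w \<and> w = rotate i (degree_word t)"
proof -
  let ?n = "length w"
  let ?s = "\<lambda>i. excess (drop i w)"
  have n: "0 < ?n" using assms by auto
  define m where "m = Max (?s ` {..<?n})"
  have fin: "finite (?s ` {..<?n})" "?s ` {..<?n} \<noteq> {}" using n by auto
  have "\<exists>i<?n. ?s i = m" using Max_in[OF fin] by (auto simp: m_def)
  then obtain i where i: "i < ?n" "?s i = m" "\<And>k. k < i \<Longrightarrow> \<not> (k < ?n \<and> ?s k = m)"
    using exists_least_iff[of "\<lambda>i. i < ?n \<and> ?s i = m"] by blast
  have le: "?s k \<le> m" if "k < ?n" for k using that fin by (auto simp: m_def)
  have less: "?s k < m" if "k < i" for k using i(1) i(3)[of k] le[of k] that by force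
  have split: "?s k = excess (take j (drop k w)) + ?s (k + j)" for j k
    by (metis add.commute append_take_drop_id drop_drop excess_simps(3))
  have "excess (drop k (rotate i w)) < 0" if k: "k < length (rotate i w)" for k
  \<comment> \<open>Suffixes that still contain the whole wrapped block only need \<open>m\<close>
    to be a maximum; those inside the block need it to be the first one, since there strictness
    comes from \<open>less\<close>.\<close>
  proof (cases "k < ?n - i")
    case True
    then have "drop k (rotate i w) = drop (k + i) w @ take i w"
      using i(1) by (simp add: rotate_drop_take)
    moreover have "excess (take i w) + m = - 1" using split[of 0 i] assms i(2) by simp
    ultimately show ?thesis using le[of "k + i"] True by (simp only: excess_simps) linarith
  next
    case False
    define j where "j = k - (?n - i)"
    have j: "j < i" using False k i(1) by (simp add: j_def)
    have "drop k (rotate i w) = take (i - j) (drop j w)"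
      using False i(1) by (simp add: rotate_drop_take j_def drop_take)
    then show ?thesis using split[of j "i - j"] less[OF j] j i(2) by simp
  qed
  then obtain ts where ts: "rotate i w = forest_word ts"
    using forest_word_iff_excess_neg by blast
  have "excess (rotate i w) = excess (drop i w @ take i w)"
    using i(1) by (simp add: rotate_drop_take)
  also have "\<dots> = - 1"
    using assms by (metis add.commute append_take_drop_id excess_simps(3))
  finally have "length ts = 1" using ts by simp
  then obtain t where t: "rotate i w = degree_word t" using ts
    by (auto simp: length_Suc_conv)
  have "rotate ((?n - i) mod ?n) (degree_word t) = rotate (?n - i + i) w"
    unfolding t[symmetric] by (metis length_rotate rotate_conv_mod rotate_rotate)
  also have "\<dots> = w" using i(1) by simp
  finally show ?thesis using n by (metis mod_less_divisor)
qed

lemma rotate_inject: "rotate n xs = rotate n ys \<Longrightarrow> xs = ys"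
proof (induction n)
  case (Suc n)
  have "us = vs" if "rotate1 us = rotate1 vs" for us vs :: "'a list"
    using that by (cases us; cases vs) auto
  then show ?case using Suc by (metis rotate_Suc)
qed simp

text \<open>A nontrivial shift would split a degree word into two nonempty pieces, each a suffix of
  some degree word and hence of negative excess; the total would be at most -2 instead of
  -1.\<close>

lemma rotate_degree_word_inject:
  assumes eq: "rotate i (degree_word t) = rotate j (degree_word u)"
    and "i < length (degree_word t)" "j < length (degree_word u)"
  shows "t = u \<and> i = j"
proof -
  have *: "t = u \<and> i = j"
    if eq: "rotate i (degree_word t) = rotate j (degree_word u)"
      and ij: "i \<le> j" "j < length (degree_word u)" for t u i j
  proof -
    have "rotate i (degree_word t) = rotate i (rotate (j - i) (degree_word u))"
      using eq ij by (simp add: rotate_rotate)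
    then have 1: "degree_word t = rotate (j - i) (degree_word u)"
      by (rule rotate_inject)
    have neg: "\<forall>k<length (degree_word v). excess (drop k (degree_word v)) < 0" for v
      using forest_word_iff_excess_neg[of "degree_word v"] by (metis append_Nil2 concat.simps list.simps(8,9))
    define k where "k = j - i"
    have k: "k < length (degree_word u)" using ij by (simp add: k_def)
    have 2: "degree_word t = drop k (degree_word u) @ take k (degree_word u)"
      using 1 k by (simp add: k_def rotate_drop_take)
    have "k = 0"
    proof (rule ccontr)
      assume "k \<noteq> 0"
      then have "excess (take k (degree_word u)) < 0"
        using neg[of t, rule_format, of "length (degree_word u) - k"] 2 k by simp
      moreover have "excess (drop k (degree_word u)) < 0" using neg k by blast
      ultimately have "excess (degree_word t) < - 1" using 2 by simp
      then show False by simp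
    qed
    then have "degree_word t = degree_word u" using 2 by simp
    moreover have "i = j" using \<open>k = 0\<close> ij(1) k_def by linarith
    ultimately show ?thesis by (simp only: degree_word_inject)
  qed
  show ?thesis
  proof (cases "i \<le> j")
    case True
    show ?thesis by (rule *[OF eq True assms(3)])
  next
    case False
    then have "j \<le> i" by simp
    then have "u = t \<and> j = i" by (rule *[OF eq[symmetric] _ assms(2)])
    then show ?thesis by blast
  qed
qed

lemma excess_eq: "excess w = int (sum_mset (mset w)) - int (size (mset w))"
  by (induction w) auto

lemma mset_rotate [simp]: "mset (rotate n xs) = mset xs"
proof (induction n)
  case (Suc n)
  have "mset (rotate1 us) = mset us" for us :: "'a list" by (cases us) auto
  then show ?case using Suc by simp
qed simp

text \<open>This transfers uniformity: a uniform arrangement amounts to a uniform tree read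
  cyclically from a uniform position. The hypothesis says that arrangements have excess -1.\<close>

lemma bij_betw_rotate_degree_word:
  assumes "size M = Suc (sum_mset M)"
  shows "bij_betw (\<lambda>(t, i). rotate i (degree_word t))
    ({t. mset (degree_word t) = M} \<times> {..<size M}) (permutations_of_multiset M)"
proof (rule bij_betw_imageI)
  have len: "length w = size M" if "mset w = M" for w :: "nat list" using that size_mset[of w] by simp
  show "inj_on (\<lambda>(t, i). rotate i (degree_word t)) ({t. mset (degree_word t) = M} \<times> {..<size M})"
  proof (rule inj_onI, clarify)
    fix t i u j
    assume *: "i < size (mset (degree_word t))" "j < size (mset (degree_word t))"
      and eq: "mset (degree_word u) = mset (degree_word t)"
      and rot: "rotate i (degree_word t) = rotate j (degree_word u)"
    show "t = u \<and> i = j"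
      using rotate_degree_word_inject[OF rot] * mset_eq_length[OF eq] by simp
  qed
  show "(\<lambda>(t, i). rotate i (degree_word t)) ` ({t. mset (degree_word t) = M} \<times> {..<size M}) = permutations_of_multiset M"
  proof (intro equalityI subsetI)
    fix w assume "w \<in> permutations_of_multiset M"
    then have w: "mset w = M" by (rule permutations_of_multisetD)
    then have "excess w = - 1" unfolding excess_eq w assms by simp
    then obtain t i where "i < length w" "w = rotate i (degree_word t)"
      using ex_rotate_degree_word by blast
    moreover from this have "mset (degree_word t) = M" using w by (metis mset_rotate)
    ultimately show "w \<in> (\<lambda>(t, i). rotate i (degree_word t)) ` ({t. mset (degree_word t) = M} \<times> {..<size M})"
      using len[OF w] by (intro image_eqI[of _ _ "(t, i)"]) auto
  next
    fix w assume "w \<in> (\<lambda>(t, i). rotate i (degree_word t)) ` ({t. mset (degree_word t) = M} \<times> {..<size M})"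
    then obtain t i where "w = rotate i (degree_word t)" "mset (degree_word t) = M" by auto
    then show "w \<in> permutations_of_multiset M" by (simp add: permutations_of_multiset_def)
  qed
qed

lemma sum_nodes_eq_sum_hitting_time:
  assumes "size M = Suc (sum_mset M)"
  shows "(\<Sum>t | mset (degree_word t) = M. \<Sum>u\<in>nodes t. Suc (length u)) =
      (\<Sum>w\<in>permutations_of_multiset M. hitting_time w 1)"
    and "card {t. mset (degree_word t) = M} * size M = card (permutations_of_multiset M)"
    and "finite {t. mset (degree_word t) = M}"
proof -
  note bij = bij_betw_rotate_degree_word[OF assms]
  show "card {t. mset (degree_word t) = M} * size M = card (permutations_of_multiset M)"
    using bij_betw_same_card[OF bij] by (simp add: card_cartesian_product)
  have "finite ({t. mset (degree_word t) = M} \<times> {..<size M})"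
    using bij_betw_finite[OF bij] by simp
  then show fin: "finite {t. mset (degree_word t) = M}"
    by (rule finite_cartesian_productD1) (simp add: assms lessThan_Suc)
  have "(\<Sum>w\<in>permutations_of_multiset M. hitting_time w 1) =
      (\<Sum>(t, i)\<in>{t. mset (degree_word t) = M} \<times> {..<size M}. hitting_time (rotate i (degree_word t)) 1)"
    using sum.reindex_bij_betw[OF bij, of "\<lambda>w. hitting_time w 1"] by (simp only: case_prod_beta')
  also have "\<dots> = (\<Sum>t | mset (degree_word t) = M. \<Sum>i<size M. hitting_time (rotate i (degree_word t)) 1)"
    by (rule sum.cartesian_product[symmetric])
  also have "\<dots> = (\<Sum>t | mset (degree_word t) = M. \<Sum>u\<in>nodes t. Suc (length u))"
  proof (rule sum.cong[OF refl], clarify)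
    fix t
    show "(\<Sum>i<size (mset (degree_word t)). hitting_time (rotate i (degree_word t)) 1) = (\<Sum>u\<in>nodes t. Suc (length u))"
      unfolding size_mset by (rule sum_hitting_time_rotate)
  qed
  finally show "(\<Sum>t | mset (degree_word t) = M. \<Sum>u\<in>nodes t. Suc (length u)) =
      (\<Sum>w\<in>permutations_of_multiset M. hitting_time w 1)" ..
qed

section \<open>The mean hitting time\<close>

lemma sum_mset_image_eq_sum_count:
  fixes f :: "'a \<Rightarrow> real"
  shows "(\<Sum>d\<in>#M. f d) = (\<Sum>d\<in>set_mset M. count M d * f d)"
proof -
  have "(\<Sum>d\<in>#M. f d) = (\<Sum>d\<in>A. count M d * f d)" if "finite A" "set_mset M \<subseteq> A" for A
    using that(2)
  proof (induction M)
    case (add x M)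
    have "real (count (add_mset x M) d) * f d = (if d = x then f d else 0) + count M d * f d" for d
      by (simp add: algebra_simps)
    then show ?case using add that(1) by (simp add: sum.distrib)
  qed simp
  then show ?thesis by blast
qed

section \<open>Drawing letters without replacement: means over arrangements\<close>

definition sq_excess :: "nat multiset \<Rightarrow> real" where
  "sq_excess M = (\<Sum>d\<in>#M. (real d - 1)\<^sup>2)"

definition mean_hitting_time :: "nat multiset \<Rightarrow> nat \<Rightarrow> real" where
  "mean_hitting_time M y =
     (\<Sum>w\<in>permutations_of_multiset M. real (hitting_time w y)) / real (card (permutations_of_multiset M))"

definition mset_mean :: "('a \<Rightarrow> real) \<Rightarrow> 'a multiset \<Rightarrow> real" where
  "mset_mean f M = (\<Sum>d\<in>#M. f d) / real (size M)"

lemma mset_mean_mono: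
  assumes "\<And>d. d \<in># M \<Longrightarrow> f d \<le> g d"
  shows "mset_mean f M \<le> mset_mean g M"
  unfolding mset_mean_def by (intro divide_right_mono sum_mset_mono assms) auto

lemma mset_mean_add: "mset_mean (\<lambda>d. f d + g d) M = mset_mean f M + mset_mean g M"
  by (simp add: mset_mean_def sum_mset.distrib add_divide_distrib)

lemma mset_mean_cmult: "mset_mean (\<lambda>d. c * f d) M = c * mset_mean f M"
  by (simp add: mset_mean_def sum_mset_distrib_left)

lemma mset_mean_const: "M \<noteq> {#} \<Longrightarrow> mset_mean (\<lambda>_. c) M = c"
  by (simp add: mset_mean_def)

lemma mean_hitting_time_le_size: "mean_hitting_time M y \<le> real (size M)"
proof -
  have "(\<Sum>w\<in>permutations_of_multiset M. real (hitting_time w y)) \<le>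
      (\<Sum>w\<in>permutations_of_multiset M. real (size M))"
  proof (intro sum_mono)
    fix w assume "w \<in> permutations_of_multiset M"
    then show "real (hitting_time w y) \<le> real (size M)"
      using hitting_time_le_length[of w y] length_finite_permutations_of_multiset[of w M] by simp
  qed
  then show ?thesis
    by (auto simp: mean_hitting_time_def field_simps card_gt_0_iff)
qed

lemma mean_hitting_time_0 [simp]: "mean_hitting_time M 0 = 0"
proof -
  have "hitting_time w 0 = 0" for w by (cases w) auto
  then show ?thesis by (simp add: mean_hitting_time_def)
qed

text \<open>A letter \<open>d\<close> comes first with probability
  \<open>count M d / size M\<close>, and given this the rest is a uniform arrangement of
  \<open>M - {#d#}\<close>.\<close>

lemma mean_hitting_time_step:
  assumes "M \<noteq> {#}" "y > 0"
  shows "mean_hitting_time M y = 1 + mset_mean (\<lambda>d. mean_hitting_time (M - {#d#}) (y - 1 + d)) M"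
proof -
  let ?P = permutations_of_multiset
  let ?c = "real (card (?P M))" and ?r = "real (size M)"
  have pos: "?c > 0" "?r > 0" using assms by (auto simp: card_gt_0_iff nonempty_has_size)
  have sub: "(\<Sum>w\<in>?P (M - {#d#}). real (hitting_time (d # w) y)) =
      ?c * count M d / ?r * (1 + mean_hitting_time (M - {#d#}) (y - 1 + d))" if "d \<in># M" for d
  proof -
    let ?c' = "real (card (?P (M - {#d#})))"
    have c': "?c' > 0" by (auto simp: card_gt_0_iff)
    have "(\<Sum>w\<in>?P (M - {#d#}). real (hitting_time (d # w) y)) =
        ?c' + (\<Sum>w\<in>?P (M - {#d#}). real (hitting_time w (y - 1 + d)))"
      using assms by (simp add: sum.distrib)
    also have "\<dots> = ?c' * (1 + mean_hitting_time (M - {#d#}) (y - 1 + d))"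
      using c' by (simp add: mean_hitting_time_def field_simps)
    also have "?c' = ?c * count M d / ?r"
      using real_card_permutations_of_multiset_remove[OF that] by simp
    finally show ?thesis .
  qed
  have "(\<Sum>w\<in>?P M. real (hitting_time w y)) =
      (\<Sum>d\<in>set_mset M. \<Sum>w\<in>(#) d ` ?P (M - {#d#}). real (hitting_time w y))"
    unfolding permutations_of_multiset_nonempty[OF assms(1)]
    by (rule sum.UNION_disjoint) auto
  also have "\<dots> = (\<Sum>d\<in>set_mset M. \<Sum>w\<in>?P (M - {#d#}). real (hitting_time (d # w) y))"
    by (intro sum.cong refl sum.reindex_cong[of "(#) _"]) auto
  also have "\<dots> = (\<Sum>d\<in>set_mset M. ?c / ?r * (count M d * (1 + mean_hitting_time (M - {#d#}) (y - 1 + d))))"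
    using sub by (intro sum.cong refl) simp
  also have "\<dots> = ?c * mset_mean (\<lambda>d. 1 + mean_hitting_time (M - {#d#}) (y - 1 + d)) M"
    by (simp add: mset_mean_def sum_mset_image_eq_sum_count sum_distrib_left sum_divide_distrib mult.assoc)
  also have "\<dots> = ?c * (1 + mset_mean (\<lambda>d. mean_hitting_time (M - {#d#}) (y - 1 + d)) M)"
    using assms by (simp add: mset_mean_add mset_mean_const)
  finally show ?thesis unfolding mean_hitting_time_def[of M] using pos by simp
qed

text \<open>A supersolution of the one-step equation for the mean hitting time. With \<open>n\<close> the initial
  number of letters and \<open>s\<^sup>2 + 1\<close> the initial sum of squares, \<open>v = n y / (s r)\<close> is a martingale when
  \<open>r\<close> letters are left and \<open>y\<close> is the current height, and the decrease of \<open>- v\<^sup>2\<close> pays for the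
  other two terms. These are there to make the bound trivial once half of the letters or a quarter
  of the squares are used up.\<close>

definition potential :: "real \<Rightarrow> real \<Rightarrow> nat multiset \<Rightarrow> nat \<Rightarrow> real" where
  "potential n s M y =
     n * (153 * (n * y / (s * size M)) - 38 * (n * y / (s * size M))\<^sup>2
       + 4 * ((s\<^sup>2 + 1 - sq_excess M) / s\<^sup>2)) + 2 * (n - size M)"

text \<open>This is the region where the trivial bound by the number of letters is good enough, and
  one term pays for it in each case. As \<open>153 = 4 * 38 + 1\<close>, the polynomial
  \<open>153 v - 38 v^2\<close> is at least 1 on [1, 4]; the factor 4 answers to a used quarter of
  the squares, and the factor 2 to half of the letters.\<close>

lemma potential_ge_size:
  fixes n s :: real and M :: "nat multiset" and y :: nat
  defines "v \<equiv> n * y / (s * size M)"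
  assumes "size M \<le> n" "s \<ge> 1" "sq_excess M \<le> s\<^sup>2 + 1" "v \<le> 4"
    and "v \<ge> 1 \<or> sq_excess M \<le> 3 / 4 * s\<^sup>2 \<or> size M \<le> n / 2"
  shows "size M \<le> potential n s M y"
proof -
  have n: "n \<ge> 0" using assms by linarith
  have v: "v \<ge> 0" using n assms by (simp add: v_def)
  have a: "153 * v - 38 * v\<^sup>2 \<ge> 0"
  proof -
    have "v * (153 - 38 * v) \<ge> 0" using v \<open>v \<le> 4\<close> by (intro mult_nonneg_nonneg) auto
    then show ?thesis by (simp add: algebra_simps power2_eq_square)
  qed
  have b: "153 * v - 38 * v\<^sup>2 \<ge> 1" if "v \<ge> 1"
  proof -
    have "(v - 1) * (4 - v) \<ge> 0" using that \<open>v \<le> 4\<close> by (intro mult_nonneg_nonneg) auto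
    then have "v\<^sup>2 \<le> 5 * v - 4" by (simp add: algebra_simps power2_eq_square)
    then show ?thesis using \<open>v \<le> 4\<close> by linarith
  qed
  define z where "z = 4 * ((s\<^sup>2 + 1 - sq_excess M) / s\<^sup>2)"
  have z: "z \<ge> 0" using assms by (simp add: z_def)
  have z1: "z \<ge> 1" if "sq_excess M \<le> 3 / 4 * s\<^sup>2"
    using that assms by (simp add: z_def field_simps)
  have *: "n * (153 * v - 38 * v\<^sup>2 + z) \<ge> n" if "153 * v - 38 * v\<^sup>2 + z \<ge> 1"
    using mult_left_mono[OF that n] by simp
  have **: "n * (153 * v - 38 * v\<^sup>2 + z) \<ge> 0" using n a z by simp
  have "potential n s M y = n * (153 * v - 38 * v\<^sup>2 + z) + 2 * (n - size M)"
    by (simp add: potential_def v_def z_def)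
  moreover have "n * (153 * v - 38 * v\<^sup>2 + z) \<ge> n" if "\<not> size M \<le> n / 2"
  proof (rule *)
    have "v \<ge> 1 \<or> sq_excess M \<le> 3 / 4 * s\<^sup>2" using assms(6) that by blast
    then show "153 * v - 38 * v\<^sup>2 + z \<ge> 1"
    proof
      assume "v \<ge> 1"
      from b[OF this] z show ?thesis by linarith
    next
      assume "sq_excess M \<le> 3 / 4 * s\<^sup>2"
      from z1[OF this] a show ?thesis by linarith
    qed
  qed
  moreover have "2 * (n - size M) = 2 * n - 2 * real (size M)" by simp
  ultimately show ?thesis using assms(2) ** by linarith
qed

lemma sq_excess_nonneg: "sq_excess M \<ge> 0"
  unfolding sq_excess_def by (induction M) auto

lemma sq_excess_remove: "d \<in># M \<Longrightarrow> sq_excess (M - {#d#}) = sq_excess M - (real d - 1)\<^sup>2"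
  by (auto simp: sq_excess_def dest!: multi_member_split)

lemma mset_mean_excess:
  assumes "sum_mset M + y = size M" "M \<noteq> {#}"
  shows "mset_mean (\<lambda>d. real d - 1) M = - (y / size M)"
proof -
  have "(\<Sum>d\<in>#M. real d - 1) = real (sum_mset M) - real (size M)"
    by (induction M) auto
  also have "\<dots> = - real y" using arg_cong[OF assms(1), of real] by simp
  finally show ?thesis by (simp add: mset_mean_def)
qed

text \<open>The martingale property \<open>k * (y + m) = v\<close> leaves only second-order terms.
  The mean change is 2 for the lost letter, at most \<open>4 * 4\<close> for the used squares, and
  at most \<open>- 38 / 2\<close> from the variance of the step of \<open>v\<close>. With the unit
  of time spent this gives \<open>1 + 2 + 16 - 19 = 0\<close>, which is the origin of 38.\<close>

lemma potential_step:
  fixes n s :: real and M :: "nat multiset" and y :: nat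
  defines "r \<equiv> real (size M)" and "v \<equiv> n * y / (s * size M)"
  assumes yM: "sum_mset M + y = size M" and y: "y > 0"
    and n: "r \<le> n" "n / 2 < r" "n \<ge> 16" and s: "s \<ge> 1" "s \<le> n"
    and R: "3 / 4 * s\<^sup>2 < sq_excess M" "sq_excess M \<le> s\<^sup>2 + 1" and v: "v < 1"
  shows "1 + mset_mean (\<lambda>d. potential n s (M - {#d#}) (y - 1 + d)) M \<le> potential n s M y"
proof -
  have M: "M \<noteq> {#}" and r: "r > 8" using n by (auto simp: r_def)
  define m where "m = - (y / r)"
  define q where "q = sq_excess M / r"
  define k where "k = n / (s * (r - 1))"
  have k: "k > 0" using n s r by (simp add: k_def)
  have mean1: "mset_mean (\<lambda>d. real d - 1) M = m"
    using mset_mean_excess[OF yM M] by (simp add: m_def r_def)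
  have mean2: "mset_mean (\<lambda>d. (real d - 1)\<^sup>2) M = q"
    by (simp add: q_def r_def mset_mean_def sq_excess_def)
  have pot: "potential n s (M - {#d#}) (y - 1 + d) =
      (n * (153 * k * y - 38 * k\<^sup>2 * y\<^sup>2 + 4 * ((s\<^sup>2 + 1 - sq_excess M) / s\<^sup>2)) + 2 * (n - r) + 2)
      + (n * (153 * k - 76 * k\<^sup>2 * y)) * (real d - 1) + (n * (4 / s\<^sup>2 - 38 * k\<^sup>2)) * (real d - 1)\<^sup>2"
    if "d \<in># M" for d
  proof -
    have 1: "real (size (M - {#d#})) = r - 1"
      using that r by (simp add: size_Diff_singleton r_def)
    have 2: "real (y - 1 + d) = y + (real d - 1)" using y by simp
    have 3: "n * (y + (real d - 1)) / (s * (r - 1)) = k * (y + (real d - 1))" by (simp add: k_def)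
    show ?thesis unfolding potential_def 1 2 3 sq_excess_remove[OF that]
      by (simp add: diff_divide_distrib add_divide_distrib algebra_simps power2_eq_square)
  qed
  have cong: "mset_mean f M = mset_mean g M" if "\<And>d. d \<in># M \<Longrightarrow> f d = g d" for f g :: "nat \<Rightarrow> real"
    using that unfolding mset_mean_def by (metis image_mset_cong)
  have "mset_mean (\<lambda>d. potential n s (M - {#d#}) (y - 1 + d)) M =
      (n * (153 * k * y - 38 * k\<^sup>2 * y\<^sup>2 + 4 * ((s\<^sup>2 + 1 - sq_excess M) / s\<^sup>2)) + 2 * (n - r) + 2)
      + (n * (153 * k - 76 * k\<^sup>2 * y)) * m + (n * (4 / s\<^sup>2 - 38 * k\<^sup>2)) * q"
    using cong[OF pot] by (simp only: mset_mean_add mset_mean_cmult mset_mean_const[OF M] mean1 mean2)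
  also have "\<dots> = n * (153 * (k * (y + m)) - 38 * (k * (y + m))\<^sup>2 + 4 * ((s\<^sup>2 + 1 - sq_excess M) / s\<^sup>2))
      + 2 * (n - r) + (2 + 4 * (n / s\<^sup>2 * q) - 38 * (n * k\<^sup>2 * (q - m\<^sup>2)))"
    by (simp add: algebra_simps power2_eq_square)
  also have "k * (y + m) = v"
    using r s by (simp add: k_def m_def v_def r_def[symmetric] field_simps)
  finally have mean: "mset_mean (\<lambda>d. potential n s (M - {#d#}) (y - 1 + d)) M =
      potential n s M y + (2 + 4 * (n / s\<^sup>2 * q) - 38 * (n * k\<^sup>2 * (q - m\<^sup>2)))"
    by (simp add: potential_def v_def r_def)
  have "q \<le> 2 * s\<^sup>2 / r"
    unfolding q_def
  proof (rule divide_right_mono)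
    show "sq_excess M \<le> 2 * s\<^sup>2" using R(2) one_le_power[OF s(1), of 2] by linarith
  qed (use r in simp)
  also have "\<dots> \<le> 2 * s\<^sup>2 / (n / 2)"
    using n s r by (intro divide_left_mono) auto
  finally have "n / s\<^sup>2 * q \<le> n / s\<^sup>2 * (2 * s\<^sup>2 / (n / 2))"
    using n s by (intro mult_left_mono) auto
  also have "\<dots> = 4" using n s by simp
  finally have T1: "n / s\<^sup>2 * q \<le> 4" .
  \<comment> \<open>Since \<open>v < 1\<close>, the squared mean step is at most a third of the
    lower bound \<open>3 / 4 * s^2 / n\<close> for the second moment, so the variance is not eaten
    up by the drift.\<close>
  have "y / r < s / n"
    using v n s r by (simp add: v_def r_def[symmetric] field_simps)
  then have "m\<^sup>2 \<le> (s / n)\<^sup>2"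
    unfolding m_def power2_minus using r by (intro power_mono) auto
  also have "\<dots> \<le> s\<^sup>2 / (4 * n)"
  proof -
    have "s\<^sup>2 / n\<^sup>2 \<le> s\<^sup>2 / (4 * n)"
      using n by (intro divide_left_mono) (auto simp: power2_eq_square)
    then show ?thesis by (simp add: power_divide)
  qed
  finally have m2: "m\<^sup>2 \<le> s\<^sup>2 / (4 * n)" .
  have "3 / 4 * s\<^sup>2 / n \<le> sq_excess M / n" using R n by (intro divide_right_mono) auto
  also have "\<dots> \<le> q" unfolding q_def using n r R s
    by (intro divide_left_mono order.trans[OF _ less_imp_le[OF R(1)]]) auto
  finally have "q - m\<^sup>2 \<ge> s\<^sup>2 / (2 * n)" using m2 n by (simp add: field_simps)
  then have "n * k\<^sup>2 * (s\<^sup>2 / (2 * n)) \<le> n * k\<^sup>2 * (q - m\<^sup>2)"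
    using n by (intro mult_left_mono) auto
  moreover have "k * s = n / (r - 1)" using s by (simp add: k_def)
  then have "1 \<le> k * s" using n r by simp
  then have "1 \<le> (k * s)\<^sup>2" by (rule one_le_power)
  then have "1 / 2 \<le> n * k\<^sup>2 * (s\<^sup>2 / (2 * n))"
    using n by (simp add: power_mult_distrib)
  ultimately have T2: "1 / 2 \<le> n * k\<^sup>2 * (q - m\<^sup>2)" by linarith
  show ?thesis unfolding mean using T1 T2 by linarith
qed

text \<open>An optional stopping argument, run as an induction on the letters left. The equation
  \<open>sum_mset M + y = size M\<close> says that the walk from \<open>y\<close> is at 0 after the
  last letter. The range of \<open>v\<close> extends to 4 to leave room for the overshoot of a
  single step out of \<open>v < 1\<close>.\<close>

lemma mean_hitting_time_le_potential:
  fixes n s :: real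
  assumes "sum_mset M + y = size M" "size M \<le> n" "n \<ge> 16" "s \<ge> 1" "s \<le> n"
    and "sq_excess M \<le> s\<^sup>2 + 1" "n * y / (s * size M) \<le> 4"
    and "\<And>d. d \<in># M \<Longrightarrow> real d - 1 \<le> s"
  shows "mean_hitting_time M y \<le> potential n s M y"
  using assms
proof (induction "size M" arbitrary: M y)
  case 0
  then show ?case using potential_ge_size[of M n s y] mean_hitting_time_le_size[of M y] by fastforce
next
  case (Suc k)
  define v where "v = n * y / (s * size M)"
  note prems = Suc.prems[folded v_def]
  show ?case
  proof (cases "v \<ge> 1 \<or> sq_excess M \<le> 3 / 4 * s\<^sup>2 \<or> size M \<le> n / 2")
    case True
    then show ?thesis using potential_ge_size[of M n s y, folded v_def] prems
        mean_hitting_time_le_size[of M y] by linarith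
  next
    case False
    then have F: "v < 1" "3 / 4 * s\<^sup>2 < sq_excess M" "n / 2 < size M" by auto
    have M: "M \<noteq> {#}" using Suc.hyps by auto
    have r: "real (size M) > 8" using F prems by linarith
    show ?thesis
    proof (cases "y = 0")
      case True
      have "potential n s M 0 \<ge> 0"
        unfolding potential_def using prems by (auto intro!: add_nonneg_nonneg mult_nonneg_nonneg divide_nonneg_nonneg)
      then show ?thesis using True by simp
    next
      case y: False
      have "mean_hitting_time (M - {#d#}) (y - 1 + d) \<le> potential n s (M - {#d#}) (y - 1 + d)"
        if d: "d \<in># M" for d
      proof (rule Suc.hyps(1))
        have size: "size M = Suc (size (M - {#d#}))" using size_Suc_Diff1[OF d] by simp
        then show "k = size (M - {#d#})" using Suc.hyps(2) by simp
        have "sum_mset M = d + sum_mset (M - {#d#})" by (rule sum_mset.remove[OF d])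
        then show "sum_mset (M - {#d#}) + (y - 1 + d) = size (M - {#d#})"
          using prems(1) y size by simp
        show "real (size (M - {#d#})) \<le> n" using prems(2) size by simp
        show "sq_excess (M - {#d#}) \<le> s\<^sup>2 + 1"
          using prems(6) unfolding sq_excess_remove[OF d] by (smt (verit) zero_le_power2)
        have "y * n < s * size M" using F(1) prems r by (simp add: v_def field_simps)
        moreover have "real (y - 1 + d) \<le> y + s" using prems(8)[OF d] y by simp
        then have "n * real (y - 1 + d) \<le> n * (y + s)" using prems(3) by (intro mult_left_mono) auto
        ultimately have "n * real (y - 1 + d) \<le> s * size M + n * s" by (simp add: algebra_simps)
        \<comment> \<open>The overshoot: a height with \<open>v < 1\<close> plus a jump of at most
          \<open>s\<close>, measured with one letter fewer. As more than half of the letters are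
          left, \<open>v\<close> stays below 4.\<close>
        also have "\<dots> \<le> s * (4 * (size M - 1))"
        proof -
          have "r + n \<le> 4 * (r - 1)" if "n / 2 < r" "8 < r" for r
            using that by (simp add: field_simps)
          from this[OF F(3) r] have "size M + n \<le> 4 * (real (size M) - 1)" .
          then have "s * (size M + n) \<le> s * (4 * (real (size M) - 1))"
            using prems(4) by (intro mult_left_mono) auto
          moreover have "real (size M - 1) = real (size M) - 1" using size by simp
          ultimately show ?thesis by (simp add: algebra_simps)
        qed
        finally show "n * real (y - 1 + d) / (s * real (size (M - {#d#}))) \<le> 4"
          using size r prems by (simp add: field_simps)
        show "real e - 1 \<le> s" if "e \<in># M - {#d#}" for e
          using prems(8) that by (meson in_diffD)
      qed (use prems(3-5) in simp_all)
      then have "mset_mean (\<lambda>d. mean_hitting_time (M - {#d#}) (y - 1 + d)) M \<le>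
          mset_mean (\<lambda>d. potential n s (M - {#d#}) (y - 1 + d)) M"
        by (rule mset_mean_mono)
      then show ?thesis
        using mean_hitting_time_step[OF M, of y] potential_step[of M y n s, folded v_def] prems F y
        by linarith
    qed
  qed
qed

text \<open>At the start no letters and no squares are used up, so the potential reduces to its
  terms in \<open>v = 1 / s\<close>. The rest checks that no jump exceeds \<open>s\<close> and that
  \<open>s\<close> is at most the number of letters.\<close>

lemma mean_hitting_time_1_le:
  fixes s :: real
  assumes "size M = Suc (sum_mset M)" "size M \<ge> 16" "s \<ge> 1" "sq_excess M = s\<^sup>2 + 1"
  shows "mean_hitting_time M 1 \<le> 153 * size M / s"
proof -
  have le: "real d - 1 \<le> s" if "d \<in># M" for d
  proof (cases "d \<le> 1")
    case False
    \<comment> \<open>The letters sum to less than their number, so one of them is 0. Its square is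
      the \<open>+ 1\<close> in \<open>s^2 + 1\<close>, which leaves at most \<open>s^2\<close> for
      the letter \<open>d\<close>.\<close>
    have "0 \<in># M"
    proof (rule ccontr)
      assume "0 \<notin># M"
      then have "size M \<le> sum_mset M"
      proof (induction M)
        case (add x M)
        then show ?case by (cases x) auto
      qed simp
      then show False using assms by simp
    qed
    then have 0: "0 \<in># M - {#d#}" using False by (simp add: in_diff_count)
    have "sq_excess M = (real d - 1)\<^sup>2 + (1 + sq_excess (M - {#d#} - {#0#}))"
      using sq_excess_remove[OF that] sq_excess_remove[OF 0] by simp
    moreover have "sq_excess (M - {#d#} - {#0#}) \<ge> 0"
      by (rule sq_excess_nonneg)
    ultimately have "(real d - 1)\<^sup>2 \<le> s\<^sup>2" using assms(4) by linarith
    then show ?thesis by (rule power2_le_imp_le) (use assms(3) in simp)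
  qed (use assms(3) in simp)
  have "s \<le> size M"
  proof -
    have "sq_excess M \<le> (real (sum_mset M))\<^sup>2 + size M"
    proof (induction M)
      case (add x M)
      have "(real x - 1)\<^sup>2 \<le> (real x)\<^sup>2 + 1" by (simp add: power2_eq_square algebra_simps)
      moreover have "a\<^sup>2 + b\<^sup>2 \<le> (a + b)\<^sup>2" if "a \<ge> 0" "b \<ge> 0" for a b :: real
        using that by (simp add: power2_sum)
      then have "(real x)\<^sup>2 + (real (sum_mset M))\<^sup>2 \<le> (real x + real (sum_mset M))\<^sup>2"
        using of_nat_0_le_iff by blast
      ultimately show ?case using add by (simp add: sq_excess_def)
    qed (simp add: sq_excess_def)
    also have "\<dots> \<le> (real (size M))\<^sup>2 + 1"
    proof -
      have "a\<^sup>2 + b \<le> b\<^sup>2 + 1" if "b = a + 1" "a \<ge> 0" for a b :: real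
        using that by (simp add: power2_sum)
      then show ?thesis using assms(1) of_nat_0_le_iff of_nat_Suc by (metis add.commute)
    qed
    finally have "s\<^sup>2 \<le> (real (size M))\<^sup>2" using assms(4) by simp
    then show ?thesis by (rule power2_le_imp_le) simp
  qed
  have nz: "M \<noteq> {#}" using assms(2) by auto
  have v: "n * real 1 / (s * n) \<le> 4" if "n \<ge> 16" for n :: real using that assms by (simp add: field_simps)
  have "mean_hitting_time M 1 \<le> potential (size M) s M 1"
  proof (rule mean_hitting_time_le_potential)
    show n: "16 \<le> real (size M)" using assms(2) by linarith
    show "real (size M) * real 1 / (s * real (size M)) \<le> 4" by (rule v[OF n])
    show "sum_mset M + 1 = size M" unfolding assms(1) by (rule Suc_eq_plus1[symmetric])
  qed (use assms(3,4) le \<open>s \<le> size M\<close> in \<open>simp_all only: order.refl\<close>)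
  also have "\<dots> = 153 * (real (size M) / s) - 38 * (size M / s\<^sup>2)"
    using nz assms(3,4) by (simp add: potential_def power_divide power2_eq_square algebra_simps)
  also have "\<dots> \<le> 153 * size M / s" by simp
  finally show ?thesis .
qed

section \<open>Plane trees\<close>

lemma Cons_in_nodes_iff: "i # u \<in> nodes (Root ts) \<longleftrightarrow> i < length ts \<and> u \<in> nodes (ts ! i)"
  by (auto simp: nodes_Root)

lemma Nil_in_nodes [simp]: "[] \<in> nodes t"
  by (cases t) (simp add: nodes_Root)

lemma num_offspring_Nil: "num_offspring (nodes (Root ts)) [] = length ts"
  by (simp add: num_offspring_def Cons_in_nodes_iff)

lemma num_offspring_Cons:
  "i < length ts \<Longrightarrow> num_offspring (nodes (Root ts)) (i # u) = num_offspring (nodes (ts ! i)) u"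
  by (simp add: num_offspring_def Cons_in_nodes_iff)

lemma count_degree_word:
  "count (mset (degree_word t)) d = card {u \<in> nodes t. num_offspring (nodes t) u = d}"
proof (induction t)
  case (Root ts)
  let ?f = "\<lambda>t u. if num_offspring (nodes t) u = d then 1 else (0 :: nat)"
  have card: "card {u \<in> nodes t. num_offspring (nodes t) u = d} = sum (?f t) (nodes t)" for t
    by (simp add: sum.If_cases Int_def)
  have 1: "count (mset (forest_word us)) d = (\<Sum>t\<leftarrow>us. count (mset (degree_word t)) d)" for us
    by (induction us) auto
  have "sum (?f (Root ts)) (nodes (Root ts)) =
      (if length ts = d then 1 else 0) + (\<Sum>i<length ts. sum (?f (ts ! i)) (nodes (ts ! i)))"
    by (simp add: sum_nodes_Root num_offspring_Nil num_offspring_Cons)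
  also have "(\<Sum>i<length ts. sum (?f (ts ! i)) (nodes (ts ! i))) = (\<Sum>i<length ts. count (mset (degree_word (ts ! i))) d)"
    using Root by (simp add: card)
  also have "\<dots> = count (mset (forest_word ts)) d"
    by (simp add: 1 sum_list_sum_nth atLeast0LessThan)
  finally show ?case by (simp add: card)
qed

lemma plane_tree_nodes: "plane_tree (nodes t)"
proof (induction t)
  case (Root ts)
  have "u \<in> nodes (Root ts) \<and> (\<forall>j<i. u @ [j] \<in> nodes (Root ts))" if "u @ [i] \<in> nodes (Root ts)" for u i
  proof (cases u)
    case Nil
    then show ?thesis using that by (auto simp: Cons_in_nodes_iff)
  next
    case (Cons k v)
    then have "k < length ts" "v @ [i] \<in> nodes (ts ! k)" using that by (auto simp: Cons_in_nodes_iff)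
    moreover from this have "plane_tree (nodes (ts ! k))" using Root by simp
    ultimately show ?thesis using Cons unfolding plane_tree_def by (simp add: Cons_in_nodes_iff)
  qed
  then show ?case by (simp add: plane_tree_def)
qed

lemma inj_nodes: "nodes t = nodes t' \<Longrightarrow> t = t'"
proof (induction t arbitrary: t')
  case (Root ts)
  obtain us where t': "t' = Root us" by (cases t')
  have len: "length ts = length us"
    using arg_cong[OF Root.prems, of "\<lambda>T. num_offspring T []"] by (simp add: t' num_offspring_Nil)
  have "ts ! i = us ! i" if "i < length ts" for i
  proof (rule Root.IH)
    show "nodes (ts ! i) = nodes (us ! i)"
    proof (rule set_eqI)
      fix u
      have "i # u \<in> nodes (Root ts) \<longleftrightarrow> i # u \<in> nodes (Root us)" using Root.prems t' by simp
      then show "u \<in> nodes (ts ! i) \<longleftrightarrow> u \<in> nodes (us ! i)" using that len by (simp add: Cons_in_nodes_iff)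
    qed
  qed (use that in simp)
  then show ?case using len t' by (simp add: list_eq_iff_nth_eq)
qed

lemma plane_tree_finite: "plane_tree T \<Longrightarrow> finite T"
  by (simp add: plane_tree_def)

lemma plane_tree_Nil: "plane_tree T \<Longrightarrow> [] \<in> T"
  by (simp add: plane_tree_def)

lemma plane_treeD:
  "plane_tree T \<Longrightarrow> u @ [i] \<in> T \<Longrightarrow> u \<in> T \<and> (\<forall>j<i. u @ [j] \<in> T)"
  by (simp add: plane_tree_def)

lemma plane_tree_subtree:
  assumes "plane_tree T" "[i] \<in> T"
  shows "plane_tree {u. i # u \<in> T}"
proof -
  have "finite ((#) i ` {u. i # u \<in> T})"
    by (rule finite_subset[OF _ plane_tree_finite[OF assms(1)]]) auto
  then have "finite {u. i # u \<in> T}" by (rule finite_imageD) simp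
  moreover have "i # u \<in> T \<and> (\<forall>k<j. i # u @ [k] \<in> T)" if "i # u @ [j] \<in> T" for u j
    using plane_treeD[OF assms(1), of "i # u" j] that by simp
  ultimately show ?thesis unfolding plane_tree_def mem_Collect_eq using assms(2) by blast
qed

lemma plane_tree_prefix:
  assumes "plane_tree T" "u @ v \<in> T"
  shows "u \<in> T"
  using assms(2)
proof (induction v rule: rev_induct)
  case (snoc i v)
  then show ?case using plane_treeD[OF assms(1), of "u @ v" i] by simp
qed simp

text \<open>\<open>num_offspring\<close> only sees a cardinality; closure under left siblings makes
  the index set an initial segment, which its cardinality determines.\<close>

lemma children_eq_lessThan:
  assumes "plane_tree T"
  shows "{i. u @ [i] \<in> T} = {..<num_offspring T u}"
proof -
  let ?A = "{i. u @ [i] \<in> T}"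
  have "finite ((\<lambda>i. u @ [i]) ` ?A)"
    by (rule finite_subset[OF _ plane_tree_finite[OF assms(1)]]) auto
  then have fin: "finite ?A" by (rule finite_imageD) (simp add: inj_on_def)
  have down: "j \<in> ?A" if "i \<in> ?A" "j < i" for i j
    using that plane_treeD[OF assms] by blast
  have "\<exists>n. ?A = {..<n}"
  proof (cases "?A = {}")
    case False
    have "?A = {..<Suc (Max ?A)}"
    proof (intro equalityI subsetI)
      fix i assume "i \<in> {..<Suc (Max ?A)}"
      then have "i = Max ?A \<or> i < Max ?A" by auto
      then show "i \<in> ?A" using Max_in[OF fin False] down by blast
    qed (use fin in \<open>auto simp: less_Suc_eq_le\<close>)
    then show ?thesis by blast
  qed (auto intro: exI[of _ 0])
  then obtain n where n: "?A = {..<n}" ..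
  then show ?thesis by (simp add: num_offspring_def)
qed

lemma ex_nodes_eq_plane_tree:
  assumes "plane_tree T"
  shows "\<exists>t. T = nodes t"
  using assms
proof (induction "card T" arbitrary: T rule: less_induct)
  case less
  let ?d = "num_offspring T []"
  have ch: "[i] \<in> T \<longleftrightarrow> i < ?d" for i
    using children_eq_lessThan[OF less.prems, of "[]"] by auto
  have "\<exists>t. {u. i # u \<in> T} = nodes t" if "i < ?d" for i
  proof (rule less.hyps)
    have fin: "finite T" "[] \<in> T" using less.prems by (simp_all only: plane_tree_finite plane_tree_Nil)
    have "card {u. i # u \<in> T} = card ((#) i ` {u. i # u \<in> T})" by (simp add: card_image)
    also have "\<dots> < card T" by (rule psubset_card_mono) (use fin in auto)
    finally show "card {u. i # u \<in> T} < card T" .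
    show "plane_tree {u. i # u \<in> T}" using plane_tree_subtree[OF less.prems] ch that by simp
  qed
  then obtain f where f: "\<And>i. i < ?d \<Longrightarrow> {u. i # u \<in> T} = nodes (f i)" by metis
  have "T = nodes (Root (map f [0..<?d]))"
  proof (rule set_eqI)
    fix u
    show "u \<in> T \<longleftrightarrow> u \<in> nodes (Root (map f [0..<?d]))"
    proof (cases u)
      case Nil
      then show ?thesis using plane_tree_Nil[OF less.prems] by simp
    next
      case (Cons i v)
      have "i # v \<in> T \<Longrightarrow> [i] \<in> T" using plane_tree_prefix[OF less.prems, of "[i]" v] by simp
      moreover have "i # v \<in> T \<longleftrightarrow> v \<in> nodes (f i)" if "i < ?d" using f[OF that] by blast
      moreover have "u \<in> nodes (Root (map f [0..<?d])) \<longleftrightarrow> i < ?d \<and> v \<in> nodes (f i)"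
        unfolding Cons by (auto simp: Cons_in_nodes_iff)
      ultimately show ?thesis unfolding Cons ch by blast
    qed
  qed
  then show ?case ..
qed

lemma nodes_in_trees_with_degrees_iff:
  assumes "count M = N"
  shows "nodes t \<in> trees_with_degrees N \<longleftrightarrow> mset (degree_word t) = M"
  unfolding trees_with_degrees_def multiset_eq_iff assms
  by (simp only: mem_Collect_eq plane_tree_nodes count_degree_word simp_thms)

lemma bij_betw_nodes:
  assumes "count M = N"
  shows "bij_betw nodes {t. mset (degree_word t) = M} (trees_with_degrees N)"
proof (rule bij_betw_imageI)
  show "inj_on nodes {t. mset (degree_word t) = M}"
    using inj_nodes by (auto simp: inj_on_def)
  show "nodes ` {t. mset (degree_word t) = M} = trees_with_degrees N"
  proof (intro equalityI subsetI)
    fix T assume "T \<in> trees_with_degrees N"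
    moreover from this obtain t where "T = nodes t"
      using ex_nodes_eq_plane_tree by (auto simp: trees_with_degrees_def)
    ultimately show "T \<in> nodes ` {t. mset (degree_word t) = M}"
      using nodes_in_trees_with_degrees_iff[OF assms] by auto
  qed (use nodes_in_trees_with_degrees_iff[OF assms] in auto)
qed

text \<open>In the discrete space \<open>nat\<close> convergent partial sums are eventually
  constant.\<close>

lemma summable_nat_finite_support:
  assumes "summable (f :: nat \<Rightarrow> nat)"
  shows "finite {i. f i \<noteq> 0}"
proof -
  obtain l where "(\<lambda>n. sum f {..<n}) \<longlonglongrightarrow> l"
    using assms by (auto simp: summable_def sums_def)
  then have "eventually (\<lambda>n. sum f {..<n} = l) sequentially" by (simp add: tendsto_discrete)
  then obtain k where k': "\<forall>n\<ge>k. sum f {..<n} = l" unfolding eventually_sequentially ..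
  then have k: "sum f {..<n} = l" if "n \<ge> k" for n using that by blast
  have f0: "f i = 0" if "i \<ge> k" for i
  proof -
    have "sum f {..<i} + f i = l" using k[OF le_SucI[OF that]] unfolding sum.lessThan_Suc .
    moreover have "sum f {..<i} = l" by (rule k[OF that])
    ultimately show ?thesis by (metis add_cancel_right_right)
  qed
  have "{i. f i \<noteq> 0} \<subseteq> {..<k}"
  proof
    fix i assume "i \<in> {i. f i \<noteq> 0}"
    then have nz: "f i \<noteq> 0" by simp
    show "i \<in> {..<k}"
    proof (rule ccontr)
      assume "i \<notin> {..<k}"
      then have "k \<le> i" by simp
      from f0[OF this] nz show False by simp
    qed
  qed
  then show ?thesis by (rule finite_subset) simp
qed

text \<open>The last identity is where \<open>deg_sigma\<close> meets the walk:
  \<open>(d - 1)^2 = d (d - 1) - d + 1\<close>, and \<open>1 - d\<close> sums to 1 over all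
  letters.\<close>

lemma degree_multiset:
  assumes "degree_sequence N"
  obtains M where "count M = N" "size M = num_vertices N" "size M = Suc (sum_mset M)"
    "sq_excess M = (deg_sigma N)\<^sup>2 + 1"
proof -
  have fin: "finite {i. N i > 0}"
    using summable_nat_finite_support[of N] assms by (simp add: degree_sequence_def)
  define M where "M = Abs_multiset N"
  have cnt: "count M = N" using fin by (simp add: M_def Abs_multiset_inverse)
  have set: "set_mset M = {i. N i > 0}" by (simp add: set_mset_def cnt)
  have sum: "(\<Sum>i. f i * N i) = (\<Sum>i | N i > 0. f i * N i)" for f
    by (rule suminf_finite) (use fin in auto)
  have size: "size M = num_vertices N"
    using sum[of "\<lambda>_. 1"] by (simp add: num_vertices_def size_multiset_overloaded_eq set cnt)
  have real_sum: "(\<Sum>d\<in>#M. f d) = (\<Sum>i | N i > 0. N i * f i)" for f :: "nat \<Rightarrow> real"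
    by (simp add: sum_mset_image_eq_sum_count set cnt)
  have "real (sum_mset M) = (\<Sum>i | N i > 0. real (N i) * real i)"
    using real_sum[of real] by simp
  also have "\<dots> = real (\<Sum>i. i * N i)"
    unfolding sum[of "\<lambda>i. i"] by (simp add: mult.commute)
  finally have "sum_mset M = (\<Sum>i. i * N i)" by (simp only: of_nat_eq_iff)
  then have size2: "size M = Suc (sum_mset M)"
    using assms size by (simp add: degree_sequence_def num_vertices_def)
  have real_size: "real (size M) = (\<Sum>i | N i > 0. real (N i))"
    using real_sum[of "\<lambda>_. 1"] by simp
  have "(deg_sigma N)\<^sup>2 = real (\<Sum>i. i * (i - 1) * N i)"
    unfolding deg_sigma_def by simp
  also have "\<dots> = (\<Sum>i | N i > 0. real (i * (i - 1) * N i))"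
    unfolding sum by simp
  also have "\<dots> = (\<Sum>i | N i > 0. real (N i) * (real i - 1)\<^sup>2 + (real (N i) * real i - real (N i)))"
  proof (rule sum.cong[OF refl])
    fix i
    have "real (i * (i - 1)) = real i * (real i - 1)" by (cases i) (auto simp: algebra_simps)
    then show "real (i * (i - 1) * N i) = real (N i) * (real i - 1)\<^sup>2 + (real (N i) * real i - real (N i))"
      unfolding of_nat_mult[of _ "N i"] by (simp only:) (simp add: algebra_simps power2_eq_square)
  qed
  also have "\<dots> = sq_excess M + (real (sum_mset M) - real (size M))"
    using real_sum[of real] real_sum[of "\<lambda>d. (real d - 1)\<^sup>2"]
    by (simp add: sum.distrib sum_subtractf real_size sq_excess_def)
  finally have sq: "sq_excess M = (deg_sigma N)\<^sup>2 + 1" unfolding size2 of_nat_Suc by linarith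
  show thesis by (rule that[OF cnt size size2 sq])
qed

lemma finite_trees_with_degrees: "degree_sequence N \<Longrightarrow> finite (trees_with_degrees N)"
  and trees_with_degrees_nonempty: "degree_sequence N \<Longrightarrow> trees_with_degrees N \<noteq> {}"
proof -
  assume "degree_sequence N"
  then obtain M where M: "count M = N" "size M = Suc (sum_mset M)" by (rule degree_multiset) (rule that)
  show "finite (trees_with_degrees N)"
    using bij_betw_finite[OF bij_betw_nodes[OF M(1)]] sum_nodes_eq_sum_hitting_time(3)[OF M(2)] by simp
  have "card (permutations_of_multiset M) > 0" by (simp add: card_gt_0_iff)
  then have "card {t. mset (degree_word t) = M} > 0"
    unfolding sum_nodes_eq_sum_hitting_time(2)[OF M(2), symmetric] nat_0_less_mult_iff ..
  then have "card (trees_with_degrees N) > 0"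
    using bij_betw_same_card[OF bij_betw_nodes[OF M(1)]] by simp
  then show "trees_with_degrees N \<noteq> {}" by auto
qed

text \<open>There are \<open>num_vertices N\<close> arrangements per tree, which supplies the second
  factor \<open>num_vertices N\<close> next to the mean hitting time.\<close>

lemma sum_length_trees_le:
  assumes "degree_sequence N" "num_vertices N \<ge> 16" "deg_sigma N \<ge> 1"
  shows "(\<Sum>T\<in>trees_with_degrees N. \<Sum>u\<in>T. real (length u)) \<le>
    card (trees_with_degrees N) * (153 * (num_vertices N)\<^sup>2 / deg_sigma N)"
proof -
  obtain M where M: "count M = N" "size M = num_vertices N" "size M = Suc (sum_mset M)"
      "sq_excess M = (deg_sigma N)\<^sup>2 + 1"
    by (rule degree_multiset[OF assms(1)])
  let ?P = "card (permutations_of_multiset M)" and ?n = "num_vertices N"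
  note bij = bij_betw_nodes[OF M(1)]
  have card: "?P = card (trees_with_degrees N) * ?n"
    unfolding sum_nodes_eq_sum_hitting_time(2)[OF M(3), symmetric] bij_betw_same_card[OF bij] M(2) by (rule refl)
  have 16: "16 \<le> size M" unfolding M(2) by (rule assms(2))
  have P: "?P > 0" by (simp add: card_gt_0_iff)
  have "(\<Sum>T\<in>trees_with_degrees N. \<Sum>u\<in>T. real (length u)) \<le>
      (\<Sum>T\<in>trees_with_degrees N. \<Sum>u\<in>T. real (Suc (length u)))"
    by (intro sum_mono) auto
  also have "\<dots> = (\<Sum>t | mset (degree_word t) = M. \<Sum>u\<in>nodes t. real (Suc (length u)))"
    by (rule sum.reindex_bij_betw[OF bij, symmetric])
  also have "\<dots> = real (\<Sum>t | mset (degree_word t) = M. \<Sum>u\<in>nodes t. Suc (length u))"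
    by (simp only: of_nat_sum)
  also have "\<dots> = ?P * mean_hitting_time M 1"
    unfolding sum_nodes_eq_sum_hitting_time(1)[OF M(3)] using P by (simp add: mean_hitting_time_def)
  also have "\<dots> \<le> ?P * (153 * ?n / deg_sigma N)"
    by (rule mult_left_mono[OF mean_hitting_time_1_le[OF M(3) 16 assms(3) M(4), unfolded M(2)]]) simp
  also have "\<dots> = card (trees_with_degrees N) * (153 * ?n\<^sup>2 / deg_sigma N)"
    unfolding card by (simp add: power2_eq_square)
  finally show ?thesis .
qed

section \<open>The Skorohod topology\<close>

subsection \<open>Time changes\<close>

lemma time_changesD:
  assumes "l \<in> time_changes"
  shows "s \<ge> 0 \<Longrightarrow> s < t \<Longrightarrow> l s < l t" "s \<ge> 0 \<Longrightarrow> t \<ge> 0 \<Longrightarrow> l s < l t \<longleftrightarrow> s < t"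
    "s \<ge> 0 \<Longrightarrow> t \<ge> 0 \<Longrightarrow> l s \<le> l t \<longleftrightarrow> s \<le> t" "t \<ge> 0 \<Longrightarrow> l t \<ge> 0"
    "u \<ge> 0 \<Longrightarrow> \<exists>t\<ge>0. l t = u" "l 0 = 0"
proof -
  have mono: "strict_mono_on {0..} l" and img: "l ` {0..} = {0..}"
    using assms by (auto simp: time_changes_def)
  show 1: "l s < l t" if "s \<ge> 0" "s < t" for s t
    using strict_mono_onD[OF mono] that by simp
  show 2: "l s < l t \<longleftrightarrow> s < t" if "s \<ge> 0" "t \<ge> 0" for s t
    using 1[of s t] 1[of t s] that by (cases s t rule: linorder_cases) auto
  show "l s \<le> l t \<longleftrightarrow> s \<le> t" if "s \<ge> 0" "t \<ge> 0" for s t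
    using 2[of t s] that by (simp add: not_less[symmetric])
  show 3: "l t \<ge> 0" if "t \<ge> 0" for t using img that by auto
  show 4: "\<exists>t\<ge>0. l t = u" if "u \<ge> 0" for u
  proof -
    have "u \<in> l ` {0..}" using img that by simp
    then show ?thesis by auto
  qed
  obtain t where t: "t \<ge> 0" "l t = 0" using 4[of 0] by auto
  then show "l 0 = 0" using 1[of 0 t] 3[of 0] by (cases "t = 0") auto
qed

text \<open>\<open>l\<close> is kept up to \<open>m\<close>, continued linearly from
  \<open>(m, l m)\<close> to \<open>(b, c)\<close>, and then with slope one. On the middle piece the
  displacement is a convex combination of those at \<open>m\<close> and \<open>b\<close>, so it
  stays below \<open>e\<close>.\<close>

lemma extend_time_change:
  assumes l: "l \<in> time_changes" and lin: "\<And>t. t \<ge> m \<Longrightarrow> l t = l m + (t - m)"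
    and m: "0 \<le> m" "m < b" "l m < c"
    and close: "\<And>t. t \<ge> 0 \<Longrightarrow> \<bar>l t - t\<bar> < e" "\<bar>c - b\<bar> < e"
  shows "\<exists>l'\<in>time_changes. (\<forall>t\<ge>b. l' t = c + (t - b)) \<and> (\<forall>t\<le>m. l' t = l t) \<and> (\<forall>t\<ge>0. \<bar>l' t - t\<bar> < e)"
proof -
  define k where "k = (c - l m) / (b - m)"
  have k: "k > 0" using m by (simp add: k_def)
  have kb: "k * (b - m) = c - l m" using m by (simp add: k_def)
  define l' where "l' = (\<lambda>t. if t \<le> m then l t else if t \<le> b then l m + k * (t - m) else c + (t - b))"
  have below: "l' t = l t" if "t \<le> m" for t using that by (simp add: l'_def)
  have mid: "l' t = l m + k * (t - m)" if "m \<le> t" "t \<le> b" for t using that by (auto simp: l'_def)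
  have above: "l' t = c + (t - b)" if "b \<le> t" for t using that m kb by (auto simp: l'_def)
  have "l' s < l' t" if "0 \<le> s" "s < t" for s t
  proof -
    have lo: "l' s < l' t" if "0 \<le> s" "s < t" "t \<le> m" for s t
      using that below time_changesD(1)[OF l] by simp
    have mi: "l' s < l' t" if "m \<le> s" "s < t" "t \<le> b" for s t
      using that k by (simp add: mid)
    have hi: "l' s < l' t" if "b \<le> s" "s < t" for s t
      using that by (simp add: above)
    consider "t \<le> m" | "s < m" "m < t" "t \<le> b" | "s < m" "b < t" | "m \<le> s" "t \<le> b"
      | "m \<le> s" "s < b" "b < t" | "b \<le> s" using \<open>s < t\<close> by linarith
    then show ?thesis
    proof cases
      case 2
      then show ?thesis using lo[of s m] mi[of m t] that by simp
    next
      case 3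
      then show ?thesis using lo[of s m] mi[of m b] hi[of b t] that m by simp
    next
      case 5
      then show ?thesis using mi[of s b] hi[of b t] by simp
    qed (use lo mi hi that in auto)
  qed
  then have mono: "strict_mono_on {0..} l'" by (auto simp: strict_mono_on_def)
  have "l' ` {0..} = {0..}"
  proof (intro equalityI subsetI)
    fix u assume "u \<in> l' ` {0..}"
    then obtain t where t: "t \<ge> 0" "u = l' t" by auto
    have "l' 0 = 0" using below m(1) time_changesD(6)[OF l] by simp
    then show "u \<in> {0..}"
      using strict_mono_onD[OF mono, of 0 t] t by (cases "t = 0") auto
  next
    fix u :: real assume "u \<in> {0..}"
    then have u: "u \<ge> 0" by simp
    consider "u \<le> l m" | "l m < u" "u \<le> c" | "c < u" by linarith
    then have "\<exists>t\<ge>0. l' t = u"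
    proof cases
      case 1
      obtain t where t: "t \<ge> 0" "l t = u" using time_changesD(5)[OF l u] by auto
      then have "t \<le> m" using 1 time_changesD(3)[OF l, of t m] m by simp
      then show ?thesis using t below by auto
    next
      case 2
      define t where "t = m + (u - l m) / k"
      have "(u - l m) / k \<le> b - m" using 2 kb k by (simp add: pos_divide_le_eq mult.commute)
      moreover have "(u - l m) / k \<ge> 0" using 2 k by simp
      ultimately show ?thesis using m k by (intro exI[of _ t]) (auto simp: mid t_def)
    next
      case 3
      then show ?thesis using m by (intro exI[of _ "b + (u - c)"]) (auto simp: above)
    qed
    then show "u \<in> l' ` {0..}" by auto
  qed
  then have "l' \<in> time_changes" using mono by (simp add: time_changes_def)
  moreover have "\<bar>l' t - t\<bar> < e" if t: "t \<ge> 0" for t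
  proof -
    consider "t \<le> m" | "m \<le> t" "t \<le> b" | "b \<le> t" by linarith
    then show ?thesis
    proof cases
      case 2
      define h where "h = (t - m) / (b - m)"
      have h: "0 \<le> h" "h \<le> 1" using 2 m by (auto simp: h_def)
      have "h * (b - m) = t - m" using m by (simp add: h_def)
      moreover have "k * (t - m) = h * (c - l m)" using m by (simp add: k_def h_def)
      ultimately have "l' t - t = (1 - h) * (l m - m) + h * (c - b)"
        using mid[OF 2] by (simp add: algebra_simps)
      also have "\<bar>\<dots>\<bar> \<le> (1 - h) * \<bar>l m - m\<bar> + h * \<bar>c - b\<bar>"
        using h by (intro order.trans[OF abs_triangle_ineq]) (simp add: abs_mult)
      also have "\<dots> < e"
        using convex_bound_lt[OF close(1)[OF m(1)] close(2), of "1 - h" h] h by simp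
      finally show ?thesis .
    qed (use t close below above in auto)
  qed
  ultimately show ?thesis using above below by (intro bexI[of _ l']) auto
qed

lemma chain_le:
  fixes a :: "nat \<Rightarrow> 'a::order"
  assumes "\<And>i. i < n \<Longrightarrow> a i \<le> a (Suc i)" "i \<le> j" "j \<le> n"
  shows "a i \<le> a j"
  using assms(2,3)
proof (induction j rule: dec_induct)
  case (step j)
  then have "a i \<le> a j" "a j \<le> a (Suc j)" using assms(1)[of j] by simp_all
  then show ?case by (rule order.trans)
qed simp

lemma ex_time_change_seq:
  fixes a c :: "nat \<Rightarrow> real"
  assumes "a 0 = 0" "c 0 = 0" "e > 0"
    and "\<And>i. i < n \<Longrightarrow> a i < a (Suc i)" "\<And>i. i < n \<Longrightarrow> c i < c (Suc i)"
    and "\<And>i. i \<le> n \<Longrightarrow> \<bar>c i - a i\<bar> < e"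
  shows "\<exists>l\<in>time_changes. (\<forall>i\<le>n. l (a i) = c i) \<and> (\<forall>t\<ge>0. \<bar>l t - t\<bar> < e)"
proof -
  \<comment> \<open>Strengthened for the induction: behind its last node the time change has slope
    one, the form that \<open>extend_time_change\<close> continues.\<close>
  have "0 \<le> a n \<and> (\<exists>l\<in>time_changes. (\<forall>i\<le>n. l (a i) = c i) \<and> (\<forall>t\<ge>0. \<bar>l t - t\<bar> < e)
      \<and> (\<forall>t\<ge>a n. l t = l (a n) + (t - a n)))"
    using assms(4-6)
  proof (induction n)
    case 0
    have "id \<in> time_changes" by (simp add: time_changes_def strict_mono_on_def)
    then show ?case using assms(1-3) by (intro conjI bexI[of _ id]) auto
  next
    case (Suc n)
    have "0 \<le> a n \<and> (\<exists>l\<in>time_changes. (\<forall>i\<le>n. l (a i) = c i) \<and> (\<forall>t\<ge>0. \<bar>l t - t\<bar> < e)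
        \<and> (\<forall>t\<ge>a n. l t = l (a n) + (t - a n)))"
      by (rule Suc.IH) (rule Suc.prems, simp)+
    then obtain l where l: "l \<in> time_changes" "\<forall>i\<le>n. l (a i) = c i" "\<forall>t\<ge>0. \<bar>l t - t\<bar> < e"
        "\<forall>t\<ge>a n. l t = l (a n) + (t - a n)" and an: "0 \<le> a n" by blast
    have lt: "a n < a (Suc n)" "l (a n) < c (Suc n)" "\<bar>c (Suc n) - a (Suc n)\<bar> < e"
      using Suc.prems(1,2)[of n] Suc.prems(3)[of "Suc n"] l(2)[rule_format, of n] by simp_all
    have "\<exists>l'\<in>time_changes. (\<forall>t\<ge>a (Suc n). l' t = c (Suc n) + (t - a (Suc n)))
        \<and> (\<forall>t\<le>a n. l' t = l t) \<and> (\<forall>t\<ge>0. \<bar>l' t - t\<bar> < e)"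
      by (rule extend_time_change[OF l(1) _ an lt(1,2) _ lt(3)]) (use l(3,4) in blast)+
    then obtain l' where l': "l' \<in> time_changes" "\<forall>t\<ge>a (Suc n). l' t = c (Suc n) + (t - a (Suc n))"
      "\<forall>t\<le>a n. l' t = l t" "\<forall>t\<ge>0. \<bar>l' t - t\<bar> < e" by blast
    have "a i \<le> a n" if "i \<le> n" for i
      by (rule chain_le[of "Suc n"]) (use that in \<open>auto intro!: less_imp_le Suc.prems(1)\<close>)
    then have "l' (a i) = c i" if "i \<le> Suc n" for i
      using that l(2) l'(2)[rule_format, of "a (Suc n)"] l'(3)[rule_format, of "a i"] by (cases "i = Suc n") auto
    then show ?case using l' lt(1) an by (intro conjI bexI[of _ l']) auto
  qed
  then show ?thesis by blast
qed

lemma ex_time_change_set: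
  fixes g :: "real \<Rightarrow> real"
  assumes A: "finite A" "\<And>a. a \<in> A \<Longrightarrow> 0 < a" and g: "strict_mono_on A g" "\<And>a. a \<in> A \<Longrightarrow> 0 < g a"
    and e: "e > 0" "\<And>a. a \<in> A \<Longrightarrow> \<bar>g a - a\<bar> < e"
  shows "\<exists>l\<in>time_changes. (\<forall>a\<in>A. l a = g a) \<and> (\<forall>t\<ge>0. \<bar>l t - t\<bar> < e)"
proof -
  define xs where "xs = sorted_list_of_set A"
  have xs: "set xs = A" "sorted_wrt (<) xs" using A(1) by (auto simp: xs_def)
  define a where "a i = (if i = 0 then 0 else xs ! (i - 1))" for i
  define c where "c i = (if i = 0 then 0 else g (xs ! (i - 1)))" for i
  have in_A: "xs ! i \<in> A" if "i < length xs" for i using that xs(1) nth_mem by blast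
  have less: "xs ! i < xs ! Suc i" if "Suc i < length xs" for i
    using sorted_wrt_nth_less[OF xs(2), of i "Suc i"] that by simp
  have "\<exists>l\<in>time_changes. (\<forall>i\<le>length xs. l (a i) = c i) \<and> (\<forall>t\<ge>0. \<bar>l t - t\<bar> < e)"
  proof (rule ex_time_change_seq)
    fix i assume i: "i < length xs"
    show "a i < a (Suc i)"
      using i A(2) in_A less[of "i - 1"] by (cases i) (auto simp: a_def)
    show "c i < c (Suc i)"
    proof (cases i)
      case (Suc j)
      then have "g (xs ! j) < g (xs ! Suc j)"
        using i less[of j] in_A[of j] in_A[of "Suc j"] strict_mono_onD[OF g(1)] by simp
      then show ?thesis using Suc by (simp add: c_def)
    qed (use i g(2) in_A in \<open>auto simp: c_def\<close>)
  next
    fix i assume "i \<le> length xs"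
    then show "\<bar>c i - a i\<bar> < e" using e in_A by (auto simp: a_def c_def)
  qed (use e in \<open>auto simp: a_def c_def\<close>)
  then obtain l where l: "l \<in> time_changes" "\<forall>i\<le>length xs. l (a i) = c i" "\<forall>t\<ge>0. \<bar>l t - t\<bar> < e" by blast
  have "l x = g x" if "x \<in> A" for x
  proof -
    have "x \<in> set xs" using that xs(1) by simp
    then obtain i where "i < length xs" "xs ! i = x" unfolding in_set_conv_nth by blast
    then show ?thesis using l(2)[rule_format, of "Suc i"] by (simp add: a_def c_def)
  qed
  then show ?thesis using l by blast
qed

lemma cadlag_undefined: "x \<in> cadlag S \<Longrightarrow> t < 0 \<Longrightarrow> x t = undefined"
  by (rule PiE_arb[of x "{0..}" "\<lambda>_. S"]) (simp_all add: cadlag_def)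

text \<open>A Hausdorff property. A path \<open>w\<close> close to both is compared slightly to the
  right of \<open>t\<close>: the time changes move the comparison times only a little, so they stay
  where right-continuity keeps \<open>x\<close> and \<open>z\<close> near their values at
  \<open>t\<close>. At \<open>t\<close> itself a time change could land on the far side of a
  jump.\<close>

lemma J1_nbhd_separates:
  assumes x: "x \<in> cadlag S" and z: "z \<in> cadlag S"
    and meet: "\<And>T e. T > 0 \<Longrightarrow> e > 0 \<Longrightarrow> J1_nbhd S x T e \<inter> J1_nbhd S z T e \<noteq> {}"
  shows "x = z"
proof
  fix t
  show "x t = z t"
  proof (cases "t \<ge> 0")
    case False
    then show ?thesis using cadlag_undefined[OF x] cadlag_undefined[OF z] by simp
  next
    case t: True
    have "dist (x t) (z t) \<le> 0 + \<eta>" if "\<eta> > 0" for \<eta>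
    proof -
      define h where "h = \<eta> / 4"
      have h: "h > 0" using that by (simp add: h_def)
      have "\<exists>r>t. \<forall>s. t < s \<and> s < r \<longrightarrow> dist (y s) (y t) < h" if "y \<in> cadlag S" for y
      proof -
        have "(y \<longlongrightarrow> y t) (at_right t)" using that t by (simp add: cadlag_def)
        then have "eventually (\<lambda>s. dist (y s) (y t) < h) (at_right t)" using h by (rule tendstoD)
        then show ?thesis unfolding eventually_at_right_field by blast
      qed
      note right = this
      obtain r1 where r1: "r1 > t" "\<forall>s. t < s \<and> s < r1 \<longrightarrow> dist (x s) (x t) < h"
        using right[OF x] by blast
      obtain r2 where r2: "r2 > t" "\<forall>s. t < s \<and> s < r2 \<longrightarrow> dist (z s) (z t) < h"
        using right[OF z] by blast
      define r where "r = min r1 r2 - t"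
      have r: "r > 0" using r1(1) r2(1) by (simp add: r_def)
      define s where "s = t + r / 2"
      define e where "e = min (r / 8) h"
      define T where "T = t + r + 1"
      have e: "e > 0" "e \<le> r / 8" "e \<le> h" using r h by (auto simp: e_def)
      have s: "0 \<le> s" "s \<le> T" using r t by (auto simp: s_def T_def)
      have "T > 0" using r t by (simp add: T_def)
      from meet[OF this e(1)] obtain w where "w \<in> J1_nbhd S x T e" "w \<in> J1_nbhd S z T e" by blast
      then obtain l m where l: "l \<in> time_changes" "\<forall>t\<in>{0..T}. \<bar>l t - t\<bar> < e \<and> dist (w (l t)) (x t) < e"
        and m: "m \<in> time_changes" "\<forall>t\<in>{0..T}. \<bar>m t - t\<bar> < e \<and> dist (w (m t)) (z t) < e"
        unfolding J1_nbhd_def by blast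
      have ls: "\<bar>l s - s\<bar> < e" "dist (w (l s)) (x s) < e" using l(2) s by auto
      \<comment> \<open>\<open>w\<close> has to be read at one common time, and \<open>m\<close>
        reaches the time \<open>l s\<close> at \<open>v\<close> rather than at \<open>s\<close>. The
        room left in \<open>T\<close> ensures \<open>v < T\<close>.\<close>
      obtain v where v: "v \<ge> 0" "m v = l s"
        using time_changesD(5)[OF m(1)] time_changesD(4)[OF l(1) s(1)] by blast
      have "\<bar>m T - T\<bar> < e" using m(2) \<open>T > 0\<close> by simp
      then have "m v < m T" using v(2) ls(1) e(2) r by (simp add: s_def T_def)
      then have "v < T" using time_changesD(2)[OF m(1), of v T] v(1) \<open>T > 0\<close> by simp
      then have mv: "\<bar>m v - v\<bar> < e" "dist (w (m v)) (z v) < e" using m(2) v(1) by auto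
      have "\<bar>v - s\<bar> < r / 4" using mv(1) ls(1) v(2) e(2) by linarith
      then have vr: "t < v" "v < t + r" using r unfolding s_def by linarith+
      have "dist (x s) (x t) < h" "dist (z v) (z t) < h"
      proof -
        have "t + r \<le> r1" "t + r \<le> r2" by (simp_all add: r_def)
        then have "t < s" "s < r1" "v < r2" using r vr(2) unfolding s_def by linarith+
        then show "dist (x s) (x t) < h" "dist (z v) (z t) < h"
          using r1(2) r2(2) vr(1) by blast+
      qed
      moreover have "dist (x t) (z t) \<le> dist (x s) (x t) + dist (w (l s)) (x s) + dist (w (l s)) (z v) + dist (z v) (z t)"
        by metric
      ultimately show ?thesis using ls(2) mv(2) v(2) e(3) by (simp add: h_def)
    qed
    then have "dist (x t) (z t) \<le> 0" by (rule field_le_epsilon)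
    then show ?thesis by simp
  qed
qed

subsection \<open>Compact sets of paths\<close>

text \<open>At level \<open>j\<close> a skeleton consists of times \<open>0 = t\<^sub>0 \<le> t\<^sub>1 \<le> \<dots>\<close>, \<open>\<delta> j\<close> apart until they reach \<open>j + 1\<close>,
  and of values \<open>v\<^sub>i\<close> that a path approximates on \<open>[t\<^sub>i, t\<^sub>i\<^sub>+\<^sub>1)\<close> up to \<open>1 / (j + 1)\<close>. That the levels are
  consistent is a closed condition since half-open intervals with a common point overlap in an
  interval of positive length.\<close>

definition skeletons :: "'a::metric_space set \<Rightarrow> (nat \<Rightarrow> real) \<Rightarrow> (nat \<Rightarrow> nat \<Rightarrow> real \<times> 'a) set" where
  "skeletons S \<delta> = {p.
     (\<forall>j i. p j i \<in> {0..real (Suc j)} \<times> S) \<and> (\<forall>j. fst (p j 0) = 0) \<and>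
     (\<forall>j i. min (fst (p j i) + \<delta> j) (real (Suc j)) \<le> fst (p j (Suc i))) \<and>
     (\<forall>j i k m. min (fst (p j (Suc i))) (fst (p k (Suc m))) \<le> max (fst (p j i)) (fst (p k m)) \<or>
        dist (snd (p j i)) (snd (p k m)) \<le> 1 / real (Suc j) + 1 / real (Suc k))}"

definition fits :: "(nat \<Rightarrow> nat \<Rightarrow> real \<times> 'a::metric_space) \<Rightarrow> (real \<Rightarrow> 'a) \<Rightarrow> bool" where
  "fits p x \<longleftrightarrow> (\<forall>j i t. fst (p j i) \<le> t \<longrightarrow> t < fst (p j (Suc i)) \<longrightarrow> dist (x t) (snd (p j i)) \<le> 1 / real (Suc j))"

definition skeleton_paths :: "'a::metric_space set \<Rightarrow> (nat \<Rightarrow> real) \<Rightarrow> (real \<Rightarrow> 'a) set" where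
  "skeleton_paths S \<delta> = {x \<in> cadlag S. \<exists>p\<in>skeletons S \<delta>. fits p x}"

text \<open>Tychonoff's theorem, moved from extensional products to the function type.\<close>

lemma compact_fun_box:
  fixes B :: "'i \<Rightarrow> 'b::topological_space set"
  assumes "\<And>i. compact (B i)"
  shows "compact {f. \<forall>i. f i \<in> B i}"
proof -
  have "compactin (product_topology (\<lambda>_. euclidean) UNIV) (PiE UNIV B)"
    using assms by (simp add: compactin_PiE)
  then show ?thesis
    by (simp add: euclidean_product_topology PiE_UNIV_domain Pi_def)
qed

lemma continuous_on_double_coordinate:
  "continuous_on UNIV (\<lambda>p :: 'i \<Rightarrow> 'j \<Rightarrow> 'b::topological_space. p j i)"
proof -
  have "continuous_on UNIV ((\<lambda>q :: 'j \<Rightarrow> 'b. q i) \<circ> (\<lambda>p :: 'i \<Rightarrow> 'j \<Rightarrow> 'b. p j))"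
    by (intro continuous_on_compose continuous_on_product_coordinates
        continuous_on_subset[OF continuous_on_product_coordinates] subset_UNIV)
  then show ?thesis by (simp add: comp_def)
qed

lemma compact_skeletons:
  assumes "compact S"
  shows "compact (skeletons S \<delta>)"
proof -
  let ?B = "{p :: nat \<Rightarrow> nat \<Rightarrow> real \<times> 'a. \<forall>j. p j \<in> {q. \<forall>i. q i \<in> {0..real (Suc j)} \<times> S}}"
  have "compact ?B"
    by (intro compact_fun_box compact_Times assms) simp
  moreover
  have "closed ({p :: nat \<Rightarrow> nat \<Rightarrow> real \<times> 'a. \<forall>j. fst (p j 0) = 0} \<inter>
      {p. \<forall>j i. min (fst (p j i) + \<delta> j) (real (Suc j)) \<le> fst (p j (Suc i))} \<inter>
      {p. \<forall>j i k m. min (fst (p j (Suc i))) (fst (p k (Suc m))) \<le> max (fst (p j i)) (fst (p k m)) \<or>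
        dist (snd (p j i)) (snd (p k m)) \<le> 1 / real (Suc j) + 1 / real (Suc k)})"
    by (intro closed_Int closed_Collect_all closed_Collect_disj closed_Collect_le closed_Collect_eq
        continuous_on_min continuous_on_max continuous_on_add continuous_on_const continuous_on_fst
        continuous_on_snd continuous_on_dist continuous_on_double_coordinate)
  moreover have "skeletons S \<delta> = ?B \<inter> ({p. \<forall>j. fst (p j 0) = 0} \<inter>
      {p. \<forall>j i. min (fst (p j i) + \<delta> j) (real (Suc j)) \<le> fst (p j (Suc i))} \<inter>
      {p. \<forall>j i k m. min (fst (p j (Suc i))) (fst (p k (Suc m))) \<le> max (fst (p j i)) (fst (p k m)) \<or>
        dist (snd (p j i)) (snd (p k m)) \<le> 1 / real (Suc j) + 1 / real (Suc k)})"
    unfolding skeletons_def by blast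
  ultimately show ?thesis by (simp only: compact_Int_closed)
qed

locale skeleton =
  fixes S :: "'a::metric_space set" and \<delta> :: "nat \<Rightarrow> real" and p
  assumes gap_pos: "\<And>j. \<delta> j > 0" and skel: "p \<in> skeletons S \<delta>"
begin

lemma time_bounds: "0 \<le> fst (p j i)" "fst (p j i) \<le> real (Suc j)"
  and val_in: "snd (p j i) \<in> S"
proof -
  have "p j i \<in> {0..real (Suc j)} \<times> S" using skel unfolding skeletons_def by blast
  then show "0 \<le> fst (p j i)" "fst (p j i) \<le> real (Suc j)" "snd (p j i) \<in> S" by (auto simp: mem_Times_iff)
qed

lemma time_0: "fst (p j 0) = 0"
  using skel unfolding skeletons_def by blast

lemma time_gap: "min (fst (p j i) + \<delta> j) (real (Suc j)) \<le> fst (p j (Suc i))"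
  using skel unfolding skeletons_def by blast

lemma consistent:
  assumes "fst (p j i) \<le> t" "t < fst (p j (Suc i))" "fst (p k m) \<le> t" "t < fst (p k (Suc m))"
  shows "dist (snd (p j i)) (snd (p k m)) \<le> 1 / real (Suc j) + 1 / real (Suc k)"
proof -
  have "min (fst (p j (Suc i))) (fst (p k (Suc m))) \<le> max (fst (p j i)) (fst (p k m)) \<or>
        dist (snd (p j i)) (snd (p k m)) \<le> 1 / real (Suc j) + 1 / real (Suc k)"
    using skel unfolding skeletons_def by blast
  then show ?thesis using assms by linarith
qed

lemma time_strict: "fst (p j i) < real (Suc j) \<Longrightarrow> fst (p j i) < fst (p j (Suc i))"
  using time_gap[of j i] gap_pos[of j] by linarith

lemma time_mono: "fst (p j i) \<le> fst (p j (Suc i))"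
  using time_gap[of j i] gap_pos[of j] time_bounds(2)[of j i] by linarith

text \<open>Gaps of at least \<open>\<delta> j\<close> exhaust the interval after finitely many
  steps.\<close>

lemma ex_time_eq: "\<exists>i. fst (p j i) = real (Suc j)"
proof -
  have ge: "min (real i * \<delta> j) (real (Suc j)) \<le> fst (p j i)" for i
  proof (induction i)
    case (Suc i)
    have "real (Suc i) * \<delta> j = real i * \<delta> j + \<delta> j" by (simp add: algebra_simps)
    then show ?case using Suc time_gap[of j i] gap_pos[of j] by linarith
  qed (use time_bounds in simp)
  obtain i where "real (Suc j) < real i * \<delta> j"
    using reals_Archimedean3[OF gap_pos[of j]] by blast
  then show ?thesis using ge[of i] time_bounds(2)[of j i] by (intro exI[of _ i]) linarith
qed

lemma ex_first:
  assumes "\<not> P (fst (p j 0))" "P (real (Suc j))"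
  obtains i where "\<not> P (fst (p j i))" "P (fst (p j (Suc i)))"
proof -
  obtain m where "fst (p j m) = real (Suc j)" using ex_time_eq by blast
  then have "\<exists>m. P (fst (p j m))" using assms(2) by metis
  then obtain m where m: "P (fst (p j m))" "\<And>i. i < m \<Longrightarrow> \<not> P (fst (p j i))"
    using exists_least_iff[of "\<lambda>m. P (fst (p j m))"] by blast
  then obtain i where "m = Suc i" using assms(1) by (cases m) auto
  then show thesis using that m by blast
qed

lemma ex_interval_right:
  assumes "0 \<le> t" "t < real (Suc j)"
  obtains i where "fst (p j i) \<le> t" "t < fst (p j (Suc i))"
proof -
  have "\<not> t < fst (p j 0)" using assms time_0 by simp
  then obtain i where "\<not> t < fst (p j i)" "t < fst (p j (Suc i))"
    using ex_first[of "\<lambda>s. t < s" j] assms(2) by blast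
  then show thesis using that by (simp add: not_less)
qed

lemma ex_interval_left:
  assumes "0 < t" "t \<le> real (Suc j)"
  obtains i where "fst (p j i) < t" "t \<le> fst (p j (Suc i))"
proof -
  have "\<not> t \<le> fst (p j 0)" using assms time_0 by simp
  then obtain i where "\<not> t \<le> fst (p j i)" "t \<le> fst (p j (Suc i))"
    using ex_first[of "\<lambda>s. t \<le> s" j] assms(2) by blast
  then show thesis using that by (simp add: not_le)
qed

lemma fits_unique:
  assumes "x \<in> cadlag S" "y \<in> cadlag S" "fits p x" "fits p y"
  shows "x = y"
proof
  fix t
  show "x t = y t"
  proof (cases "t \<ge> 0")
    case t: True
    have "dist (x t) (y t) \<le> 0 + e" if e: "e > 0" for e
    proof -
      obtain j where j: "2 / real (Suc j) < e" "t < real (Suc j)"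
      proof -
        obtain j where "max (2 / e) t < real j" using reals_Archimedean2 by blast
        then have "2 / e < real (Suc j)" "t < real (Suc j)" by auto
        then show thesis using that e by (simp add: field_simps)
      qed
      obtain i where "fst (p j i) \<le> t" "t < fst (p j (Suc i))" using ex_interval_right t j(2) by blast
      then have "dist (x t) (snd (p j i)) \<le> 1 / real (Suc j)" "dist (y t) (snd (p j i)) \<le> 1 / real (Suc j)"
        using assms(3,4) unfolding fits_def by blast+
      then show ?thesis using j(1) dist_triangle2[of "x t" "y t" "snd (p j i)"] by simp
    qed
    then have "dist (x t) (y t) \<le> 0" by (rule field_le_epsilon)
    then show ?thesis by simp
  qed (use cadlag_undefined[OF assms(1)] cadlag_undefined[OF assms(2)] in simp)
qed

text \<open>The value at \<open>t\<close> is a limit point of the values that finer and finer levels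
  prescribe there; consistency with level \<open>j\<close> passes to the limit, and the error of the
  finer levels vanishes. Such a path oscillates by at most \<open>2 / (j + 1)\<close> inside an
  interval of level \<open>j\<close>, which gives right-continuity and left limits.\<close>

lemma ex_fits_cadlag:
  assumes S: "compact S"
  shows "\<exists>x\<in>cadlag S. fits p x"
proof -
  have level: "\<exists>j. c / real (Suc j) < e \<and> t < real (Suc j)" if "e > 0" for c e t :: real
  proof -
    obtain j where "max (c / e) t < real j" using reals_Archimedean2 by blast
    then have "c / e < real (Suc j)" "t < real (Suc j)" by auto
    then show ?thesis using that by (auto simp: field_simps intro!: exI[of _ j])
  qed
  have "\<exists>z\<in>S. \<forall>j i. fst (p j i) \<le> t \<longrightarrow> t < fst (p j (Suc i)) \<longrightarrow> dist z (snd (p j i)) \<le> 1 / real (Suc j)"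
    if t: "t \<ge> 0" for t
  proof -
    obtain k where k: "t < real k" using reals_Archimedean2 by blast
    have "\<exists>i. fst (p (k + n) i) \<le> t \<and> t < fst (p (k + n) (Suc i))" for n
    proof -
      have "t < real (Suc (k + n))" using k by simp
      then show ?thesis using ex_interval_right[OF t] by blast
    qed
    then obtain f where f: "\<And>n. fst (p (k + n) (f n)) \<le> t" "\<And>n. t < fst (p (k + n) (Suc (f n)))"
      by metis
    define v where "v n = snd (p (k + n) (f n))" for n
    have "\<forall>n. v n \<in> S" using val_in by (simp add: v_def)
    then obtain z r where z: "z \<in> S" "strict_mono (r :: nat \<Rightarrow> nat)" "(v \<circ> r) \<longlonglongrightarrow> z"
      using S unfolding compact_def by blast
    have "dist z (snd (p j i)) \<le> 1 / real (Suc j)" if "fst (p j i) \<le> t" "t < fst (p j (Suc i))" for j i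
    proof (rule LIMSEQ_le)
      show "(\<lambda>n. dist ((v \<circ> r) n) (snd (p j i))) \<longlonglongrightarrow> dist z (snd (p j i))"
        by (intro tendsto_dist z tendsto_const)
      have "(\<lambda>n. 1 / real (Suc (k + r n))) \<longlonglongrightarrow> 0"
      proof (rule tendsto_sandwich[of "\<lambda>_. 0" _ _ "\<lambda>n. 1 / real (Suc n)"])
        show "\<forall>\<^sub>F n in sequentially. 1 / real (Suc (k + r n)) \<le> 1 / real (Suc n)"
        proof (rule always_eventually, rule allI)
          fix n
          have "n \<le> r n" using z(2) by (rule seq_suble)
          then show "1 / real (Suc (k + r n)) \<le> 1 / real (Suc n)"
            by (intro divide_left_mono) auto
        qed
        show "(\<lambda>n. 1 / real (Suc n)) \<longlonglongrightarrow> 0" using LIMSEQ_inverse_real_of_nat by (simp add: inverse_eq_divide)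
      qed auto
      from tendsto_add[OF this tendsto_const]
      show "(\<lambda>n. 1 / real (Suc (k + r n)) + 1 / real (Suc j)) \<longlonglongrightarrow> 1 / real (Suc j)" by simp
      show "\<exists>N. \<forall>n\<ge>N. dist ((v \<circ> r) n) (snd (p j i)) \<le> 1 / real (Suc (k + r n)) + 1 / real (Suc j)"
        using consistent[OF f that] by (simp add: v_def)
    qed
    then show ?thesis using z(1) by blast
  qed
  then obtain x where x: "\<And>t. t \<ge> 0 \<Longrightarrow> x t \<in> S \<and> (\<forall>j i. fst (p j i) \<le> t \<longrightarrow> t < fst (p j (Suc i)) \<longrightarrow>
      dist (x t) (snd (p j i)) \<le> 1 / real (Suc j))"
    by metis
  define y where "y = restrict x {0..}"
  have yS: "y t \<in> S" if "t \<ge> 0" for t using that x by (simp add: y_def)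
  have fit: "dist (y t) (snd (p j i)) \<le> 1 / real (Suc j)" if "fst (p j i) \<le> t" "t < fst (p j (Suc i))" for j i t
    using that x[of t] time_bounds(1)[of j i] by (auto simp: y_def)
  have osc: "dist (y s) (y t) \<le> 2 / real (Suc j)"
    if "fst (p j i) \<le> s" "s < fst (p j (Suc i))" "fst (p j i) \<le> t" "t < fst (p j (Suc i))" for j i s t
    using fit[OF that(1,2)] fit[OF that(3,4)] dist_triangle2[of "y s" "y t" "snd (p j i)"] by simp
  have "(y \<longlongrightarrow> y t) (at_right t)" if t: "t \<ge> 0" for t
  proof (rule tendstoI)
    fix e :: real assume "e > 0"
    then obtain j where j: "2 / real (Suc j) < e" "t < real (Suc j)" using level by blast
    obtain i where i: "fst (p j i) \<le> t" "t < fst (p j (Suc i))" using ex_interval_right t j(2) by blast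
    have "dist (y s) (y t) < e" if "t < s" "s < fst (p j (Suc i))" for s
      using osc[of j i s t] i that j(1) by simp
    then show "eventually (\<lambda>s. dist (y s) (y t) < e) (at_right t)"
      unfolding eventually_at_right_field using i(2) by blast
  qed
  moreover have "\<exists>l\<in>S. (y \<longlongrightarrow> l) (at_left t)" if t: "t > 0" for t
  proof -
    \<comment> \<open>Compactness of \<open>S\<close> supplies a limit point along one sequence from
      the left, and the small oscillation just before \<open>t\<close> makes it the left
      limit.\<close>
    define s where "s n = t - t / real (Suc n)" for n
    have s: "0 \<le> s n" "s n < t" for n using t by (auto simp: s_def field_simps)
    have lim_s: "s \<longlonglongrightarrow> t - t * 0"
      unfolding s_def divide_inverse
      by (intro tendsto_diff tendsto_mult tendsto_const) (rule LIMSEQ_inverse_real_of_nat)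
    obtain l r where l: "l \<in> S" "strict_mono (r :: nat \<Rightarrow> nat)" "((y \<circ> s) \<circ> r) \<longlonglongrightarrow> l"
      using S yS[OF s(1)] unfolding compact_def by (metis comp_apply)
    have lim_sr: "(s \<circ> r) \<longlonglongrightarrow> t" using LIMSEQ_subseq_LIMSEQ[OF lim_s l(2)] by simp
    have "(y \<longlongrightarrow> l) (at_left t)"
    proof (rule tendstoI)
      fix e :: real assume e: "e > 0"
      then obtain j where j: "4 / real (Suc j) < e" "t < real (Suc j)" using level by blast
      obtain i where i: "fst (p j i) < t" "t \<le> fst (p j (Suc i))" using ex_interval_left t j(2) less_imp_le by blast
      have "eventually (\<lambda>n. fst (p j i) < (s \<circ> r) n) sequentially"
        using lim_sr i(1) by (rule order_tendstoD(1))
      moreover have "eventually (\<lambda>n. dist (((y \<circ> s) \<circ> r) n) l < e / 2) sequentially"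
        by (rule tendstoD[OF l(3)]) (use e in simp)
      ultimately have "eventually (\<lambda>n. fst (p j i) < s (r n) \<and> dist (y (s (r n))) l < e / 2) sequentially"
        by eventually_elim simp
      then obtain n where n: "fst (p j i) < s (r n)" "dist (y (s (r n))) l < e / 2"
        unfolding eventually_sequentially by blast
      have "dist (y u) l < e" if "fst (p j i) < u" "u < t" for u
      proof -
        have "dist (y u) (y (s (r n))) \<le> 2 / real (Suc j)"
          using osc[of j i u "s (r n)"] that n(1) s(2)[of "r n"] i(2) by simp
        moreover have "2 / real (Suc j) < e / 2" using j(1) by (simp add: field_simps)
        ultimately show ?thesis using dist_triangle[of "y u" l "y (s (r n))"] n(2) by linarith
      qed
      then show "eventually (\<lambda>u. dist (y u) l < e) (at_left t)"
        unfolding eventually_at_left_field using i(1) by blast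
    qed
    then show ?thesis using l(1) by blast
  qed
  moreover have "y \<in> {0..} \<rightarrow>\<^sub>E S" using yS by (auto simp: y_def)
  ultimately have "y \<in> cadlag S" unfolding cadlag_def by blast
  moreover have "fits p y" unfolding fits_def using fit by blast
  ultimately show ?thesis by blast
qed

text \<open>Up to \<open>T\<close> finitely many times and values of one level decide, so closeness
  of these is open in the product topology. A time change carries the times of \<open>p\<close> to
  those of \<open>q\<close>, and on matching intervals three errors below \<open>e / 3\<close> add
  up.\<close>

lemma nearby_skeletons_fit_nearby_paths:
  assumes x: "x \<in> cadlag S" "fits p x" and T: "T > 0" and e: "e > 0"
  obtains W where "open W" "p \<in> W"
    "\<And>q y. q \<in> W \<Longrightarrow> q \<in> skeletons S \<delta> \<Longrightarrow> y \<in> cadlag S \<Longrightarrow> fits q y \<Longrightarrow> y \<in> J1_nbhd S x T e"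
proof -
  obtain j where j: "1 / real (Suc j) < e / 3" "T < real (Suc j)"
  proof -
    obtain j where "max (3 / e) T < real j" using reals_Archimedean2 by blast
    then have "3 / e < real (Suc j)" "T < real (Suc j)" by auto
    then show thesis using that e by (simp add: field_simps)
  qed
  define a where "a i = fst (p j i)" for i
  have "\<exists>m. T < a m" using ex_time_eq[of j] j(2) unfolding a_def by metis
  then obtain m where m: "T < a m" "\<And>i. i < m \<Longrightarrow> \<not> T < a i"
    using exists_least_iff[of "\<lambda>m. T < a m"] by blast
  have strict: "a i < a (Suc i)" if "i < m" for i
    using time_strict[of j i] m(2)[OF that] j(2) by (simp add: a_def)
  have m0: "m \<noteq> 0" using m(1) T time_0[of j] by (cases m) (auto simp: a_def)
  define g where "g = Min ((\<lambda>i. a (Suc i) - a i) ` {..<m})"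
  have g: "g > 0" unfolding g_def by (subst Min_gr_iff) (use strict m0 in auto)
  have g_le: "g \<le> a (Suc i) - a i" if "i < m" for i using that by (auto simp: g_def)
  \<comment> \<open>Moving two neighbouring times by less than a third of the smallest gap keeps
    them in order, as the time change requires.\<close>
  define h where "h = min e (g / 3)"
  have h: "h > 0" "h \<le> e" "h \<le> g / 3" using e g by (auto simp: h_def)
  define W where "W = (\<Inter>i\<in>{..m}. {q :: nat \<Rightarrow> nat \<Rightarrow> real \<times> 'a. dist (fst (q j i)) (fst (p j i)) < h
      \<and> dist (snd (q j i)) (snd (p j i)) < e / 3})"
  have "open W"
    unfolding W_def
    by (intro open_INT ballI open_Collect_conj open_Collect_less continuous_on_dist
        continuous_on_const continuous_on_fst continuous_on_snd continuous_on_double_coordinate) auto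
  moreover have "p \<in> W" using h e by (simp add: W_def)
  moreover have "y \<in> J1_nbhd S x T e"
    if q: "q \<in> W" "q \<in> skeletons S \<delta>" and y: "y \<in> cadlag S" "fits q y" for q y
  proof -
    interpret q: skeleton S \<delta> q by unfold_locales (fact gap_pos q)+
    define c where "c i = fst (q j i)" for i
    have near: "\<bar>c i - a i\<bar> < h" "dist (snd (q j i)) (snd (p j i)) < e / 3" if "i \<le> m" for i
      using q(1) that by (auto simp: W_def c_def a_def dist_real_def)
    have "c i < c (Suc i)" if "i < m" for i
      using near(1)[of i] near(1)[of "Suc i"] g_le[OF that] h(3) that by (simp add: abs_less_iff)
    moreover have "\<bar>c i - a i\<bar> < e" if "i \<le> m" for i using near(1)[OF that] h(2) by simp
    moreover have "a 0 = 0" "c 0 = 0" using time_0 q.time_0 by (auto simp: a_def c_def)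
    ultimately have "\<exists>l\<in>time_changes. (\<forall>i\<le>m. l (a i) = c i) \<and> (\<forall>t\<ge>0. \<bar>l t - t\<bar> < e)"
      using strict e by (intro ex_time_change_seq)
    then obtain l where l: "l \<in> time_changes" "\<forall>i\<le>m. l (a i) = c i" "\<forall>t\<ge>0. \<bar>l t - t\<bar> < e" by blast
    have "dist (y (l t)) (x t) < e" if t: "t \<in> {0..T}" for t
    proof -
      have "0 \<le> t" "t < real (Suc j)" using t j(2) by auto
      then obtain i where "fst (p j i) \<le> t" "t < fst (p j (Suc i))" by (rule ex_interval_right)
      then have i: "a i \<le> t" "t < a (Suc i)" by (simp_all only: a_def)
      have im: "i < m"
      proof (rule ccontr)
        assume "\<not> i < m"
        then have "a m \<le> a i"
          using lift_Suc_mono_le[of a m i] by (simp add: a_def time_mono)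
        then show False using m(1) i(1) t by simp
      qed
      have "0 \<le> a i" by (simp add: a_def time_bounds)
      then have "l (a i) \<le> l t" "l t < l (a (Suc i))"
        using i t time_changesD(2)[OF l(1), of t "a (Suc i)"] time_changesD(3)[OF l(1), of "a i" t] by simp_all
      then have "c i \<le> l t" "l t < c (Suc i)"
        using im l(2)[rule_format, of i] l(2)[rule_format, of "Suc i"] by simp_all
      then have "dist (y (l t)) (snd (q j i)) \<le> 1 / real (Suc j)"
        using y(2) unfolding fits_def c_def by blast
      moreover have "dist (x t) (snd (p j i)) \<le> 1 / real (Suc j)"
        using x(2) i unfolding fits_def a_def by blast
      moreover have "dist (snd (q j i)) (snd (p j i)) < e / 3" using near(2) im by simp
      moreover have "dist (y (l t)) (x t) \<le> dist (y (l t)) (snd (q j i)) + dist (snd (q j i)) (snd (p j i)) + dist (x t) (snd (p j i))"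
        by metric
      ultimately show ?thesis using j(1) by linarith
    qed
    then show ?thesis
      unfolding J1_nbhd_def using y(1) l(1,3) by (intro CollectI conjI bexI[of _ l] ballI) auto
  qed
  ultimately show thesis using that by blast
qed

end

text \<open>A skeleton determines its path, and this map is continuous, so compactness is inherited
  from \<open>skeletons\<close>. Closedness is what later makes the event of lying in the set
  measurable: a limit of such paths has approximating skeletons with a convergent subsequence, and
  \<open>J1_nbhd_separates\<close> identifies it with the path of the limit skeleton.\<close>

lemma skeleton_paths_compact_closed:
  assumes S: "compact S" and \<delta>: "\<And>j. \<delta> j > 0"
  shows "compactin (skorohod_J1 S) (skeleton_paths S \<delta>)"
    and "closedin (skorohod_J1 S) (skeleton_paths S \<delta>)"
proof -
  have sk: "skeleton S \<delta> p" if "p \<in> skeletons S \<delta>" for p using that \<delta> by (simp add: skeleton_def)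
  define f where "f p = (SOME x. x \<in> cadlag S \<and> fits p x)" for p
  have f: "f p \<in> cadlag S" "fits p (f p)" if "p \<in> skeletons S \<delta>" for p
  proof -
    have "\<exists>x. x \<in> cadlag S \<and> fits p x" using skeleton.ex_fits_cadlag[OF sk[OF that] S] by blast
    then show "f p \<in> cadlag S" "fits p (f p)" using someI_ex[of "\<lambda>x. x \<in> cadlag S \<and> fits p x"] by (auto simp: f_def)
  qed
  have f_eq: "f p = x" if "p \<in> skeletons S \<delta>" "x \<in> cadlag S" "fits p x" for p x
    by (rule skeleton.fits_unique[OF sk[OF that(1)] f(1)[OF that(1)] that(2) f(2)[OF that(1)] that(3)])
  have img: "f ` skeletons S \<delta> = skeleton_paths S \<delta>"
    unfolding skeleton_paths_def using f f_eq by blast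
  have "continuous_map (top_of_set (skeletons S \<delta>)) (skorohod_J1 S) f"
    unfolding continuous_map_def
  proof (intro conjI allI impI funcsetI)
    fix G assume "openin (skorohod_J1 S) G"
    then have G: "\<And>x. x \<in> G \<Longrightarrow> \<exists>T>0. \<exists>e>0. J1_nbhd S x T e \<subseteq> G" by (simp add: openin_skorohod_J1)
    show "openin (top_of_set (skeletons S \<delta>)) {p \<in> topspace (top_of_set (skeletons S \<delta>)). f p \<in> G}"
      unfolding topspace_euclidean_subtopology
    proof (subst openin_subopen, intro ballI)
      fix p assume "p \<in> {p \<in> skeletons S \<delta>. f p \<in> G}"
      then have p: "p \<in> skeletons S \<delta>" "f p \<in> G" by auto
      obtain T e where Te: "T > 0" "e > 0" "J1_nbhd S (f p) T e \<subseteq> G" using G[OF p(2)] by blast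
      obtain W where W: "open W" "p \<in> W" "\<And>q y. q \<in> W \<Longrightarrow> q \<in> skeletons S \<delta> \<Longrightarrow> y \<in> cadlag S \<Longrightarrow> fits q y \<Longrightarrow> y \<in> J1_nbhd S (f p) T e"
        using skeleton.nearby_skeletons_fit_nearby_paths[OF sk[OF p(1)] f[OF p(1)] Te(1,2)] by blast
      have "openin (top_of_set (skeletons S \<delta>)) (skeletons S \<delta> \<inter> W)" using W(1) by (rule openin_open_Int)
      moreover have "skeletons S \<delta> \<inter> W \<subseteq> {p \<in> skeletons S \<delta>. f p \<in> G}" using W(3) f Te(3) by blast
      ultimately show "\<exists>V. openin (top_of_set (skeletons S \<delta>)) V \<and> p \<in> V \<and> V \<subseteq> {p \<in> skeletons S \<delta>. f p \<in> G}"
        using p(1) W(2) by blast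
    qed
  qed (simp add: topspace_skorohod_J1 f)
  moreover have "compactin (top_of_set (skeletons S \<delta>)) (skeletons S \<delta>)"
    using compact_skeletons[OF S] by (simp add: compactin_subtopology)
  ultimately show "compactin (skorohod_J1 S) (skeleton_paths S \<delta>)"
    unfolding img[symmetric] by (rule image_compactin[rotated])
  have "\<exists>T>0. \<exists>e>0. J1_nbhd S x T e \<subseteq> cadlag S - skeleton_paths S \<delta>"
    if x: "x \<in> cadlag S - skeleton_paths S \<delta>" for x
  proof (rule ccontr)
    assume neg: "\<not> ?thesis"
    have "\<exists>q\<in>skeletons S \<delta>. f q \<in> J1_nbhd S x (real (Suc k)) (1 / real (Suc k))" for k
    proof -
      have "\<not> J1_nbhd S x (real (Suc k)) (1 / real (Suc k)) \<subseteq> cadlag S - skeleton_paths S \<delta>"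
        using neg by (auto simp del: of_nat_Suc)
      then show ?thesis unfolding J1_nbhd_def img[symmetric] by blast
    qed
    then obtain q where q: "\<And>k. q k \<in> skeletons S \<delta>"
        "\<And>k. f (q k) \<in> J1_nbhd S x (real (Suc k)) (1 / real (Suc k))" by metis
    have "seq_compact (skeletons S \<delta>)"
      using compact_skeletons[OF S] by (simp add: compact_eq_seq_compact_metric)
    then obtain p r where p: "p \<in> skeletons S \<delta>" "strict_mono (r :: nat \<Rightarrow> nat)" "(q \<circ> r) \<longlonglongrightarrow> p"
      using q(1) unfolding seq_compact_def by blast
    have "x = f p"
    proof (rule J1_nbhd_separates)
      show "x \<in> cadlag S" "f p \<in> cadlag S" using x f(1)[OF p(1)] by auto
      fix T e :: real assume Te: "T > 0" "e > 0"
      obtain W where W: "open W" "p \<in> W" "\<And>q y. q \<in> W \<Longrightarrow> q \<in> skeletons S \<delta> \<Longrightarrow> y \<in> cadlag S \<Longrightarrow> fits q y \<Longrightarrow> y \<in> J1_nbhd S (f p) T e"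
        using skeleton.nearby_skeletons_fit_nearby_paths[OF sk[OF p(1)] f[OF p(1)] Te] by blast
      have "eventually (\<lambda>n. (q \<circ> r) n \<in> W) sequentially" using p(3) W(1,2) by (rule topological_tendstoD)
      moreover have "eventually (\<lambda>n. max T (1 / e) < real n) sequentially"
        using filterlim_real_sequentially unfolding filterlim_at_top_dense by blast
      ultimately have "eventually (\<lambda>n. (q \<circ> r) n \<in> W \<and> max T (1 / e) < real n) sequentially"
        by (rule eventually_conj)
      then obtain n where n: "q (r n) \<in> W" "max T (1 / e) < real n"
        by (auto simp: eventually_sequentially)
      have "n \<le> r n" using p(2) by (rule seq_suble)
      then have rn: "T \<le> real (Suc (r n))" "1 / e \<le> real (Suc (r n))" using n(2) by auto
      have "1 / real (Suc (r n)) \<le> e" using rn(2) Te(2) by (simp add: field_simps)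
      then have "f (q (r n)) \<in> J1_nbhd S x T e" using q(2)[of "r n"] J1_nbhd_mono[OF rn(1)] by blast
      moreover have "f (q (r n)) \<in> J1_nbhd S (f p) T e" using W(3)[OF n(1) q(1) f[OF q(1)]] .
      ultimately show "J1_nbhd S x T e \<inter> J1_nbhd S (f p) T e \<noteq> {}" by blast
    qed
    then show False using x img p(1) by blast
  qed
  then have "openin (skorohod_J1 S) (cadlag S - skeleton_paths S \<delta>)"
    unfolding openin_skorohod_J1 by blast
  then show "closedin (skorohod_J1 S) (skeleton_paths S \<delta>)"
    unfolding closedin_def topspace_skorohod_J1 by (simp add: skeleton_paths_def)
qed

section \<open>Ranked component sizes\<close>

lemma sorted_wrt_ge_nth_ge_iff:
  fixes xs :: "nat list"
  assumes "sorted_wrt (\<ge>) xs" "k > 0"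
  shows "k \<le> (if i < length xs then xs ! i else 0) \<longleftrightarrow> i < length (filter (\<lambda>x. k \<le> x) xs)"
  using assms(1)
proof (induction xs arbitrary: i)
  case (Cons x xs)
  show ?case
  proof (cases "k \<le> x")
    case True
    then show ?thesis using Cons.IH[of "i - 1"] Cons.prems by (cases i) auto
  next
    case False
    then have lt: "\<forall>y\<in>set xs. \<not> k \<le> y" using Cons.prems by auto
    then have "filter (\<lambda>x. k \<le> x) xs = []" by (simp add: filter_empty_conv)
    moreover have "\<not> k \<le> (x # xs) ! i" if "i < length (x # xs)"
      using that lt False by (cases i) auto
    ultimately show ?thesis using False assms(2) by auto
  qed
qed (use assms(2) in simp)

lemma ranked_sizes_list:
  obtains L where "sorted_wrt (\<ge>) L" "mset L = image_mset card (mset_set C)"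
    "\<And>i. ranked_sizes C i = (if i < length L then L ! i else 0)"
proof -
  define L where "L = rev (sorted_list_of_multiset (image_mset card (mset_set C)))"
  have "sorted_wrt (\<ge>) L" unfolding L_def sorted_wrt_rev
    using sorted_sorted_list_of_multiset[of "image_mset card (mset_set C)"] by simp
  moreover have "mset L = image_mset card (mset_set C)" by (simp add: L_def)
  moreover have "ranked_sizes C i = (if i < length L then L ! i else 0)" for i
    by (simp only: ranked_sizes_def Let_def L_def)
  ultimately show thesis using that by blast
qed

text \<open>This turns statements about ranks into counts of large classes. \<open>k > 0\<close>
  keeps out the padding zeros.\<close>

lemma ranked_sizes_ge_iff:
  assumes "finite C" "k > 0"
  shows "k \<le> ranked_sizes C i \<longleftrightarrow> i < card {c \<in> C. k \<le> card c}"
proof -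
  obtain L where L: "sorted_wrt (\<ge>) L" "mset L = image_mset card (mset_set C)"
    "\<And>i. ranked_sizes C i = (if i < length L then L ! i else 0)"
    using ranked_sizes_list[of C] by blast
  have "length (filter (\<lambda>x. k \<le> x) L) = size (filter_mset (\<lambda>x. k \<le> x) (mset L))"
    by (simp flip: mset_filter)
  also have "\<dots> = size (image_mset card (filter_mset (\<lambda>c. k \<le> card c) (mset_set C)))"
    unfolding L(2) filter_mset_image_mset ..
  also have "\<dots> = card {c \<in> C. k \<le> card c}"
    using assms(1) by simp
  finally show ?thesis using sorted_wrt_ge_nth_ge_iff[OF L(1) assms(2), of i] L(3)[of i] by simp
qed

lemma antimono_ranked_sizes: "antimono (ranked_sizes C)"
proof (rule antimonoI)
  fix i j :: nat assume ij: "i \<le> j"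
  obtain L where L: "sorted_wrt (\<ge>) L" "\<And>i. ranked_sizes C i = (if i < length L then L ! i else 0)"
    using ranked_sizes_list[of C] by blast
  show "ranked_sizes C j \<le> ranked_sizes C i"
    using ij sorted_wrt_nth_less[OF L(1), of i j] by (cases "i = j") (auto simp: L(2))
qed

lemma ranked_sizes_sums: "(\<lambda>i. real (ranked_sizes C i)) sums real (\<Sum>c\<in>C. card c)"
proof -
  obtain L where L: "mset L = image_mset card (mset_set C)"
    "\<And>i. ranked_sizes C i = (if i < length L then L ! i else 0)"
    using ranked_sizes_list[of C] by blast
  have "(\<lambda>i. real (ranked_sizes C i)) sums (\<Sum>i\<in>{..<length L}. real (ranked_sizes C i))"
    by (rule sums_finite) (simp_all add: L(2))
  also have "(\<Sum>i\<in>{..<length L}. real (ranked_sizes C i)) = real (\<Sum>i\<in>{..<length L}. ranked_sizes C i)"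
    by simp
  also have "(\<Sum>i\<in>{..<length L}. ranked_sizes C i) = sum_mset (mset L)"
    by (simp add: L(2) sum_mset_sum_list sum_list_sum_nth atLeast0LessThan)
  also have "\<dots> = (\<Sum>c\<in>C. card c)" unfolding L(1) by (simp add: sum_unfold_sum_mset)
  finally show ?thesis .
qed

lemma sum_card_quotient:
  assumes "equiv V R" "finite V"
  shows "(\<Sum>c\<in>V // R. card c) = card V"
proof -
  have "card (\<Union>(V // R)) = (\<Sum>c\<in>V // R. card c)"
  proof (rule card_Union_disjoint)
    show "pairwise disjnt (V // R)"
      using quotient_disj[OF assms(1)] by (auto simp: pairwise_def disjnt_def)
    show "finite c" if "c \<in> V // R" for c
      using that assms finite_equiv_class equiv_type by blast
  qed
  then show ?thesis using Union_quotient[OF assms(1)] by simp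
qed

text \<open>If some rank moves by \<open>m\<close>, then either a large coarse class has no large fine subclass or
  two large fine classes lie in one coarse class; both separate at least \<open>m\<^sup>2\<close> pairs.\<close>

lemma ranked_sizes_refinement:
  assumes R: "equiv V R" and R': "equiv V R'" and sub: "R' \<subseteq> R" and V: "finite V"
  shows "(real (ranked_sizes (V // R) i) - real (ranked_sizes (V // R') i))\<^sup>2 \<le> card (R - R')"
proof -
  define a b where "a = ranked_sizes (V // R) i" and "b = ranked_sizes (V // R') i"
  have RV: "R \<subseteq> V \<times> V" using R by (rule equiv_type)
  have fin: "finite (R - R')" using RV V by (meson finite_Diff finite_SigmaI finite_subset)
  have finq: "finite (V // R)" "finite (V // R')"
    using V RV sub by (auto intro!: finite_quotient)
  have class_V: "c \<subseteq> V" if "c \<in> V // R" for c using that RV by (auto simp: quotient_def)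
  have fin_class: "finite c" if "c \<in> V // R" for c using class_V[OF that] V finite_subset by blast
  have up: "R `` {u} \<in> V // R" "R' `` {u} \<subseteq> R `` {u}" "u \<in> R' `` {u}" "R' `` {u} \<in> V // R'" if "u \<in> V" for u
    using that sub equiv_class_self[OF R' that] by (auto simp: quotient_def)
  consider "a = b" | "b < a" | "a < b" by linarith
  then show ?thesis
  proof cases
    case 2
    \<comment> \<open>Otherwise picking a fine class larger than \<open>b\<close> inside every
      coarse class of size at least \<open>a\<close> would be injective, and more than
      \<open>i\<close> fine classes would exceed \<open>b\<close>, the size at rank
      \<open>i\<close>.\<close>
    have "\<exists>c\<in>V // R. a \<le> card c \<and> (\<forall>u\<in>c. card (R' `` {u}) \<le> b)"
    proof (rule ccontr)
      assume "\<not> ?thesis"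
      then have "\<forall>c\<in>{c \<in> V // R. a \<le> card c}. \<exists>u\<in>c. b < card (R' `` {u})" by (auto simp: not_le)
      then obtain f where f: "\<And>c. c \<in> V // R \<Longrightarrow> a \<le> card c \<Longrightarrow> f c \<in> c \<and> b < card (R' `` {f c})"
        by (metis (mono_tags, lifting) mem_Collect_eq)
      have eq: "R `` {f c} = c" if "c \<in> V // R" "a \<le> card c" for c
        using f[OF that] that(1) R by (metis Image_singleton_iff equiv_class_eq_iff quotientE)
      have inj: "inj_on (\<lambda>c. R' `` {f c}) {c \<in> V // R. a \<le> card c}"
      proof (rule inj_onI, clarify)
        fix c d assume c: "c \<in> V // R" "a \<le> card c" and d: "d \<in> V // R" "a \<le> card d"
          and e: "R' `` {f c} = R' `` {f d}"
        have "f c \<in> V" "f d \<in> V" using f class_V c d by blast+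
        then have "(f c, f d) \<in> R'" using e R' by (simp add: eq_equiv_class_iff)
        then have "R `` {f c} = R `` {f d}" using sub R by (meson equiv_class_eq subsetD)
        then show "c = d" using eq c d by simp
      qed
      have "i < card {c \<in> V // R. a \<le> card c}"
        using ranked_sizes_ge_iff[OF finq(1), of a i] 2 by (simp add: a_def)
      also have "\<dots> = card ((\<lambda>c. R' `` {f c}) ` {c \<in> V // R. a \<le> card c})"
        using inj by (simp add: card_image)
      also have "\<dots> \<le> card {d \<in> V // R'. Suc b \<le> card d}"
        using f class_V up(4) finq(2) by (intro card_mono) (auto simp: Suc_le_eq)
      finally have "Suc b \<le> b" using ranked_sizes_ge_iff[OF finq(2), of "Suc b" i] by (simp add: b_def)
      then show False by simp
    qed
    then obtain c where c: "c \<in> V // R" "a \<le> card c" "\<And>u. u \<in> c \<Longrightarrow> card (R' `` {u}) \<le> b" by blast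
    have "(a - b) * (a - b) \<le> card c * (card c - b)" using c(2) by (intro mult_le_mono) auto
    also have "\<dots> = (\<Sum>u\<in>c. card c - b)" by simp
    also have "\<dots> \<le> (\<Sum>u\<in>c. card (c - R' `` {u}))"
    proof (rule sum_mono)
      fix u assume u: "u \<in> c"
      have "card c - card (R' `` {u}) \<le> card (c - R' `` {u})"
        by (rule diff_card_le_card_Diff) (use V RV sub in \<open>auto intro: finite_subset[of _ V]\<close>)
      then show "card c - b \<le> card (c - R' `` {u})" using c(3)[OF u] by simp
    qed
    also have "\<dots> = card (SIGMA u:c. c - R' `` {u})"
      using fin_class[OF c(1)] by (subst card_SigmaI) auto
    also have "\<dots> \<le> card (R - R')"
      using in_quotient_imp_in_rel[OF R c(1)] by (intro card_mono fin) auto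
    finally have "(real (a - b))\<^sup>2 \<le> card (R - R')"
      unfolding power2_eq_square by (simp flip: of_nat_mult)
    then show ?thesis using 2 by (simp add: a_def[symmetric] b_def[symmetric] of_nat_diff)
  next
    case 3
    \<comment> \<open>A rank can also grow under refinement, namely when a larger class splits. Then
      more than \<open>i\<close> fine classes of size at least \<open>b\<close> sit inside at most
      \<open>i\<close> coarse classes larger than \<open>a\<close>, so two of them share
      one.\<close>
    define D where "D = {d \<in> V // R'. b \<le> card d}"
    define C where "C = {c \<in> V // R. Suc a \<le> card c}"
    have iD: "i < card D" using ranked_sizes_ge_iff[OF finq(2), of b i] 3 by (simp add: b_def D_def)
    have "\<not> i < card C" using ranked_sizes_ge_iff[OF finq(1), of "Suc a" i] by (simp add: a_def C_def)
    then have less: "card C < card D" using iD by simp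
    have "(\<lambda>d. R `` d) ` D \<subseteq> C"
    proof
      fix c assume "c \<in> (\<lambda>d. R `` d) ` D"
      then obtain u where u: "u \<in> V" "c = R `` (R' `` {u})" "b \<le> card (R' `` {u})"
        by (auto simp: D_def quotient_def)
      have "R `` (R' `` {u}) = R `` {u}"
        using up(3)[OF u(1)] sub equiv_class_eq[OF R] by blast
      then have c: "c = R `` {u}" using u(2) by simp
      have "card (R' `` {u}) \<le> card c"
        unfolding c using up(1,2)[OF u(1)] fin_class by (intro card_mono) auto
      then show "c \<in> C" using c up(1)[OF u(1)] u(3) 3 by (simp add: C_def)
    qed
    then have "card ((\<lambda>d. R `` d) ` D) \<le> card C" using finq by (intro card_mono) (auto simp: C_def)
    then have "\<not> inj_on (\<lambda>d. R `` d) D" using less by (metis card_image not_less)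
    then obtain d e where de: "d \<in> D" "e \<in> D" "d \<noteq> e" "R `` d = R `` e" by (auto simp: inj_on_def)
    have dV: "d \<in> V // R'" "e \<in> V // R'" using de by (auto simp: D_def)
    have "d \<times> e \<subseteq> R - R'"
    proof
      fix z assume "z \<in> d \<times> e"
      then obtain u v where z: "z = (u, v)" "u \<in> d" "v \<in> e" by auto
      then have uv: "u \<in> V" "v \<in> V" using dV R' equiv_type[OF R'] by (auto simp: quotient_def)
      have "v \<in> R `` e" using z(3) uv(2) R by (auto simp: equiv_def refl_on_def)
      then obtain w where w: "w \<in> d" "(w, v) \<in> R" using de(4) by blast
      have "(u, w) \<in> R" using quotient_eq_iff[OF R' dV(1) dV(1) z(2) w(1)] sub by auto
      then have "(u, v) \<in> R" using w(2) R by (meson equivE transE)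
      moreover have "(u, v) \<notin> R'" using quotient_eq_iff[OF R' dV z(2,3)] de(3) by auto
      ultimately show "z \<in> R - R'" using z(1) by simp
    qed
    then have "card d * card e \<le> card (R - R')"
      using card_mono[OF fin] by (metis card_cartesian_product)
    moreover have "(b - a) * (b - a) \<le> card d * card e"
      using de(1,2) by (intro mult_le_mono) (auto simp: D_def)
    ultimately have "(b - a) * (b - a) \<le> card (R - R')" by linarith
    then have "(real (b - a))\<^sup>2 \<le> card (R - R')"
      unfolding power2_eq_square by (simp flip: of_nat_mult)
    then show ?thesis using 3
      by (simp add: a_def[symmetric] b_def[symmetric] of_nat_diff power2_commute[of "real a"])
  qed (simp add: a_def[symmetric] b_def[symmetric])
qed

section \<open>Connectivity in forests of parent-child edges\<close>

definition connectivity :: "'v set \<Rightarrow> ('v \<times> 'v) set \<Rightarrow> ('v \<times> 'v) set" where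
  "connectivity V F = {(u, v). u \<in> V \<and> v \<in> V \<and> (u, v) \<in> (F \<union> F\<inverse>)\<^sup>*}"

lemma conn_components_eq: "conn_components V F = V // connectivity V F"
  by (simp add: conn_components_def connectivity_def)

lemma equiv_connectivity: "equiv V (connectivity V F)"
proof (rule equivI)
  have "sym ((F \<union> F\<inverse>)\<^sup>*)" by (rule sym_rtrancl) (auto simp: sym_def)
  then show "sym (connectivity V F)" by (auto simp: sym_def connectivity_def)
qed (auto simp: refl_on_def trans_def connectivity_def intro: rtrancl_trans)

lemma connectivity_mono: "F \<subseteq> F' \<Longrightarrow> connectivity V F \<subseteq> connectivity V F'"
  unfolding connectivity_def using rtrancl_mono[of "F \<union> F\<inverse>" "F' \<union> F'\<inverse>"] by blast

definition path_edges :: "nat list \<Rightarrow> edge set" where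
  "path_edges u = (\<lambda>k. (take k u, take (Suc k) u)) ` {..<length u}"

lemma finite_path_edges [simp]: "finite (path_edges u)"
  by (simp add: path_edges_def)

lemma card_path_edges_le: "card (path_edges u) \<le> length u"
  unfolding path_edges_def using card_image_le[of "{..<length u}"] by fastforce

lemma path_edges_snoc: "path_edges (u @ [i]) = insert (u, u @ [i]) (path_edges u)"
  by (auto simp: path_edges_def lessThan_Suc image_iff)

text \<open>The top of the component of a vertex, reached by climbing towards the root along present
  edges. It depends only on the edges above the vertex, and vertices are connected iff their
  tops agree.\<close>

function top_of :: "edge set \<Rightarrow> nat list \<Rightarrow> nat list" where
  "top_of F [] = []"
| "top_of F (u @ [i]) = (if (u, u @ [i]) \<in> F then top_of F u else u @ [i])"
  by (auto intro: rev_exhaust) (metis rev_exhaust surj_pair)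
termination by (relation "Wellfounded.measure (\<lambda>(F, u). length u)") auto

lemma top_of_connected: "(u, top_of F u) \<in> (F \<union> F\<inverse>)\<^sup>*"
  by (induction F u rule: top_of.induct) (auto intro: converse_rtrancl_into_rtrancl)

lemma connected_imp_top_of_eq:
  assumes "F \<subseteq> {(u, u @ [i]) | u i. True}" "(u, v) \<in> (F \<union> F\<inverse>)\<^sup>*"
  shows "top_of F u = top_of F v"
  using assms(2)
proof (induction rule: rtrancl_induct)
  case (step v w)
  have "top_of F y = top_of F x" if "(x, y) \<in> F" for x y
  proof -
    obtain i where "y = x @ [i]" using assms(1) \<open>(x, y) \<in> F\<close> by blast
    then show ?thesis using that by simp
  qed
  then show ?case using step by auto
qed simp

lemma top_of_cong:
  assumes "\<And>e. e \<in> path_edges u \<Longrightarrow> e \<in> F \<longleftrightarrow> e \<in> F'"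
  shows "top_of F u = top_of F' u"
  using assms
proof (induction u rule: rev_induct)
  case (snoc i u)
  then show ?case by (simp add: path_edges_snoc)
qed simp

text \<open>Tops depend only on the edges above a vertex. If none of those above \<open>u\<close>
  and \<open>v\<close> is lost, both tops survive, and they agreed before.\<close>

lemma disconnection_needs_path_edge:
  assumes F: "F \<subseteq> {(u, u @ [i]) | u i. True}" and "F' \<subseteq> F"
    and "(u, v) \<in> connectivity V F - connectivity V F'"
  shows "path_edges u \<inter> (F - F') \<noteq> {} \<or> path_edges v \<inter> (F - F') \<noteq> {}"
proof (rule ccontr)
  assume neg: "\<not> ?thesis"
  have uv: "u \<in> V" "v \<in> V" "(u, v) \<in> (F \<union> F\<inverse>)\<^sup>*" "(u, v) \<notin> (F' \<union> F'\<inverse>)\<^sup>*"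
    using assms(3) by (auto simp: connectivity_def)
  have "top_of F' w = top_of F w" if "path_edges w \<inter> (F - F') = {}" for w
    by (rule top_of_cong) (use that assms(2) in blast)
  then have "top_of F' u = top_of F' v"
    using neg connected_imp_top_of_eq[OF F uv(3)] by simp
  moreover have "sym ((F' \<union> F'\<inverse>)\<^sup>*)" by (rule sym_rtrancl) (auto simp: sym_def)
  then have "(top_of F' v, v) \<in> (F' \<union> F'\<inverse>)\<^sup>*" using top_of_connected[of v F'] by (rule symD)
  ultimately have "(u, v) \<in> (F' \<union> F'\<inverse>)\<^sup>*"
    using top_of_connected[of u F'] by (metis rtrancl_trans)
  then show False using uv by simp
qed

text \<open>Every lost pair has a vertex with a lost edge above it. The sum counts each such vertex
  at least once, and a vertex lies in at most \<open>2 * card V\<close> ordered pairs.\<close>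

lemma card_connectivity_diff_le:
  assumes F: "F \<subseteq> {(u, u @ [i]) | u i. True}" and "F' \<subseteq> F" and V: "finite V"
  shows "card (connectivity V F - connectivity V F') \<le> 2 * card V * (\<Sum>u\<in>V. card (path_edges u \<inter> (F - F')))"
proof -
  define B where "B = {u \<in> V. path_edges u \<inter> (F - F') \<noteq> {}}"
  have "connectivity V F - connectivity V F' \<subseteq> B \<times> V \<union> V \<times> B"
  proof
    fix z assume z: "z \<in> connectivity V F - connectivity V F'"
    obtain u v where uv: "z = (u, v)" by (cases z)
    have "u \<in> V" "v \<in> V" using z uv by (auto simp: connectivity_def)
    then show "z \<in> B \<times> V \<union> V \<times> B"
      using disconnection_needs_path_edge[OF F assms(2)] z unfolding uv B_def by blast
  qed
  moreover have fin: "finite B" using V by (simp add: B_def)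
  ultimately have "card (connectivity V F - connectivity V F') \<le> card (B \<times> V \<union> V \<times> B)"
    using V by (intro card_mono) auto
  also have "\<dots> \<le> card (B \<times> V) + card (V \<times> B)" by (rule card_Un_le)
  also have "\<dots> = 2 * card V * card B" by (simp add: card_cartesian_product)
  also have "card B = (\<Sum>u\<in>B. 1)" by simp
  also have "(\<Sum>u\<in>B. 1) \<le> (\<Sum>u\<in>B. card (path_edges u \<inter> (F - F')))"
    by (intro sum_mono) (auto simp: B_def Suc_le_eq card_gt_0_iff)
  also have "\<dots> \<le> (\<Sum>u\<in>V. card (path_edges u \<inter> (F - F')))"
    by (rule sum_mono2) (use V in \<open>auto simp: B_def\<close>)
  finally show ?thesis by simp
qed

section \<open>Step paths\<close>

subsection \<open>Paths driven by finitely many deletion times\<close>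

text \<open>Time enters only through the set of surviving edges, so paths with the same order of
  deletions run through the same states. An edge is already gone at its own deletion time, which
  makes the path right-continuous.\<close>

definition step_path :: "('e set \<Rightarrow> 'a) \<Rightarrow> 'e set \<Rightarrow> ('e \<Rightarrow> real) \<Rightarrow> real \<Rightarrow> 'a" where
  "step_path h E \<tau> = (\<lambda>t\<in>{0..}. h {e \<in> E. t < \<tau> e})"

lemma step_path_eq: "t \<ge> 0 \<Longrightarrow> step_path h E \<tau> t = h {e \<in> E. t < \<tau> e}"
  by (simp add: step_path_def)

lemma remaining_right_constant:
  assumes "finite E"
  shows "\<exists>r>t. \<forall>s. t < s \<and> s < r \<longrightarrow> {e \<in> E. s < \<tau> e} = {e \<in> E. t < (\<tau> e :: real)}"
proof -
  \<comment> \<open>The element \<open>t + 1\<close> keeps the set nonempty when no deletion lies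
    ahead.\<close>
  let ?A = "insert (t + 1) (\<tau> ` {e \<in> E. t < \<tau> e})"
  have A: "finite ?A" "?A \<noteq> {}" using assms by auto
  have "t < Min ?A" using A by (subst Min_gr_iff) auto
  moreover have "{e \<in> E. s < \<tau> e} = {e \<in> E. t < \<tau> e}" if s: "t < s" "s < Min ?A" for s
  proof -
    have "s < \<tau> e" if "e \<in> E" "t < \<tau> e" for e
      using s(2) Min_le[OF A(1), of "\<tau> e"] that by fastforce
    then show ?thesis using s(1) by auto
  qed
  ultimately show ?thesis by (intro exI[of _ "Min ?A"]) simp
qed

lemma remaining_left_constant:
  assumes "finite E"
  shows "\<exists>r<t. \<forall>s. r < s \<and> s < t \<longrightarrow> {e \<in> E. s < \<tau> e} = {e \<in> E. t \<le> (\<tau> e :: real)}"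
proof -
  let ?A = "insert (t - 1) (\<tau> ` {e \<in> E. \<tau> e < t})"
  have A: "finite ?A" "?A \<noteq> {}" using assms by auto
  have "Max ?A < t" using A by (subst Max_less_iff) auto
  moreover have "{e \<in> E. s < \<tau> e} = {e \<in> E. t \<le> \<tau> e}" if s: "Max ?A < s" "s < t" for s
  proof -
    have "\<tau> e < s" if "e \<in> E" "\<tau> e < t" for e
      using s(1) Max_ge[OF A(1), of "\<tau> e"] that by fastforce
    then have "s < \<tau> e \<longleftrightarrow> t \<le> \<tau> e" if "e \<in> E" for e
      using s(2) that by (cases "\<tau> e < t") force+
    then show ?thesis by blast
  qed
  ultimately show ?thesis by (intro exI[of _ "Max ?A"]) simp
qed

lemma step_path_cadlag:
  assumes E: "finite E" and h: "\<And>F. F \<subseteq> E \<Longrightarrow> h F \<in> S"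
  shows "step_path h E \<tau> \<in> cadlag S"
proof -
  let ?x = "step_path h E \<tau>"
  have "?x \<in> {0..} \<rightarrow>\<^sub>E S" using h by (auto simp: step_path_def)
  moreover have "(?x \<longlongrightarrow> ?x t) (at_right t)" if t: "t \<ge> 0" for t
  proof (rule tendsto_eventually)
    obtain r where r: "r > t" "\<And>s. t < s \<Longrightarrow> s < r \<Longrightarrow> {e \<in> E. s < \<tau> e} = {e \<in> E. t < \<tau> e}"
      using remaining_right_constant[OF E, of t \<tau>] by blast
    have "?x s = ?x t" if "t < s" "s < r" for s using t that r(2)[OF that] by (simp add: step_path_eq)
    then show "eventually (\<lambda>s. ?x s = ?x t) (at_right t)"
      unfolding eventually_at_right_field using r(1) by blast
  qed
  moreover have "(?x \<longlongrightarrow> h {e \<in> E. t \<le> \<tau> e}) (at_left t)" if t: "t > 0" for t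
  proof (rule tendsto_eventually)
    obtain r where r: "r < t" "\<And>s. r < s \<Longrightarrow> s < t \<Longrightarrow> {e \<in> E. s < \<tau> e} = {e \<in> E. t \<le> \<tau> e}"
      using remaining_left_constant[OF E, of t \<tau>] by blast
    have "?x s = h {e \<in> E. t \<le> \<tau> e}" if "max r 0 < s" "s < t" for s
      using that r(2)[of s] by (simp add: step_path_eq)
    then show "eventually (\<lambda>s. ?x s = h {e \<in> E. t \<le> \<tau> e}) (at_left t)"
      unfolding eventually_at_left_field using r(1) t by (intro exI[of _ "max r 0"]) simp
  qed
  moreover have "h {e \<in> E. t \<le> \<tau> e} \<in> S" for t by (rule h) auto
  ultimately show ?thesis unfolding cadlag_def by blast
qed

text \<open>A time change that carries each positive \<open>\<tau> e\<close> to
  \<open>\<tau>' e\<close> turns one path exactly into the other. Equal order makes this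
  prescription well defined, since ties stay ties, and increasing. \<open>sign\<close> takes care of
  edges that are missing from time 0 on, as a time change fixes 0.\<close>

lemma step_path_same_order:
  assumes E: "finite E" and h: "\<And>F. F \<subseteq> E \<Longrightarrow> h F \<in> S"
    and order: "\<And>e f. e \<in> E \<Longrightarrow> f \<in> E \<Longrightarrow> \<tau> e < \<tau> f \<longleftrightarrow> \<tau>' e < \<tau>' f"
    and sign: "\<And>e. e \<in> E \<Longrightarrow> \<tau> e \<le> 0 \<longleftrightarrow> \<tau>' e \<le> 0"
    and \<epsilon>: "\<epsilon> > 0" and close: "\<And>e. e \<in> E \<Longrightarrow> \<bar>\<tau>' e - \<tau> e\<bar> < \<epsilon>"
  shows "step_path h E \<tau>' \<in> J1_nbhd S (step_path h E \<tau>) T \<epsilon>"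
proof -
  define A where "A = \<tau> ` {e \<in> E. 0 < \<tau> e}"
  define g where "g a = \<tau>' (SOME e. e \<in> E \<and> \<tau> e = a)" for a
  have g: "g (\<tau> e) = \<tau>' e" if "e \<in> E" for e
  proof -
    let ?f = "SOME f. f \<in> E \<and> \<tau> f = \<tau> e"
    have f: "?f \<in> E" "\<tau> ?f = \<tau> e" using someI[of "\<lambda>f. f \<in> E \<and> \<tau> f = \<tau> e" e] that by auto
    have "\<not> \<tau>' ?f < \<tau>' e" "\<not> \<tau>' e < \<tau>' ?f" using order[OF f(1) that] order[OF that f(1)] f(2) by auto
    then show ?thesis by (simp add: g_def)
  qed
  have "\<exists>l\<in>time_changes. (\<forall>a\<in>A. l a = g a) \<and> (\<forall>t\<ge>0. \<bar>l t - t\<bar> < \<epsilon>)"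
  proof (rule ex_time_change_set)
    show "finite A" using E by (simp add: A_def)
    show "strict_mono_on A g"
      using g order by (auto simp: strict_mono_on_def A_def)
    show "0 < g a" if "a \<in> A" for a
      using that g sign by (force simp: A_def not_le[symmetric])
    show "\<bar>g a - a\<bar> < \<epsilon>" if "a \<in> A" for a
      using that g close by (auto simp: A_def)
  qed (use \<epsilon> in \<open>auto simp: A_def\<close>)
  then obtain l where l: "l \<in> time_changes" "\<forall>a\<in>A. l a = g a" "\<forall>t\<ge>0. \<bar>l t - t\<bar> < \<epsilon>" by blast
  have "step_path h E \<tau>' (l t) = step_path h E \<tau> t" if t: "t \<ge> 0" for t
  proof -
    have "l t < \<tau>' e \<longleftrightarrow> t < \<tau> e" if e: "e \<in> E" for e
    proof (cases "\<tau> e \<le> 0")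
      case True
      then show ?thesis using sign[OF e] t time_changesD(4)[OF l(1) t] by auto
    next
      case False
      then have "l (\<tau> e) = \<tau>' e" using l(2) g[OF e] e by (auto simp: A_def)
      then show ?thesis using time_changesD(2)[OF l(1) t, of "\<tau> e"] False by simp
    qed
    then have "{e \<in> E. l t < \<tau>' e} = {e \<in> E. t < \<tau> e}" by blast
    then show ?thesis using t time_changesD(4)[OF l(1) t] by (simp add: step_path_eq)
  qed
  then show ?thesis
    unfolding J1_nbhd_def using step_path_cadlag[OF E h] l(1,3) \<epsilon>
    by (intro CollectI conjI bexI[of _ l] ballI) auto
qed

text \<open>Among deletion times in the same relative order the path depends continuously on them.\<close>

lemma measurable_step_path:
  fixes E :: "'e::countable set"
  assumes E: "finite E" and h: "\<And>F. F \<subseteq> E \<Longrightarrow> h F \<in> S"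
  shows "step_path h E \<in> borel \<rightarrow>\<^sub>M borel_sets_of (skorohod_J1 S)"
  unfolding borel_sets_of_def
proof (rule measurable_measure_of)
  show "{G. openin (skorohod_J1 S) G} \<subseteq> Pow (topspace (skorohod_J1 S))"
    using openin_subset by blast
  show "step_path h E \<in> space borel \<rightarrow> topspace (skorohod_J1 S)"
    using step_path_cadlag[OF E h] by (auto simp: topspace_skorohod_J1)
  fix G assume "G \<in> {G. openin (skorohod_J1 S) G}"
  then have G: "\<And>x. x \<in> G \<Longrightarrow> \<exists>T>0. \<exists>e>0. J1_nbhd S x T e \<subseteq> G" by (simp add: openin_skorohod_J1)
  define pat where "pat \<tau> = ({(e, f) \<in> E \<times> E. \<tau> e < \<tau> f}, {e \<in> E. \<tau> e \<le> 0})" for \<tau> :: "'e \<Rightarrow> real"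
  have "\<exists>r>0. \<forall>\<tau>'. pat \<tau>' = pat \<tau> \<longrightarrow> (\<forall>e\<in>E. \<bar>\<tau>' e - \<tau> e\<bar> < r) \<longrightarrow> step_path h E \<tau>' \<in> G"
    if in_G: "step_path h E \<tau> \<in> G" for \<tau>
  proof -
    obtain T r where r: "r > 0" "J1_nbhd S (step_path h E \<tau>) T r \<subseteq> G" using G[OF in_G] by blast
    have "step_path h E \<tau>' \<in> G" if p: "pat \<tau>' = pat \<tau>" and c: "\<forall>e\<in>E. \<bar>\<tau>' e - \<tau> e\<bar> < r" for \<tau>'
    proof -
      have 1: "{(e, f) \<in> E \<times> E. \<tau>' e < \<tau>' f} = {(e, f) \<in> E \<times> E. \<tau> e < \<tau> f}"
        and 2: "{e \<in> E. \<tau>' e \<le> 0} = {e \<in> E. \<tau> e \<le> 0}" using p by (auto simp only: pat_def prod.inject)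
      have "step_path h E \<tau>' \<in> J1_nbhd S (step_path h E \<tau>) T r"
      proof (rule step_path_same_order[OF E h])
        show "\<tau> e < \<tau> f \<longleftrightarrow> \<tau>' e < \<tau>' f" if "e \<in> E" "f \<in> E" for e f using 1 that by blast
        show "\<tau> e \<le> 0 \<longleftrightarrow> \<tau>' e \<le> 0" if "e \<in> E" for e using 2 that by blast
      qed (use r(1) c in auto)
      then show ?thesis using r(2) by blast
    qed
    then show ?thesis using r(1) by blast
  qed
  then obtain r where r: "\<And>\<tau>. step_path h E \<tau> \<in> G \<Longrightarrow> r \<tau> > 0"
      "\<And>\<tau> \<tau>'. step_path h E \<tau> \<in> G \<Longrightarrow> pat \<tau>' = pat \<tau> \<Longrightarrow> \<forall>e\<in>E. \<bar>\<tau>' e - \<tau> e\<bar> < r \<tau> \<Longrightarrow> step_path h E \<tau>' \<in> G"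
    by metis
  \<comment> \<open>The union ranges over uncountably many \<open>\<tau>\<close> and is measurable
    because it is open. Cut down to its pattern \<open>a\<close>, it is the part of the preimage of
    \<open>G\<close> with that pattern, and only finitely many patterns occur.\<close>
  define O' where "O' a = (\<Union>\<tau>\<in>{\<tau>. step_path h E \<tau> \<in> G \<and> pat \<tau> = a}. \<Inter>e\<in>E. {\<tau>'. \<bar>\<tau>' e - \<tau> e\<bar> < r \<tau>})" for a
  have "open (O' a)" for a
  proof -
    have "open {\<tau>' :: 'e \<Rightarrow> real. \<bar>\<tau>' e - c\<bar> < d}" for e c d
      by (intro open_Collect_less continuous_on_rabs continuous_on_diff continuous_on_const
          continuous_on_product_coordinates)
    then show ?thesis unfolding O'_def using E by (intro open_UN open_INT ballI) auto
  qed
  then have meas_O: "O' a \<in> sets borel" for a by (rule borel_open)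
  have [measurable]: "(\<lambda>\<tau> :: 'e \<Rightarrow> real. \<tau> e) \<in> borel_measurable borel" for e
    by (intro borel_measurable_continuous_onI continuous_on_product_coordinates)
  have lt: "{\<tau> :: 'e \<Rightarrow> real. \<tau> e < \<tau> f} \<in> sets borel" "{\<tau> :: 'e \<Rightarrow> real. \<not> \<tau> e < \<tau> f} \<in> sets borel" for e f
    by measurable
  have le: "{\<tau> :: 'e \<Rightarrow> real. \<tau> e \<le> 0} \<in> sets borel" "{\<tau> :: 'e \<Rightarrow> real. \<not> \<tau> e \<le> 0} \<in> sets borel" for e
    by measurable
  have meas_pat: "{\<tau>. pat \<tau> = a} \<in> sets borel" if a: "a \<in> Pow (E \<times> E) \<times> Pow E" for a
  proof -
    obtain B C where BC: "a = (B, C)" by (cases a)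
    have "{\<tau>. pat \<tau> = a} = {\<tau> \<in> space borel. \<forall>e\<in>E. (\<forall>f\<in>E. (\<tau> e < \<tau> f) = ((e, f) \<in> B)) \<and> (\<tau> e \<le> 0) = (e \<in> C)}"
      using a by (auto simp: pat_def BC)
    also have "\<dots> \<in> sets borel"
    proof (intro sets.sets_Collect_finite_All sets.sets_Collect_conj E)
      fix e f
      show "{\<tau> \<in> space borel. (\<tau> e < \<tau> f) = ((e, f) \<in> B)} \<in> sets (borel :: ('e \<Rightarrow> real) measure)"
        using lt[of e f] by (cases "(e, f) \<in> B") simp_all
      show "{\<tau> \<in> space borel. (\<tau> e \<le> 0) = (e \<in> C)} \<in> sets (borel :: ('e \<Rightarrow> real) measure)"
        using le[of e] by (cases "e \<in> C") simp_all
    qed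
    finally show ?thesis .
  qed
  have "step_path h E -` G \<inter> space borel = (\<Union>a\<in>Pow (E \<times> E) \<times> Pow E. {\<tau>. pat \<tau> = a} \<inter> O' a)"
  proof (intro equalityI subsetI)
    fix \<tau> assume "\<tau> \<in> step_path h E -` G \<inter> space borel"
    then have \<tau>: "step_path h E \<tau> \<in> G" by simp
    have "pat \<tau> \<in> Pow (E \<times> E) \<times> Pow E" by (auto simp: pat_def)
    moreover have "\<tau> \<in> O' (pat \<tau>)" unfolding O'_def using \<tau> r(1)[OF \<tau>] by auto
    ultimately show "\<tau> \<in> (\<Union>a\<in>Pow (E \<times> E) \<times> Pow E. {\<tau>. pat \<tau> = a} \<inter> O' a)"
      by (intro UN_I[of "pat \<tau>"] IntI CollectI refl)
  next
    fix \<tau>' assume "\<tau>' \<in> (\<Union>a\<in>Pow (E \<times> E) \<times> Pow E. {\<tau>. pat \<tau> = a} \<inter> O' a)"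
    then obtain a where a: "pat \<tau>' = a" "\<tau>' \<in> O' a" by (elim UN_E IntE CollectE)
    obtain \<tau> where \<tau>: "\<tau> \<in> {\<tau>. step_path h E \<tau> \<in> G \<and> pat \<tau> = a}"
        and c: "\<tau>' \<in> (\<Inter>e\<in>E. {\<tau>'. \<bar>\<tau>' e - \<tau> e\<bar> < r \<tau>})"
      using a(2) unfolding O'_def by (rule UN_E)
    have "step_path h E \<tau> \<in> G" "pat \<tau>' = pat \<tau>" using \<tau> a(1) by simp_all
    moreover have "\<forall>e\<in>E. \<bar>\<tau>' e - \<tau> e\<bar> < r \<tau>" using c by simp
    ultimately have "step_path h E \<tau>' \<in> G" by (rule r(2))
    then show "\<tau>' \<in> step_path h E -` G \<inter> space borel" by simp
  qed
  also have "\<dots> \<in> sets borel"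
    using E meas_O meas_pat by (intro sets.finite_UN sets.Int) auto
  finally show "step_path h E -` G \<inter> space borel \<in> sets borel" .
qed

subsection \<open>Greedy partitions\<close>

text \<open>The surviving set changes only at deletion times, so the next cut is the first deletion
  time at which \<open>q\<close> is down by more than \<open>\<kappa>\<close> since the last cut,
  capped by the horizon \<open>J\<close>. Edges that do not qualify contribute \<open>J\<close>,
  which leaves a minimum over a fixed finite index set.\<close>

primrec greedy :: "'e set \<Rightarrow> ('e set \<Rightarrow> real) \<Rightarrow> real \<Rightarrow> real \<Rightarrow> ('e \<Rightarrow> real) \<Rightarrow> nat \<Rightarrow> real" where
  "greedy E q \<kappa> J \<tau> 0 = 0"
| "greedy E q \<kappa> J \<tau> (Suc i) = Min (insert J ((\<lambda>e.
     if greedy E q \<kappa> J \<tau> i < \<tau> e \<and> \<kappa> < q {f \<in> E. greedy E q \<kappa> J \<tau> i < \<tau> f} - q {f \<in> E. \<tau> e < \<tau> f}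
     then \<tau> e else J) ` E))"

declare greedy.simps(2) [simp del]

context
  fixes E :: "'e set" and q :: "'e set \<Rightarrow> real" and \<kappa> J :: real
  assumes E: "finite E" and J: "J > 0"
begin

abbreviation "cutting \<equiv> greedy E q \<kappa> J"

abbreviation "drops \<tau> s t \<equiv> \<kappa> < q {f \<in> E. s < \<tau> f} - q {f \<in> E. t < \<tau> f}"

lemma greedy_le: "cutting \<tau> i \<le> J"
  using J E by (cases i) (auto simp: greedy.simps(2) intro!: Min_le)

lemma greedy_Suc_le:
  assumes "e \<in> E" "cutting \<tau> i < \<tau> e" "drops \<tau> (cutting \<tau> i) (\<tau> e)"
  shows "cutting \<tau> (Suc i) \<le> \<tau> e"
  unfolding greedy.simps by (rule Min_le) (use E assms in \<open>auto intro!: image_eqI[of _ _ e]\<close>)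

lemma greedy_Suc_cases:
  obtains "cutting \<tau> (Suc i) = J"
  | e where "e \<in> E" "cutting \<tau> i < \<tau> e" "drops \<tau> (cutting \<tau> i) (\<tau> e)"
      "cutting \<tau> (Suc i) = \<tau> e"
proof -
  let ?A = "insert J ((\<lambda>e.
     if cutting \<tau> i < \<tau> e \<and> \<kappa> < q {f \<in> E. cutting \<tau> i < \<tau> f} - q {f \<in> E. \<tau> e < \<tau> f}
     then \<tau> e else J) ` E)"
  have "Min ?A \<in> ?A" using E by (intro Min_in) auto
  moreover have "cutting \<tau> (Suc i) = Min ?A" by (rule greedy.simps(2))
  ultimately show thesis using that by (auto split: if_splits)
qed

lemma greedy_mono: "cutting \<tau> i \<le> cutting \<tau> (Suc i)"
  by (rule greedy_Suc_cases[of \<tau> i]) (use greedy_le in auto)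

lemma greedy_nonneg: "0 \<le> cutting \<tau> i"
proof (induction i)
  case (Suc i)
  then show ?case using greedy_mono[of \<tau> i] by (rule order.trans)
qed simp

text \<open>The surviving set at \<open>t\<close> is that of the last deletion time up to
  \<open>t\<close>, where such a drop would already have caused a cut.\<close>

lemma greedy_no_drop:
  assumes "\<kappa> \<ge> 0" "cutting \<tau> i \<le> t" "t < cutting \<tau> (Suc i)"
  shows "\<not> drops \<tau> (cutting \<tau> i) t"
proof
  let ?s = "cutting \<tau> i"
  assume drop: "drops \<tau> ?s t"
  let ?B = "\<tau> ` {e \<in> E. ?s < \<tau> e \<and> \<tau> e \<le> t}"
  have "?B \<noteq> {}"
  proof
    assume "?B = {}"
    then have "{f \<in> E. ?s < \<tau> f} = {f \<in> E. t < \<tau> f}" using assms(2) by (auto simp: not_le)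
    then show False using drop assms(1) by simp
  qed
  then have "Max ?B \<in> ?B" using E by (intro Max_in) auto
  then obtain e where e: "e \<in> E" "?s < \<tau> e" "\<tau> e \<le> t" "Max ?B = \<tau> e" by auto
  have "{f \<in> E. \<tau> e < \<tau> f} = {f \<in> E. t < \<tau> f}"
  proof (intro Collect_cong conj_cong refl iffI)
    fix f assume f: "f \<in> E" "\<tau> e < \<tau> f"
    show "t < \<tau> f"
    proof (rule ccontr)
      assume "\<not> t < \<tau> f"
      then have "\<tau> f \<le> Max ?B" using f e E by (intro Max_ge) auto
      then show False using f(2) e(4) by simp
    qed
  qed (use e(3) in simp)
  then have "cutting \<tau> (Suc i) \<le> \<tau> e" using greedy_Suc_le[OF e(1,2)] drop by simp
  then show False using assms(3) e(3) by simp
qed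

lemma greedy_drop:
  assumes "cutting \<tau> (Suc i) < J"
  shows "drops \<tau> (cutting \<tau> i) (cutting \<tau> (Suc i))"
  by (rule greedy_Suc_cases[of \<tau> i]) (use assms in auto)

text \<open>Each cut before \<open>J\<close> costs more than \<open>\<kappa>\<close> of a quantity
  that lies between 0 and 1.\<close>

lemma greedy_eventually_J:
  assumes q: "\<And>F. F \<subseteq> E \<Longrightarrow> 0 \<le> q F \<and> q F \<le> 1" and "1 \<le> real m * \<kappa>" "m \<le> i"
  shows "cutting \<tau> i = J"
proof (rule ccontr)
  \<comment> \<open>Strict from the first cut on: for \<open>m * \<kappa> = 1\<close> the weak bound
    would still allow the value 0.\<close>
  have "q {f \<in> E. cutting \<tau> i < \<tau> f} \<le> 1 - real i * \<kappa> \<and> (i > 0 \<longrightarrow> q {f \<in> E. cutting \<tau> i < \<tau> f} < 1 - real i * \<kappa>)"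
    if "cutting \<tau> i < J" for i
    using that
  proof (induction i)
    case 0
    then show ?case using q[of "{f \<in> E. 0 < \<tau> f}"] by auto
  next
    case (Suc i)
    have "cutting \<tau> i < J" using Suc.prems greedy_mono[of \<tau> i] by linarith
    then show ?case using Suc.IH greedy_drop[OF Suc.prems] by (simp add: algebra_simps)
  qed
  moreover assume "cutting \<tau> i \<noteq> J"
  then have "cutting \<tau> i < J" using greedy_le[of \<tau> i] by simp
  moreover have \<kappa>: "\<kappa> > 0" "m > 0" using assms(2) by (auto simp: zero_less_mult_iff dest: order.strict_trans2[OF zero_less_one])
  ultimately have "q {f \<in> E. cutting \<tau> i < \<tau> f} < 1 - real i * \<kappa>" using assms(3) by auto
  moreover have "real m * \<kappa> \<le> real i * \<kappa>" using assms(3) \<kappa> by simp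
  ultimately show False using assms(2) q[of "{f \<in> E. cutting \<tau> i < \<tau> f}"] by auto
qed

text \<open>A pathwise stopping-time property: cuts made while \<open>f\<close> is present do not
  know when \<open>f\<close> will go. With the new time \<open>c\<close> beyond the horizon,
  \<open>f\<close> can never be a cut itself.\<close>

lemma greedy_stopping:
  assumes "f \<in> E" "J < c" "cutting \<tau> i < \<tau> f"
  shows "cutting (\<tau>(f := c)) i = cutting \<tau> i"
  using assms(3)
proof (induction i)
  case (Suc i)
  let ?g = "cutting \<tau>" and ?\<tau>' = "\<tau>(f := c)"
  let ?g' = "cutting ?\<tau>'"
  have lt: "?g i < \<tau> f" using Suc.prems greedy_mono[of \<tau> i] by linarith
  then have IH: "?g' i = ?g i" by (rule Suc.IH)
  have cJ: "t < c" if "t \<le> J" for t using that assms(2) by simp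
  have same: "{e \<in> E. t < ?\<tau>' e} = {e \<in> E. t < \<tau> e}" if "t < \<tau> f" "t \<le> J" for t
    using that cJ by auto
  have same_i: "{e \<in> E. ?g i < ?\<tau>' e} = {e \<in> E. ?g i < \<tau> e}"
    using same[OF lt greedy_le] .
  show ?case
  proof (rule antisym)
    show "?g' (Suc i) \<le> ?g (Suc i)"
    proof (rule greedy_Suc_cases[of \<tau> i])
      assume "?g (Suc i) = J"
      then show ?thesis using greedy_le[of ?\<tau>' "Suc i"] by simp
    next
      fix e assume e: "e \<in> E" "?g i < \<tau> e" "drops \<tau> (?g i) (\<tau> e)" "?g (Suc i) = \<tau> e"
      have "\<tau> e < \<tau> f" using Suc.prems unfolding e(4) .
      then have ef: "e \<noteq> f" by auto
      have "\<tau> e \<le> J" using e(4) greedy_le[of \<tau> "Suc i"] by simp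
      moreover have "\<tau> e < \<tau> f" using Suc.prems unfolding e(4) .
      ultimately have same_e: "{f \<in> E. \<tau> e < ?\<tau>' f} = {f \<in> E. \<tau> e < \<tau> f}" by (intro same)
      have te: "?\<tau>' e = \<tau> e" using ef by simp
      have "?g' (Suc i) \<le> ?\<tau>' e"
      proof (rule greedy_Suc_le[OF e(1)])
        show "?g' i < ?\<tau>' e" unfolding IH te by (rule e(2))
        show "drops ?\<tau>' (?g' i) (?\<tau>' e)" unfolding IH te same_i same_e by (rule e(3))
      qed
      then show ?thesis unfolding te e(4) .
    qed
    show "?g (Suc i) \<le> ?g' (Suc i)"
    proof (rule greedy_Suc_cases[of ?\<tau>' i])
      assume "?g' (Suc i) = J"
      then show ?thesis using greedy_le[of \<tau> "Suc i"] by simp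
    next
      fix e assume e: "e \<in> E" "?g' i < ?\<tau>' e" "drops ?\<tau>' (?g' i) (?\<tau>' e)" "?g' (Suc i) = ?\<tau>' e"
      have ef: "e \<noteq> f"
      proof
        assume "e = f"
        then have "?\<tau>' e = c" by simp
        then show False using e(4) greedy_le[of ?\<tau>' "Suc i"] assms(2) by linarith
      qed
      show ?thesis
      proof (rule ccontr)
        assume neg: "\<not> ?thesis"
        have te: "?\<tau>' e = \<tau> e" using ef by simp
        have e_lt: "\<tau> e < ?g (Suc i)" using neg unfolding e(4) te not_le .
        then have "\<tau> e < \<tau> f" "\<tau> e \<le> J" using Suc.prems greedy_le[of \<tau> "Suc i"] by linarith+
        then have same_e: "{f \<in> E. \<tau> e < ?\<tau>' f} = {f \<in> E. \<tau> e < \<tau> f}" by (rule same)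
        have "?g (Suc i) \<le> \<tau> e"
          by (rule greedy_Suc_le[OF e(1) e(2)[unfolded IH te] e(3)[unfolded IH te same_i same_e]])
        then show False using e_lt by linarith
      qed
    qed
  qed
qed simp

text \<open>The surviving set takes finitely many values, so the function is a finite sum over
  them.\<close>

lemma measurable_remaining:
  fixes q' :: "'e set \<Rightarrow> real" and g :: "'w \<Rightarrow> real" and X :: "'e \<Rightarrow> 'w \<Rightarrow> real"
  assumes g: "g \<in> borel_measurable M" and X: "\<And>e. e \<in> E \<Longrightarrow> X e \<in> borel_measurable M"
  shows "(\<lambda>\<omega>. q' {f \<in> E. g \<omega> < X f \<omega>}) \<in> borel_measurable M"
proof -
  have eq: "q' {f \<in> E. g \<omega> < X f \<omega>} = (\<Sum>A\<in>Pow E. if \<forall>f\<in>E. (g \<omega> < X f \<omega>) = (f \<in> A) then q' A else 0)" for \<omega>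
  proof -
    have "(\<Sum>A\<in>Pow E. if \<forall>f\<in>E. (g \<omega> < X f \<omega>) = (f \<in> A) then q' A else 0) =
        (\<Sum>A\<in>Pow E. if A = {f \<in> E. g \<omega> < X f \<omega>} then q' A else 0)"
      by (intro sum.cong refl if_cong) auto
    also have "\<dots> = q' {f \<in> E. g \<omega> < X f \<omega>}" using E by simp
    finally show ?thesis ..
  qed
  have "(\<lambda>\<omega>. if \<forall>f\<in>E. (g \<omega> < X f \<omega>) = (f \<in> A) then q' A else 0) \<in> borel_measurable M" for A
  proof (rule measurable_If)
    show "{\<omega> \<in> space M. \<forall>f\<in>E. (g \<omega> < X f \<omega>) = (f \<in> A)} \<in> sets M"
    proof (rule sets.sets_Collect_finite_All[OF _ E])
      fix f assume f: "f \<in> E"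
      have [measurable]: "g \<in> borel_measurable M" "X f \<in> borel_measurable M" using g X[OF f] by auto
      have "{\<omega> \<in> space M. g \<omega> < X f \<omega>} \<in> sets M" "{\<omega> \<in> space M. \<not> g \<omega> < X f \<omega>} \<in> sets M"
        by measurable
      then show "{\<omega> \<in> space M. (g \<omega> < X f \<omega>) = (f \<in> A)} \<in> sets M" by (cases "f \<in> A") simp_all
    qed
  qed auto
  then show ?thesis unfolding eq by (rule borel_measurable_sum)
qed

lemma measurable_greedy:
  assumes X: "\<And>e. e \<in> E \<Longrightarrow> X e \<in> borel_measurable M"
  shows "(\<lambda>\<omega>. cutting (\<lambda>e. X e \<omega>) i) \<in> borel_measurable M"
proof (induction i)
  case (Suc i)
  let ?g = "\<lambda>\<omega>. cutting (\<lambda>e. X e \<omega>) i"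
  have min: "(\<lambda>\<omega>. Min (insert J ((\<lambda>e. Y e \<omega>) ` A))) \<in> borel_measurable M"
    if "finite A" "\<And>e. e \<in> A \<Longrightarrow> Y e \<in> borel_measurable M" for A and Y :: "'e \<Rightarrow> _ \<Rightarrow> real"
    using that
  proof (induction A rule: finite_induct)
    case (insert a A)
    have "(\<lambda>\<omega>. min (Y a \<omega>) (Min (insert J ((\<lambda>e. Y e \<omega>) ` A)))) \<in> borel_measurable M"
      using insert by (intro borel_measurable_min) auto
    also have "(\<lambda>\<omega>. min (Y a \<omega>) (Min (insert J ((\<lambda>e. Y e \<omega>) ` A)))) =
        (\<lambda>\<omega>. Min (insert J ((\<lambda>e. Y e \<omega>) ` insert a A)))"
      using insert.hyps(1) by (simp add: insert_commute[of J])
    finally show ?case .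
  qed simp
  show ?case
    unfolding greedy.simps
  proof (rule min[OF E])
    fix e assume e: "e \<in> E"
    have [measurable]: "?g \<in> borel_measurable M" "X e \<in> borel_measurable M"
      "(\<lambda>\<omega>. q {f \<in> E. ?g \<omega> < X f \<omega>}) \<in> borel_measurable M"
      "(\<lambda>\<omega>. q {f \<in> E. X e \<omega> < X f \<omega>}) \<in> borel_measurable M"
      using Suc X[OF e] measurable_remaining[OF Suc X] measurable_remaining[OF X[OF e] X] by auto
    show "(\<lambda>\<omega>. if ?g \<omega> < X e \<omega> \<and> \<kappa> < q {f \<in> E. ?g \<omega> < X f \<omega>} - q {f \<in> E. X e \<omega> < X f \<omega>}
        then X e \<omega> else J) \<in> borel_measurable M"
      by measurable
  qed
qed simp

end

section \<open>Fragmentation of a tree\<close>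

text \<open>The factor 2 is the sum of the weights \<open>(1 / 2) ^ n\<close> in the library metric
  on sequences.\<close>

lemma dist_seq_le:
  fixes x y :: "nat \<Rightarrow> real"
  assumes "\<And>i. \<bar>x i - y i\<bar> \<le> c"
  shows "dist x y \<le> 2 * c"
proof -
  have g: "summable (\<lambda>n. (1 / 2 :: real) ^ n)" by (rule summable_geometric) simp
  have le: "(1 / 2) ^ n * min (dist (x (from_nat n)) (y (from_nat n))) 1 \<le> (1 / 2) ^ n * c" for n
    using assms by (intro mult_left_mono min.coboundedI1) (auto simp: dist_real_def)
  have "summable (\<lambda>n. (1 / 2) ^ n * min (dist (x (from_nat n)) (y (from_nat n))) 1)"
    by (rule summable_comparison_test'[OF g, of 0]) (simp add: abs_mult mult_left_le)
  then have "dist x y \<le> (\<Sum>n. (1 / 2) ^ n * c)"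
    unfolding dist_fun_def by (rule suminf_le[OF le]) (rule summable_mult2[OF g])
  also have "\<dots> = (\<Sum>n. (1 / 2) ^ n) * c" by (rule suminf_mult2[OF g, symmetric])
  also have "(\<Sum>n. (1 / 2 :: real) ^ n) = 2" by (subst suminf_geometric) auto
  finally show ?thesis .
qed

text \<open>For nonnegative sequences, summability with sum at most 1 is the same as a bound on all
  finite partial sums, and each of these is a closed condition inside the compact box of sequences
  in [0, 1].\<close>

lemma compact_mass_partitions: "compact mass_partitions"
proof -
  let ?D = "{x :: nat \<Rightarrow> real. \<forall>i j. i \<le> j \<longrightarrow> x j \<le> x i}"
  let ?B = "{x :: nat \<Rightarrow> real. \<forall>n. sum x {..<n} \<le> 1}"
  have c: "compact {x :: nat \<Rightarrow> real. \<forall>i. x i \<in> {0..1}}" by (rule compact_fun_box) simp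
  have cl: "closed (?D \<inter> ?B)"
    by (intro closed_Int closed_Collect_all closed_Collect_imp closed_Collect_le open_Collect_const
        continuous_on_sum continuous_on_const continuous_on_product_coordinates)
  have eq: "mass_partitions = {x. \<forall>i. x i \<in> {0..1}} \<inter> (?D \<inter> ?B)"
  proof (intro equalityI subsetI)
    fix x assume "x \<in> mass_partitions"
    then have x: "antimono x" "\<And>i. 0 \<le> x i" "summable x" "suminf x \<le> 1" by (auto simp: mass_partitions_def)
    have sum: "sum x A \<le> 1" if "finite A" for A
      using sum_le_suminf[OF x(3) that] x(2,4) by (meson order.trans)
    have "x i \<le> 1" for i using sum[of "{i}"] by simp
    then show "x \<in> {x. \<forall>i. x i \<in> {0..1}} \<inter> (?D \<inter> ?B)" using x(1,2) sum by (auto simp: antimono_def)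
  next
    fix x assume "x \<in> {x. \<forall>i. x i \<in> {0..1}} \<inter> (?D \<inter> ?B)"
    then have x: "antimono x" "\<And>i. 0 \<le> x i" "\<And>n. sum x {..<n} \<le> 1" by (auto simp: antimono_def)
    have "summable x" using x(2,3) by (rule summableI_nonneg_bounded)
    moreover from this have "suminf x \<le> 1" using x(3) by (rule suminf_le_const)
    ultimately show "x \<in> mass_partitions" using x by (simp add: mass_partitions_def)
  qed
  show ?thesis unfolding eq by (rule compact_Int_closed[OF c cl])
qed

text \<open>The J1 modulus condition in existence form: pieces of length at least \<open>d\<close>
  up to the horizon, with the path compared to its value at the left end of each. It describes one
  level of \<open>skeletons\<close>.\<close>

definition partitionable :: "(real \<Rightarrow> 'a::metric_space) \<Rightarrow> real \<Rightarrow> nat \<Rightarrow> bool" where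
  "partitionable x d j \<longleftrightarrow> (\<exists>s. s 0 = 0 \<and>
     (\<forall>i. 0 \<le> s i \<and> s i \<le> real (Suc j) \<and> min (s i + d) (real (Suc j)) \<le> s (Suc i)) \<and>
     (\<forall>i t. s i \<le> t \<longrightarrow> t < s (Suc i) \<longrightarrow> dist (x t) (x (s i)) \<le> 1 / real (Suc j)))"

text \<open>The values at the left ends serve as skeleton values. Two overlapping pieces both
  contain the later of their left ends, and comparing there gives consistency by the triangle
  inequality.\<close>

lemma skeleton_pathsI:
  assumes x: "x \<in> cadlag S" and ex: "\<And>j. partitionable x (\<delta> j) j"
  shows "x \<in> skeleton_paths S \<delta>"
proof -
  obtain s where s: "\<And>j. s j 0 = 0"
      "\<And>j i. 0 \<le> s j i \<and> s j i \<le> real (Suc j) \<and> min (s j i + \<delta> j) (real (Suc j)) \<le> s j (Suc i)"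
      "\<And>j i t. s j i \<le> t \<Longrightarrow> t < s j (Suc i) \<Longrightarrow> dist (x t) (x (s j i)) \<le> 1 / real (Suc j)"
    using ex unfolding partitionable_def by metis
  define p where "p j i = (s j i, x (s j i))" for j i
  have xS: "x t \<in> S" if "t \<ge> 0" for t using x that by (auto simp: cadlag_def)
  have "min (s j (Suc i)) (s k (Suc m)) \<le> max (s j i) (s k m) \<or>
      dist (x (s j i)) (x (s k m)) \<le> 1 / real (Suc j) + 1 / real (Suc k)" for j i k m
  proof (cases "min (s j (Suc i)) (s k (Suc m)) \<le> max (s j i) (s k m)")
    case False
    define t where "t = max (s j i) (s k m)"
    have "dist (x t) (x (s j i)) \<le> 1 / real (Suc j)" "dist (x t) (x (s k m)) \<le> 1 / real (Suc k)"
    proof -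
      have "s j i \<le> t" "s k m \<le> t" by (simp_all add: t_def)
      moreover have "t < s j (Suc i)" "t < s k (Suc m)"
        using False unfolding not_le t_def min_less_iff_conj by blast+
      ultimately show "dist (x t) (x (s j i)) \<le> 1 / real (Suc j)" "dist (x t) (x (s k m)) \<le> 1 / real (Suc k)"
        by (blast intro: s(3))+
    qed
    then show ?thesis using dist_triangle3[of "x (s j i)" "x (s k m)" "x t"] by linarith
  qed simp
  then have "p \<in> skeletons S \<delta>"
    unfolding skeletons_def p_def mem_Collect_eq fst_conv snd_conv
    using s(1,2) xS by (auto simp del: of_nat_Suc)
  moreover have "fits p x" unfolding fits_def p_def fst_conv snd_conv using s(3) by blast
  ultimately show ?thesis using x unfolding skeleton_paths_def by blast
qed

definition component_masses :: "nat list set \<Rightarrow> edge set \<Rightarrow> nat \<Rightarrow> real" where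
  "component_masses T F i = real (ranked_sizes (conn_components T F) i) / real (card T)"

text \<open>The \<open>Q\<close> of the overview for one tree and one set of surviving edges; the
  two vertices may coincide.\<close>

definition connectivity_fraction :: "nat list set \<Rightarrow> edge set \<Rightarrow> real" where
  "connectivity_fraction T F = real (card (connectivity T F)) / (real (card T))\<^sup>2"

lemma component_masses_in_mass_partitions:
  assumes "finite T" "T \<noteq> {}"
  shows "component_masses T F \<in> mass_partitions"
proof -
  let ?r = "ranked_sizes (conn_components T F)"
  have T: "real (card T) > 0" using assms by (simp add: card_gt_0_iff)
  have "(\<lambda>i. real (?r i)) sums real (card T)"
    using ranked_sizes_sums[of "conn_components T F"] sum_card_quotient[OF equiv_connectivity assms(1), of F]
    by (simp add: conn_components_eq)
  then have "component_masses T F sums (real (card T) / real (card T))"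
    unfolding component_masses_def by (rule sums_divide)
  then have "component_masses T F sums 1" using T by simp
  moreover have "antimono (component_masses T F)"
    using antimono_ranked_sizes[of "conn_components T F"] T
    by (auto simp: antimono_def component_masses_def intro!: divide_right_mono)
  ultimately show ?thesis
    by (auto simp: mass_partitions_def sums_iff component_masses_def)
qed

lemma connectivity_subset: "connectivity V F \<subseteq> V \<times> V"
  by (auto simp: connectivity_def)

lemma connectivity_fraction_bounds:
  assumes "finite T"
  shows "0 \<le> connectivity_fraction T F" "connectivity_fraction T F \<le> 1"
proof -
  have "card (connectivity T F) \<le> card (T \<times> T)" using assms connectivity_subset by (intro card_mono) auto
  also have "\<dots> = (card T)\<^sup>2" by (simp add: card_cartesian_product power2_eq_square)
  finally have "real (card (connectivity T F)) \<le> real ((card T)\<^sup>2)" by (simp only: of_nat_le_iff)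
  then show "connectivity_fraction T F \<le> 1" by (cases "card T = 0") (simp_all add: connectivity_fraction_def divide_le_eq_1)
qed (simp add: connectivity_fraction_def)

lemma connectivity_fraction_diff:
  assumes "finite T" "F' \<subseteq> F"
  shows "connectivity_fraction T F - connectivity_fraction T F' =
    real (card (connectivity T F - connectivity T F')) / (real (card T))\<^sup>2"
proof -
  have fin: "finite (connectivity T G)" for G
    using assms(1) connectivity_subset[of T G] by (meson finite_SigmaI finite_subset)
  have "card (connectivity T F - connectivity T F') = card (connectivity T F) - card (connectivity T F')"
    using fin connectivity_mono[OF assms(2)] by (intro card_Diff_subset)
  moreover have "card (connectivity T F') \<le> card (connectivity T F)"
    using fin connectivity_mono[OF assms(2)] by (intro card_mono)
  ultimately show ?thesis by (simp add: connectivity_fraction_def of_nat_diff diff_divide_distrib)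
qed

text \<open>\<open>ranked_sizes_refinement\<close> bounds the square of every change of rank by the
  lost pairs, hence the root; the 2 comes from \<open>dist_seq_le\<close>.\<close>

lemma dist_component_masses_le:
  assumes "finite T" "F' \<subseteq> F" "connectivity_fraction T F - connectivity_fraction T F' \<le> \<kappa>"
  shows "dist (component_masses T F') (component_masses T F) \<le> 2 * sqrt \<kappa>"
proof (rule dist_seq_le)
  fix i
  let ?D = "connectivity T F - connectivity T F'"
  have "(real (ranked_sizes (conn_components T F) i) - real (ranked_sizes (conn_components T F') i))\<^sup>2 \<le> card ?D"
    unfolding conn_components_eq
    by (rule ranked_sizes_refinement[OF equiv_connectivity equiv_connectivity connectivity_mono[OF assms(2)] assms(1)])
  then have "(component_masses T F i - component_masses T F' i)\<^sup>2 \<le> card ?D / (real (card T))\<^sup>2"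
    unfolding component_masses_def diff_divide_distrib[symmetric] power_divide by (rule divide_right_mono) simp
  also have "\<dots> \<le> \<kappa>" using assms(3) connectivity_fraction_diff[OF assms(1,2)] by simp
  finally have "\<bar>component_masses T F i - component_masses T F' i\<bar> \<le> sqrt \<kappa>"
    using real_sqrt_le_mono by fastforce
  then show "\<bar>component_masses T F' i - component_masses T F i\<bar> \<le> sqrt \<kappa>" by (simp add: abs_minus_commute)
qed

lemma tree_edges_subset: "tree_edges T \<subseteq> {(u, u @ [i]) | u i. True}"
  by (auto simp: tree_edges_def)

lemma finite_tree_edges:
  assumes "plane_tree T"
  shows "finite (tree_edges T)"
proof (rule finite_subset)
  show "tree_edges T \<subseteq> T \<times> T" using plane_treeD[OF assms] by (auto simp: tree_edges_def)
  show "finite (T \<times> T)" using plane_tree_finite[OF assms] by simp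
qed

lemma card_tree:
  assumes "degree_sequence N" "T \<in> trees_with_degrees N"
  shows "card T = num_vertices N"
proof -
  obtain M where M: "count M = N" "size M = num_vertices N" "size M = Suc (sum_mset M)"
      "sq_excess M = (deg_sigma N)\<^sup>2 + 1"
    by (rule degree_multiset[OF assms(1)])
  have "T \<in> nodes ` {t. mset (degree_word t) = M}"
    using assms(2) bij_betw_imp_surj_on[OF bij_betw_nodes[OF M(1)]] by simp
  then obtain t where t: "T = nodes t" "mset (degree_word t) = M" by blast
  have "card T = size (mset (degree_word t))" unfolding t(1) card_nodes size_mset ..
  then show ?thesis unfolding t(2) M(2) .
qed

lemma num_vertices_pos: "degree_sequence N \<Longrightarrow> num_vertices N > 0"
  by (simp add: degree_sequence_def num_vertices_def)

lemma fragmentation_eq_step_path: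
  assumes "card T = num_vertices N"
  shows "fragmentation N b (T, U) = step_path (component_masses T) (tree_edges T) (deletion_time N b U)"
  by (simp add: fragmentation_def step_path_def component_masses_def assms not_le fun_eq_iff restrict_def)

text \<open>A step shorter than \<open>\<delta>\<close> that ends before \<open>J\<close> has lost
  more than a fraction \<open>\<kappa>\<close> of the pairs. By
  \<open>card_connectivity_diff_le\<close>, with its factor 2, this takes more than
  \<open>\<kappa> * card T / 2\<close> deletions above vertices, against \<open>good\<close>.
  Checking the first \<open>m\<close> steps suffices, since all later cuts sit at
  \<open>J\<close>.\<close>

lemma greedy_partition_of_fragmentation:
  fixes T :: "nat list set" and \<tau> :: "edge \<Rightarrow> real" and \<kappa> \<delta> J :: real
  defines "E \<equiv> tree_edges T"
  defines "s \<equiv> greedy E (connectivity_fraction T) \<kappa> J \<tau>"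
  defines "x \<equiv> step_path (component_masses T) E \<tau>"
  assumes T: "plane_tree T" and \<kappa>: "\<kappa> > 0" and J: "J > 0" and m: "1 \<le> real m * \<kappa>"
    and good: "\<And>i. i < m \<Longrightarrow>
      real (\<Sum>u\<in>T. card (path_edges u \<inter> {f \<in> E. s i < \<tau> f \<and> \<tau> f \<le> s i + \<delta>})) < \<kappa> * card T / 2"
  shows "min (s i + \<delta>) J \<le> s (Suc i)"
    and "s i \<le> t \<Longrightarrow> t < s (Suc i) \<Longrightarrow> dist (x t) (x (s i)) \<le> 2 * sqrt \<kappa>"
proof -
  have fin: "finite E" "finite T" unfolding E_def using T by (simp_all add: finite_tree_edges plane_tree_finite)
  have cT: "real (card T) > 0" using fin plane_tree_Nil[OF T] by (auto simp: card_gt_0_iff)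
  have qb: "0 \<le> connectivity_fraction T F \<and> connectivity_fraction T F \<le> 1" for F
    using connectivity_fraction_bounds[OF fin(2)] by simp
  let ?F = "\<lambda>t. {f \<in> E. t < \<tau> f}"
  have s_nonneg: "0 \<le> s i" for i unfolding s_def by (rule greedy_nonneg[OF fin(1) J])
  show "min (s i + \<delta>) J \<le> s (Suc i)"
  proof (rule ccontr)
    assume neg: "\<not> ?thesis"
    then have lt: "s (Suc i) < s i + \<delta>" "s (Suc i) < J" by auto
    have "s i \<le> s (Suc i)" unfolding s_def by (rule greedy_mono[OF fin(1) J])
    then have "s i < J" using lt(2) by simp
    have im: "i < m"
    proof (rule ccontr)
      assume "\<not> i < m"
      then have "m \<le> i" by simp
      then have "s i = J" unfolding s_def by (rule greedy_eventually_J[OF fin(1) J qb m])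
      then show False using \<open>s i < J\<close> by simp
    qed
    have sub: "?F (s (Suc i)) \<subseteq> ?F (s i)" using \<open>s i \<le> s (Suc i)\<close> by auto
    have FE: "?F (s i) \<subseteq> {(u, u @ [i]) | u i. True}" using tree_edges_subset by (auto simp: E_def)
    have "\<kappa> < connectivity_fraction T (?F (s i)) - connectivity_fraction T (?F (s (Suc i)))"
      using greedy_drop[OF fin(1) J] lt(2) unfolding s_def by blast
    also have "\<dots> = real (card (connectivity T (?F (s i)) - connectivity T (?F (s (Suc i))))) / (real (card T))\<^sup>2"
      by (rule connectivity_fraction_diff[OF fin(2) sub])
    also have "\<dots> \<le> real (2 * card T * (\<Sum>u\<in>T. card (path_edges u \<inter> (?F (s i) - ?F (s (Suc i)))))) / (real (card T))\<^sup>2"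
      using card_connectivity_diff_le[OF FE sub fin(2)] by (intro divide_right_mono) (simp_all only: of_nat_le_iff zero_le_power2)
    also have "\<dots> = 2 * real (\<Sum>u\<in>T. card (path_edges u \<inter> (?F (s i) - ?F (s (Suc i))))) / real (card T)"
      by (simp add: power2_eq_square)
    also have "\<dots> \<le> 2 * real (\<Sum>u\<in>T. card (path_edges u \<inter> {f \<in> E. s i < \<tau> f \<and> \<tau> f \<le> s i + \<delta>})) / real (card T)"
    proof -
      have "(\<Sum>u\<in>T. card (path_edges u \<inter> (?F (s i) - ?F (s (Suc i))))) \<le>
          (\<Sum>u\<in>T. card (path_edges u \<inter> {f \<in> E. s i < \<tau> f \<and> \<tau> f \<le> s i + \<delta>}))"
        using lt(1) by (intro sum_mono card_mono) auto
      then show ?thesis by (intro divide_right_mono mult_left_mono) (simp_all only: of_nat_le_iff of_nat_0_le_iff zero_le_numeral)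
    qed
    also have "\<dots> < \<kappa>" using good[OF im] cT by (simp only: pos_divide_less_eq)
    finally show False .
  qed
  assume t: "s i \<le> t" "t < s (Suc i)"
  have "connectivity_fraction T (?F (s i)) - connectivity_fraction T (?F t) \<le> \<kappa>"
    using greedy_no_drop[OF fin(1) J less_imp_le[OF \<kappa>], of "connectivity_fraction T" \<tau> i t] t
    unfolding s_def by linarith
  moreover have "?F t \<subseteq> ?F (s i)" using t(1) by auto
  ultimately have "dist (component_masses T (?F t)) (component_masses T (?F (s i))) \<le> 2 * sqrt \<kappa>"
    by (intro dist_component_masses_le[OF fin(2)])
  then show "dist (x t) (x (s i)) \<le> 2 * sqrt \<kappa>"
    using t s_nonneg[of i] by (simp add: x_def step_path_eq)
qed

subsection \<open>The probability of short steps\<close>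

abbreviation marks :: "('e \<Rightarrow> real) measure" where
  "marks \<equiv> \<Pi>\<^sub>M e\<in>UNIV. uniform_measure lborel {0<..<1}"

lemma prob_space_uniform01: "prob_space (uniform_measure lborel {0<..<1 :: real})"
  by (rule prob_space_uniform_measure) simp_all

lemma prob_space_marks: "prob_space marks"
  by (rule prob_space_PiM) (rule prob_space_uniform01)

lemma space_marks [simp]: "space marks = UNIV"
  by (simp add: space_PiM)

lemma measurable_mark [measurable]: "(\<lambda>U. U e) \<in> borel_measurable marks"
proof -
  have "(\<lambda>U. U e) \<in> marks \<rightarrow>\<^sub>M uniform_measure lborel {0<..<1 :: real}"
    by (rule measurable_component_singleton) simp
  then show ?thesis by (simp add: measurable_cong_sets[OF refl, of "uniform_measure lborel {0<..<1 :: real}" borel])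
qed

lemma sets_window:
  fixes g h :: "'w \<Rightarrow> real"
  assumes [measurable]: "g \<in> borel_measurable M" "h \<in> borel_measurable M"
  shows "{\<omega> \<in> space M. g \<omega> < h \<omega> \<and> h \<omega> \<le> g \<omega> + \<delta>} \<in> sets M"
  by measurable

text \<open>Conditionally on the other marks the time is uniform on \<open>(0, c)\<close>, whatever the window is.\<close>

lemma prob_time_in_independent_window:
  fixes g :: "('e \<Rightarrow> real) \<Rightarrow> real"
  assumes g: "g \<in> borel_measurable marks" and indep: "\<And>U x. g (U(f := x)) = g U"
    and c: "c > 0" and \<delta>: "\<delta> \<ge> 0"
  shows "measure marks {U. g U < c * (1 - U f) \<and> c * (1 - U f) \<le> g U + \<delta>} \<le> \<delta> / c"
proof -
  let ?\<mu> = "uniform_measure lborel {0<..<1 :: real}"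
  let ?Q = "\<Pi>\<^sub>M e\<in>UNIV - {f}. ?\<mu>"
  let ?A = "{U. g U < c * (1 - U f) \<and> c * (1 - U f) \<le> g U + \<delta>}"
  let ?upd = "\<lambda>(x, X). X(f := x)"
  interpret mu: prob_space ?\<mu> by (rule prob_space_uniform01)
  interpret Q: prob_space ?Q by (rule prob_space_PiM) (rule prob_space_uniform01)
  interpret pair: pair_sigma_finite ?\<mu> ?Q ..
  interpret P: prob_space "marks :: ('e \<Rightarrow> real) measure" by (rule prob_space_marks)
  have "(\<lambda>U. c * (1 - U f)) \<in> borel_measurable marks"
    by (intro borel_measurable_times borel_measurable_diff borel_measurable_const measurable_mark)
  from sets_window[OF g this] have A: "?A \<in> sets marks" by simp
  have ins: "insert f (UNIV - {f}) = (UNIV :: 'e set)" by auto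
  have upd: "?upd \<in> ?\<mu> \<Otimes>\<^sub>M ?Q \<rightarrow>\<^sub>M marks"
    unfolding case_prod_beta' by (rule measurable_fun_upd[of UNIV "UNIV - {f}" f]) auto
  have distr: "distr (?\<mu> \<Otimes>\<^sub>M ?Q) marks ?upd = marks"
    using distr_pair_PiM_eq_PiM[of "UNIV - {f}" "\<lambda>_. ?\<mu>" f] prob_space_uniform01 unfolding ins by simp
  let ?B = "?upd -` ?A \<inter> space (?\<mu> \<Otimes>\<^sub>M ?Q)"
  have "emeasure marks ?A = emeasure (distr (?\<mu> \<Otimes>\<^sub>M ?Q) marks ?upd) ?A" unfolding distr ..
  also have "\<dots> = emeasure (?\<mu> \<Otimes>\<^sub>M ?Q) ?B" by (rule emeasure_distr[OF upd A])
  also have "\<dots> = (\<integral>\<^sup>+X. emeasure ?\<mu> ((\<lambda>x. (x, X)) -` ?B) \<partial>?Q)"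
    by (rule pair.emeasure_pair_measure_alt2) (rule measurable_sets[OF upd A])
  also have "\<dots> \<le> (\<integral>\<^sup>+X. ennreal (\<delta> / c) \<partial>?Q)"
  proof (rule nn_integral_mono)
    fix X
    define s where "s = g (X(f := 0))"
    have gs: "g (X(f := x)) = s" for x
      using indep[of "X(f := 0)" x] by (simp add: s_def)
    let ?I = "{1 - (s + \<delta>) / c ..< 1 - s / c}"
    have "(\<lambda>x. (x, X)) -` ?B \<subseteq> ?I"
      using c by (auto simp: gs field_simps)
    then have "emeasure ?\<mu> ((\<lambda>x. (x, X)) -` ?B) \<le> emeasure ?\<mu> ?I"
      by (rule emeasure_mono) simp
    also have "\<dots> = emeasure lborel ({0<..<1} \<inter> ?I)"
      by (subst emeasure_uniform_measure) (simp_all add: divide_ennreal_def)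
    also have "\<dots> \<le> emeasure lborel ?I" by (rule emeasure_mono) auto
    also have "\<dots> = ennreal (\<delta> / c)"
    proof -
      have "1 - (s + \<delta>) / c \<le> 1 - s / c" using c \<delta> by (simp add: divide_right_mono)
      then have "emeasure lborel ?I = ennreal ((1 - s / c) - (1 - (s + \<delta>) / c))"
        by (rule emeasure_lborel_Ico)
      also have "(1 - s / c) - (1 - (s + \<delta>) / c) = \<delta> / c" by (simp add: add_divide_distrib)
      finally show ?thesis .
    qed
    finally show "emeasure ?\<mu> ((\<lambda>x. (x, X)) -` ?B) \<le> ennreal (\<delta> / c)" .
  qed
  also have "\<dots> = ennreal (\<delta> / c)" by (simp add: Q.emeasure_space_1)
  finally show ?thesis
    using c \<delta> by (simp add: P.emeasure_eq_measure)
qed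

text \<open>The cut is not independent of the mark of \<open>f\<close>. On the event in question,
  however, it precedes the deletion of \<open>f\<close>, and by \<open>greedy_stopping\<close> it
  then equals the cut computed with the time of \<open>f\<close> frozen at \<open>J + 1\<close>,
  which is independent of that mark.\<close>

lemma prob_edge_deleted_after_greedy_time:
  fixes E :: "'e set" and c J :: real
  defines "\<tau> \<equiv> \<lambda>U e. c * (1 - U e)"
  assumes E: "finite E" "f \<in> E" and J: "J > 0" and c: "c > 0" and \<delta>: "\<delta> \<ge> 0"
  shows "measure marks {U. greedy E q \<kappa> J (\<tau> U) i < \<tau> U f \<and> \<tau> U f \<le> greedy E q \<kappa> J (\<tau> U) i + \<delta>} \<le> \<delta> / c"
    and "{U. greedy E q \<kappa> J (\<tau> U) i < \<tau> U f \<and> \<tau> U f \<le> greedy E q \<kappa> J (\<tau> U) i + \<delta>} \<in> sets marks"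
proof -
  let ?A = "{U. greedy E q \<kappa> J (\<tau> U) i < \<tau> U f \<and> \<tau> U f \<le> greedy E q \<kappa> J (\<tau> U) i + \<delta>}"
  interpret P: prob_space "marks :: ('e \<Rightarrow> real) measure" by (rule prob_space_marks)
  define g where "g U = greedy E q \<kappa> J ((\<tau> U)(f := J + 1)) i" for U
  have \<tau>: "(\<lambda>U. \<tau> U e) \<in> borel_measurable marks" for e
    unfolding \<tau>_def by (intro borel_measurable_times borel_measurable_diff borel_measurable_const measurable_mark)
  have "(\<lambda>U. greedy E q \<kappa> J (\<lambda>e. if e = f then J + 1 else \<tau> U e) i) \<in> borel_measurable marks"
    by (rule measurable_greedy[OF E(1) J]) (use \<tau> in simp)
  moreover have "(\<tau> U)(f := J + 1) = (\<lambda>e. if e = f then J + 1 else \<tau> U e)" for U by auto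
  ultimately have g: "g \<in> borel_measurable marks" unfolding g_def by simp
  have gr: "(\<lambda>U. greedy E q \<kappa> J (\<tau> U) i) \<in> borel_measurable marks"
    using measurable_greedy[OF E(1) J, of "\<lambda>e U. \<tau> U e" marks] \<tau> by simp
  from sets_window[OF gr \<tau>] show "?A \<in> sets marks" by simp
  from sets_window[OF g \<tau>] have meas: "{U. g U < \<tau> U f \<and> \<tau> U f \<le> g U + \<delta>} \<in> sets marks" by simp
  have "?A \<subseteq> {U. g U < \<tau> U f \<and> \<tau> U f \<le> g U + \<delta>}"
  proof
    fix U assume U: "U \<in> ?A"
    then have "g U = greedy E q \<kappa> J (\<tau> U) i"
      unfolding g_def by (intro greedy_stopping[OF E(1) J E(2)]) auto
    then show "U \<in> {U. g U < \<tau> U f \<and> \<tau> U f \<le> g U + \<delta>}" using U by simp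
  qed
  then have "measure marks ?A \<le> measure marks {U. g U < \<tau> U f \<and> \<tau> U f \<le> g U + \<delta>}"
    using meas by (rule P.finite_measure_mono)
  also have "\<dots> \<le> \<delta> / c"
    unfolding \<tau>_def
  proof (rule prob_time_in_independent_window[OF g _ c \<delta>])
    fix U x
    have "(\<tau> (U(f := x)))(f := J + 1) = (\<tau> U)(f := J + 1)" by (auto simp: \<tau>_def)
    then show "g (U(f := x)) = g U" by (simp add: g_def)
  qed
  finally show "measure marks ?A \<le> \<delta> / c" .
qed

text \<open>Markov's inequality for the number of deletions above vertices in one window, then a
  union bound over \<open>m\<close> windows. By linearity a vertex contributes at most its depth
  times \<open>\<delta> / c\<close> to the mean.\<close>

lemma prob_short_greedy_step:
  fixes T :: "nat list set" and c J \<kappa> \<delta> :: real and m :: nat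
  defines "\<tau> \<equiv> \<lambda>U e. c * (1 - U e)"
  defines "E \<equiv> tree_edges T"
  defines "s \<equiv> \<lambda>U. greedy E (connectivity_fraction T) \<kappa> J (\<tau> U)"
  defines "B \<equiv> {U. \<exists>i<m. \<kappa> * card T / 2 \<le>
      real (\<Sum>u\<in>T. card (path_edges u \<inter> {f \<in> E. s U i < \<tau> U f \<and> \<tau> U f \<le> s U i + \<delta>}))}"
  assumes T: "plane_tree T" and \<kappa>: "\<kappa> > 0" and J: "J > 0" and c: "c > 0" and \<delta>: "\<delta> \<ge> 0"
  shows "B \<in> sets marks"
    and "measure marks B \<le> real m * ((\<Sum>u\<in>T. real (length u)) * (\<delta> / c) / (\<kappa> * card T / 2))"
proof -
  interpret P: prob_space "marks :: (edge \<Rightarrow> real) measure" by (rule prob_space_marks)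
  have fin: "finite E" "finite T" unfolding E_def using T by (simp_all add: finite_tree_edges plane_tree_finite)
  have cT: "real (card T) > 0" using fin plane_tree_Nil[OF T] by (auto simp: card_gt_0_iff)
  define W where "W i f = {U. s U i < \<tau> U f \<and> \<tau> U f \<le> s U i + \<delta>}" for i f
  have W: "W i f \<in> sets marks" "measure marks (W i f) \<le> \<delta> / c" if "f \<in> E" for i f
    using prob_edge_deleted_after_greedy_time[OF fin(1) that J c \<delta>, of "connectivity_fraction T" \<kappa> i]
    unfolding W_def s_def \<tau>_def by auto
  define Z where "Z i U = real (\<Sum>u\<in>T. card (path_edges u \<inter> {f \<in> E. s U i < \<tau> U f \<and> \<tau> U f \<le> s U i + \<delta>}))" for i U
  have Z_eq: "Z i = (\<lambda>U. \<Sum>u\<in>T. \<Sum>f\<in>path_edges u \<inter> E. indicator (W i f) U)" for i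
  proof
    fix U
    have "real (card (path_edges u \<inter> {f \<in> E. s U i < \<tau> U f \<and> \<tau> U f \<le> s U i + \<delta>})) =
        (\<Sum>f\<in>path_edges u \<inter> E. indicator (W i f) U)" for u
    proof -
      have "path_edges u \<inter> {f \<in> E. s U i < \<tau> U f \<and> \<tau> U f \<le> s U i + \<delta>} = (path_edges u \<inter> E) \<inter> {f. U \<in> W i f}"
        by (auto simp: W_def)
      then show ?thesis by (simp add: indicator_def sum.If_cases)
    qed
    then show "Z i U = (\<Sum>u\<in>T. \<Sum>f\<in>path_edges u \<inter> E. indicator (W i f) U)" by (simp add: Z_def)
  qed
  have int: "integrable marks (indicator (W i f) :: _ \<Rightarrow> real)" if "f \<in> E" for i f
    using W(1)[OF that] by (intro integrable_real_indicator) (auto simp: P.emeasure_eq_measure)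
  have intZ: "integrable marks (Z i)" for i
    unfolding Z_eq by (intro Bochner_Integration.integrable_sum int) auto
  have Zle: "integral\<^sup>L marks (Z i) \<le> (\<Sum>u\<in>T. real (length u)) * (\<delta> / c)" for i
  proof -
    have "integral\<^sup>L marks (Z i) = (\<Sum>u\<in>T. \<Sum>f\<in>path_edges u \<inter> E. integral\<^sup>L marks (indicator (W i f)))"
      unfolding Z_eq
      by (subst Bochner_Integration.integral_sum, intro Bochner_Integration.integrable_sum int, simp,
          intro sum.cong refl Bochner_Integration.integral_sum int, simp)
    also have "\<dots> \<le> (\<Sum>u\<in>T. \<Sum>f\<in>path_edges u \<inter> E. \<delta> / c)"
      using W by (intro sum_mono) simp
    also have "\<dots> \<le> (\<Sum>u\<in>T. real (length u) * (\<delta> / c))"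
    proof (rule sum_mono)
      fix u
      have "card (path_edges u \<inter> E) \<le> length u"
        using card_mono[of "path_edges u" "path_edges u \<inter> E"] card_path_edges_le[of u] by auto
      then show "(\<Sum>f\<in>path_edges u \<inter> E. \<delta> / c) \<le> real (length u) * (\<delta> / c)"
        using c \<delta> by (simp add: divide_right_mono mult_right_mono)
    qed
    also have "\<dots> = (\<Sum>u\<in>T. real (length u)) * (\<delta> / c)" by (rule sum_distrib_right[symmetric])
    finally show ?thesis .
  qed
  have a: "\<kappa> * card T / 2 > 0" using \<kappa> cT by simp
  have Zmeas: "{U. \<kappa> * card T / 2 \<le> Z i U} \<in> sets marks" for i
  proof -
    have [measurable]: "Z i \<in> borel_measurable marks" using intZ by (rule borel_measurable_integrable)
    have "{U \<in> space marks. \<kappa> * card T / 2 \<le> Z i U} \<in> sets marks" by measurable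
    then show ?thesis by simp
  qed
  have B_eq: "B = (\<Union>i\<in>{..<m}. {U. \<kappa> * card T / 2 \<le> Z i U})"
    unfolding B_def Z_def by auto
  show "B \<in> sets marks" unfolding B_eq using Zmeas by (intro sets.finite_UN) auto
  have "measure marks B \<le> (\<Sum>i<m. measure marks {U. \<kappa> * card T / 2 \<le> Z i U})"
    unfolding B_eq using Zmeas by (intro P.finite_measure_subadditive_finite) auto
  also have "\<dots> \<le> (\<Sum>i<m. (\<Sum>u\<in>T. real (length u)) * (\<delta> / c) / (\<kappa> * card T / 2))"
  proof (rule sum_mono)
    fix i
    have "measure marks {U \<in> space marks. Z i U \<ge> \<kappa> * card T / 2} \<le> integral\<^sup>L marks (Z i) / (\<kappa> * card T / 2)"
      by (rule integral_Markov_inequality_measure[OF intZ, where A = "{}"]) (use a in \<open>auto simp: Z_def sum_nonneg\<close>)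
    also have "\<dots> \<le> (\<Sum>u\<in>T. real (length u)) * (\<delta> / c) / (\<kappa> * card T / 2)"
      using Zle a by (intro divide_right_mono) auto
    finally show "measure marks {U. \<kappa> * card T / 2 \<le> Z i U} \<le> (\<Sum>u\<in>T. real (length u)) * (\<delta> / c) / (\<kappa> * card T / 2)"
      by simp
  qed
  finally show "measure marks B \<le> real m * ((\<Sum>u\<in>T. real (length u)) * (\<delta> / c) / (\<kappa> * card T / 2))"
    by simp
qed

section \<open>Tightness\<close>

lemma prob_space_tree_marks:
  assumes "degree_sequence N"
  shows "prob_space (tree_marks_measure N)"
  unfolding tree_marks_measure_def
  by (intro prob_space_pair prob_space_uniform_count_measure finite_trees_with_degrees
      trees_with_degrees_nonempty prob_space_marks assms)

lemma measurable_deletion_time: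
  "(\<lambda>U. deletion_time N b U) \<in> marks \<rightarrow>\<^sub>M (borel :: (edge \<Rightarrow> real) measure)"
proof -
  have "(\<lambda>U. deletion_time N b U e) \<in> borel_measurable marks" for e
    unfolding deletion_time_def
    by (intro borel_measurable_times borel_measurable_diff borel_measurable_const measurable_mark)
  then have "(\<lambda>U e. deletion_time N b U e) \<in> marks \<rightarrow>\<^sub>M (\<Pi>\<^sub>M e\<in>UNIV. borel)"
    by (rule measurable_abs_UNIV)
  then show ?thesis by (simp only: measurable_cong_sets[OF refl sets_PiM_equal_borel])
qed

lemma measurable_fragmentation:
  assumes "degree_sequence N"
  shows "fragmentation N b \<in> tree_marks_measure N \<rightarrow>\<^sub>M borel_sets_of (skorohod_J1 mass_partitions)"
proof -
  let ?A = "trees_with_degrees N"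
  have meas: "fragmentation N b \<in> count_space ?A \<Otimes>\<^sub>M marks \<rightarrow>\<^sub>M borel_sets_of (skorohod_J1 mass_partitions)"
  proof (rule measurable_pair_measure_countable1)
    show "countable ?A" using finite_trees_with_degrees[OF assms] by (rule countable_finite)
    fix T assume T: "T \<in> ?A"
    then have pT: "plane_tree T" by (simp add: trees_with_degrees_def)
    have "step_path (component_masses T) (tree_edges T) \<in> borel \<rightarrow>\<^sub>M borel_sets_of (skorohod_J1 mass_partitions)"
      using plane_tree_Nil[OF pT]
      by (intro measurable_step_path finite_tree_edges component_masses_in_mass_partitions plane_tree_finite pT) auto
    from measurable_compose[OF measurable_deletion_time this]
    show "(\<lambda>U. fragmentation N b (T, U)) \<in> marks \<rightarrow>\<^sub>M borel_sets_of (skorohod_J1 mass_partitions)"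
      unfolding fragmentation_eq_step_path[OF card_tree[OF assms T]] .
  qed
  have sets: "sets (tree_marks_measure N) = sets (count_space ?A \<Otimes>\<^sub>M marks)"
    unfolding tree_marks_measure_def
    by (intro sets_pair_measure_cong sets_uniform_count_measure_count_space refl)
  show ?thesis unfolding measurable_cong_sets[OF sets refl] by (rule meas)
qed

text \<open>Bounds for fixed trees are averaged over the uniform tree; as \<open>k\<close> is common
  to all trees, only the mean of \<open>L\<close> remains.\<close>

lemma measure_tree_marks_le:
  assumes N: "degree_sequence N" and B: "\<And>T. T \<in> trees_with_degrees N \<Longrightarrow> B T \<in> sets marks"
    and le: "\<And>T. T \<in> trees_with_degrees N \<Longrightarrow> measure marks (B T) \<le> k * L T"
  shows "(SIGMA T:trees_with_degrees N. B T) \<in> sets (tree_marks_measure N)"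
    and "measure (tree_marks_measure N) (SIGMA T:trees_with_degrees N. B T) \<le>
      k * ((\<Sum>T\<in>trees_with_degrees N. L T) / card (trees_with_degrees N))"
proof -
  let ?A = "trees_with_degrees N"
  interpret P: prob_space "marks :: (edge \<Rightarrow> real) measure" by (rule prob_space_marks)
  interpret M: prob_space "tree_marks_measure N" by (rule prob_space_tree_marks[OF N])
  have fin: "finite ?A" by (rule finite_trees_with_degrees[OF N])
  have eq: "(SIGMA T:?A. B T) = (\<Union>T\<in>?A. {T} \<times> B T)" by auto
  have S: "{T} \<times> B T \<in> sets (tree_marks_measure N)" if "T \<in> ?A" for T
    unfolding tree_marks_measure_def
    by (rule pair_measureI) (use that B in \<open>auto simp: sets_uniform_count_measure\<close>)
  show "(SIGMA T:?A. B T) \<in> sets (tree_marks_measure N)"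
    unfolding eq using fin S by (intro sets.finite_UN) auto
  have "measure (tree_marks_measure N) (SIGMA T:?A. B T) \<le> (\<Sum>T\<in>?A. measure (tree_marks_measure N) ({T} \<times> B T))"
    unfolding eq using fin S by (intro M.finite_measure_subadditive_finite) auto
  also have "\<dots> \<le> (\<Sum>T\<in>?A. k * L T / card ?A)"
  proof (rule sum_mono)
    fix T assume T: "T \<in> ?A"
    have "emeasure (tree_marks_measure N) ({T} \<times> B T) =
        emeasure (uniform_count_measure ?A) {T} * emeasure marks (B T)"
      unfolding tree_marks_measure_def
      by (rule P.emeasure_pair_measure_Times) (use T B in \<open>auto simp: sets_uniform_count_measure\<close>)
    then have "measure (tree_marks_measure N) ({T} \<times> B T) =
        measure (uniform_count_measure ?A) {T} * measure marks (B T)"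
      by (simp add: measure_def enn2real_mult)
    also have "measure (uniform_count_measure ?A) {T} = 1 / card ?A"
      using measure_uniform_count_measure[OF fin, of "{T}"] T by simp
    finally show "measure (tree_marks_measure N) ({T} \<times> B T) \<le> k * L T / card ?A"
      using le[OF T] by (simp add: divide_right_mono)
  qed
  also have "\<dots> = k * ((\<Sum>T\<in>?A. L T) / card ?A)"
    by (simp add: sum_divide_distrib sum_distrib_left)
  finally show "measure (tree_marks_measure N) (SIGMA T:?A. B T) \<le> k * ((\<Sum>T\<in>?A. L T) / card ?A)" .
qed

text \<open>The expected sum of all depths, that is, the mean depth of a uniform vertex times the
  number of vertices.\<close>

definition mean_path_length :: "(nat \<Rightarrow> nat) \<Rightarrow> real" where
  "mean_path_length N =
     (\<Sum>T\<in>trees_with_degrees N. \<Sum>u\<in>T. real (length u)) / card (trees_with_degrees N)"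

lemma mean_path_length_le:
  assumes "degree_sequence N" "num_vertices N \<ge> 16" "deg_sigma N \<ge> 1"
  shows "mean_path_length N \<le> 153 * (num_vertices N)\<^sup>2 / deg_sigma N"
proof -
  have "card (trees_with_degrees N) > 0"
    using finite_trees_with_degrees trees_with_degrees_nonempty assms(1) by (simp add: card_gt_0_iff)
  then show ?thesis
    using sum_length_trees_le[OF assms] unfolding mean_path_length_def
    by (subst pos_divide_le_eq) (simp_all add: mult.commute)
qed

text \<open>A path length of order \<open>num_vertices^2 / deg_sigma\<close> turns the rate into
  \<open>b / deg_sigma\<close>, which converges. The bound has to hold for every \<open>n\<close>,
  so \<open>C\<close> also absorbs the finitely many exceptional indices.\<close>

lemma rate_bounded:
  fixes N :: "nat \<Rightarrow> nat \<Rightarrow> nat" and b :: "nat \<Rightarrow> real"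
  assumes N: "\<And>n. degree_sequence (N n)"
    and b: "filterlim b at_top sequentially"
    and nb: "filterlim (\<lambda>n. real (num_vertices (N n)) / b n) at_top sequentially"
    and sig: "(\<lambda>n. b n / deg_sigma (N n)) \<longlonglongrightarrow> 1"
  shows "\<exists>C\<ge>0. \<forall>n. b n / (real (num_vertices (N n)))\<^sup>2 * mean_path_length (N n) \<le> C"
proof -
  let ?r = "\<lambda>n. b n / (real (num_vertices (N n)))\<^sup>2 * mean_path_length (N n)"
  have "eventually (\<lambda>n. ?r n \<le> 306) sequentially"
  proof -
    \<comment> \<open>\<open>b n \<ge> 2\<close> together with a ratio
      \<open>b n / deg_sigma\<close> below 2 gives \<open>deg_sigma \<ge> 1\<close>, and the factor
      8 then gives at least 16 vertices. The bound 306 is \<open>2 * 153\<close>.\<close>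
    have "eventually (\<lambda>n. 2 \<le> b n) sequentially" "eventually (\<lambda>n. 8 \<le> real (num_vertices (N n)) / b n) sequentially"
      using b nb by (auto simp: filterlim_at_top)
    moreover have "eventually (\<lambda>n. 1 / 2 < b n / deg_sigma (N n)) sequentially"
      by (rule order_tendstoD(1)[OF sig]) simp
    moreover have "eventually (\<lambda>n. b n / deg_sigma (N n) < 2) sequentially"
      by (rule order_tendstoD(2)[OF sig]) simp
    ultimately show ?thesis
    proof eventually_elim
      case (elim n)
      let ?s = "deg_sigma (N n)" and ?n = "real (num_vertices (N n))"
      have "?s \<ge> 0" by (simp add: deg_sigma_def)
      moreover have "?s \<noteq> 0" using elim by auto
      ultimately have s: "?s > 0" by simp
      have "b n < 2 * ?s" using elim(4) s by (simp add: pos_divide_less_eq)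
      then have s1: "?s \<ge> 1" using elim(1) by linarith
      have "8 * b n \<le> ?n" using elim(1,2) by (simp add: pos_le_divide_eq)
      then have n: "?n \<ge> 16" using elim(1) by linarith
      have "?r n \<le> b n / ?n\<^sup>2 * (153 * ?n\<^sup>2 / ?s)"
        using mean_path_length_le[OF N _ s1] n elim(1) by (intro mult_left_mono) auto
      also have "\<dots> = 153 * (b n / ?s)" using n by simp
      also have "\<dots> \<le> 306" using elim(4) by simp
      finally show ?case .
    qed
  qed
  then obtain n0 where n0: "\<And>n. n \<ge> n0 \<Longrightarrow> ?r n \<le> 306" unfolding eventually_sequentially by blast
  define C where "C = 306 + (\<Sum>n<n0. \<bar>?r n\<bar>)"
  have "?r n \<le> C" for n
  proof (cases "n < n0")
    case True
    then have "\<bar>?r n\<bar> \<le> (\<Sum>n<n0. \<bar>?r n\<bar>)" by (intro member_le_sum) auto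
    then show ?thesis unfolding C_def by linarith
  next
    case False
    then have "?r n \<le> 306" using n0 by simp
    moreover have "0 \<le> (\<Sum>n<n0. \<bar>?r n\<bar>)" by (rule sum_nonneg) simp
    ultimately show ?thesis unfolding C_def by linarith
  qed
  moreover have "C \<ge> 0" unfolding C_def by (intro add_nonneg_nonneg sum_nonneg) auto
  ultimately show ?thesis by blast
qed

text \<open>\<open>\<delta>\<close> is solved from the final estimate: with \<open>J = j + 1\<close>
  there are \<open>4 J^2\<close> windows and a Markov threshold proportional to
  \<open>\<kappa> = 1 / (4 J^2)\<close>, in all a probability of at most
  \<open>32 J^4 \<delta> C\<close>. \<open>C + 1\<close> avoids a division by zero.\<close>

lemma fragmentation_level_bound:
  fixes N :: "nat \<Rightarrow> nat" and b C \<epsilon> :: real and j :: nat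
  defines "\<delta> \<equiv> \<epsilon> / (32 * real (Suc j) ^ 4 * (C + 1))"
  assumes N: "degree_sequence N" and b: "b > 0" and C: "C \<ge> 0" and \<epsilon>: "\<epsilon> > 0"
    and rate: "b / (real (num_vertices N))\<^sup>2 * mean_path_length N \<le> C"
  obtains B where "B \<in> sets (tree_marks_measure N)" "measure (tree_marks_measure N) B \<le> \<epsilon>"
    "\<And>\<omega>. \<omega> \<in> space (tree_marks_measure N) - B \<Longrightarrow> partitionable (fragmentation N b \<omega>) \<delta> j"
proof -
  let ?A = "trees_with_degrees N" and ?n = "real (num_vertices N)" and ?J = "real (Suc j)"
  \<comment> \<open>Chosen so that \<open>2 * sqrt \<kappa>\<close> is the precision
    \<open>1 / (j + 1)\<close> of level \<open>j\<close>; accordingly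
    \<open>m = 1 / \<kappa>\<close> cuts use up the whole of \<open>Q\<close>.\<close>
  define \<kappa> where "\<kappa> = 1 / (4 * ?J\<^sup>2)"
  define m where "m = 4 * (Suc j)\<^sup>2"
  define c where "c = ?n / b"
  have n: "?n > 0" using num_vertices_pos[OF N] by simp
  have J: "?J > 0" by simp
  have \<kappa>: "\<kappa> > 0" unfolding \<kappa>_def by (intro divide_pos_pos mult_pos_pos zero_less_power J) simp_all
  have rm: "real m = 4 * ?J\<^sup>2" unfolding m_def of_nat_mult of_nat_power by simp
  have mk: "1 \<le> real m * \<kappa>" unfolding rm \<kappa>_def using J by simp
  have c: "c > 0" using n b by (simp add: c_def)
  have \<delta>: "\<delta> \<ge> 0" unfolding \<delta>_def using C \<epsilon> by simp
  have sqrt: "2 * sqrt \<kappa> = 1 / ?J"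
  proof -
    have "\<kappa> = (1 / (2 * ?J))\<^sup>2" unfolding \<kappa>_def by (simp add: power_divide power_mult_distrib del: of_nat_Suc)
    then have "sqrt \<kappa> = 1 / (2 * ?J)" by (simp del: of_nat_Suc)
    then show ?thesis by (simp del: of_nat_Suc)
  qed
  have del: "deletion_time N b U = (\<lambda>e. c * (1 - U e))" for U
    by (simp add: deletion_time_def c_def fun_eq_iff)
  define s where "s T U = greedy (tree_edges T) (connectivity_fraction T) \<kappa> ?J (\<lambda>e. c * (1 - U e))" for T U
  define B where "B T = {U. \<exists>i<m. \<kappa> * card T / 2 \<le> real (\<Sum>u\<in>T. card (path_edges u \<inter>
      {f \<in> tree_edges T. s T U i < c * (1 - U f) \<and> c * (1 - U f) \<le> s T U i + \<delta>}))}" for T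
  have pT: "plane_tree T" if "T \<in> ?A" for T using that by (simp add: trees_with_degrees_def)
  define k where "k = real m * ((\<delta> / c) / (\<kappa> * ?n / 2))"
  have B: "B T \<in> sets marks" "measure marks (B T) \<le> k * (\<Sum>u\<in>T. real (length u))" if "T \<in> ?A" for T
  proof -
    note short = prob_short_greedy_step[OF pT[OF that] \<kappa> J c \<delta>, of m]
    show "B T \<in> sets marks" unfolding B_def s_def by (rule short(1))
    have "measure marks (B T) \<le> real m * ((\<Sum>u\<in>T. real (length u)) * (\<delta> / c) / (\<kappa> * card T / 2))"
      unfolding B_def s_def by (rule short(2))
    then show "measure marks (B T) \<le> k * (\<Sum>u\<in>T. real (length u))"
      unfolding card_tree[OF N that] k_def by (simp add: mult.commute mult.left_commute)
  qed
  note bound = measure_tree_marks_le[OF N B]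
  show thesis
  proof (rule that[OF bound(1)])
    have "measure (tree_marks_measure N) (SIGMA T:?A. B T) \<le> k * mean_path_length N"
      using bound(2) unfolding mean_path_length_def .
    also have "k * mean_path_length N = 32 * ?J ^ 4 * \<delta> * (b / ?n\<^sup>2 * mean_path_length N)"
      unfolding k_def rm \<kappa>_def c_def using b n
      by (simp add: power2_eq_square power4_eq_xxxx field_simps del: of_nat_Suc)
    also have "\<dots> \<le> 32 * ?J ^ 4 * \<delta> * C"
      using rate \<delta> by (intro mult_left_mono mult_nonneg_nonneg) auto
    also have "\<dots> = \<epsilon> * (C / (C + 1))"
    proof -
      have "a * (\<epsilon> / (a * d)) * C = \<epsilon> * (C / d)" if "a > 0" for a d :: real using that by simp
      then show ?thesis unfolding \<delta>_def using J by simp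
    qed
    also have "\<dots> \<le> \<epsilon> * 1" using C \<epsilon> by (intro mult_left_mono) (auto simp: field_simps)
    finally show "measure (tree_marks_measure N) (SIGMA T:?A. B T) \<le> \<epsilon>" by simp
  next
    fix \<omega> assume \<omega>: "\<omega> \<in> space (tree_marks_measure N) - (SIGMA T:?A. B T)"
    obtain T U where TU: "\<omega> = (T, U)" by (cases \<omega>)
    have T: "T \<in> ?A" using \<omega> unfolding TU tree_marks_measure_def by (simp add: space_pair_measure space_uniform_count_measure)
    then have U: "U \<notin> B T" using \<omega> unfolding TU by simp
    let ?s = "s T U"
    have frag: "fragmentation N b \<omega> = step_path (component_masses T) (tree_edges T) (\<lambda>e. c * (1 - U e))"
      unfolding TU fragmentation_eq_step_path[OF card_tree[OF N T]] del ..
    have good: "real (\<Sum>u\<in>T. card (path_edges u \<inter> {f \<in> tree_edges T. ?s i < c * (1 - U f) \<and> c * (1 - U f) \<le> ?s i + \<delta>})) < \<kappa> * card T / 2"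
      if "i < m" for i
      using U that unfolding B_def by (auto simp: not_le)
    note part = greedy_partition_of_fragmentation[OF pT[OF T] \<kappa> J mk, of "\<lambda>e. c * (1 - U e)" \<delta>, folded s_def, OF good]
    have fin: "finite (tree_edges T)" by (rule finite_tree_edges[OF pT[OF T]])
    show "partitionable (fragmentation N b \<omega>) \<delta> j"
      unfolding partitionable_def
    proof (intro exI[of _ ?s] conjI allI impI)
      show "?s 0 = 0" by (simp add: s_def)
      show "0 \<le> ?s i" for i unfolding s_def by (rule greedy_nonneg[OF fin J])
      show "?s i \<le> ?J" for i unfolding s_def by (rule greedy_le[OF fin J])
      show "min (?s i + \<delta>) ?J \<le> ?s (Suc i)" for i by (rule part(1))
      show "dist (fragmentation N b \<omega> t) (fragmentation N b \<omega> (?s i)) \<le> 1 / ?J"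
        if "?s i \<le> t" "t < ?s (Suc i)" for i t
        unfolding frag sqrt[symmetric] by (rule part(2)[OF _ that])
    qed
  qed
qed

theorem corollary8p1:
  fixes N :: "nat \<Rightarrow> nat \<Rightarrow> nat" and b :: "nat \<Rightarrow> real"
  assumes "\<And>n. degree_sequence (N n)"
    and "\<And>n. 0 \<le> b n"
    and "filterlim b at_top sequentially"
    and "filterlim (\<lambda>n. real (num_vertices (N n)) / b n) at_top sequentially"
    and "(\<lambda>n. b n / deg_sigma (N n)) \<longlonglongrightarrow> 1"
  shows "tight_family (skorohod_J1 mass_partitions) {n. b n > 0}
           (\<lambda>n. tree_marks_measure (N n)) (\<lambda>n. fragmentation (N n) (b n))"
  unfolding tight_family_def
proof (intro conjI ballI allI impI)
  fix n
  show "prob_space (tree_marks_measure (N n))" by (rule prob_space_tree_marks[OF assms(1)])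
  show "fragmentation (N n) (b n) \<in> tree_marks_measure (N n) \<rightarrow>\<^sub>M borel_sets_of (skorohod_J1 mass_partitions)"
    by (rule measurable_fragmentation[OF assms(1)])
next
  fix \<epsilon> :: real assume \<epsilon>: "\<epsilon> > 0"
  obtain C where C: "C \<ge> 0" "\<And>n. b n / (real (num_vertices (N n)))\<^sup>2 * mean_path_length (N n) \<le> C"
    using rate_bounded[OF assms(1,3,4,5)] by blast
  \<comment> \<open>Level \<open>j\<close> may fail with probability at most
    \<open>\<eta> j\<close>, and these add up to \<open>\<epsilon>\<close>. The resulting
    \<open>\<delta>\<close> does not involve \<open>n\<close>, so one compact set serves the whole
    family.\<close>
  define \<eta> where "\<eta> j = \<epsilon> * (1 / 2) ^ Suc j" for j :: nat
  define \<delta> where "\<delta> j = \<eta> j / (32 * real (Suc j) ^ 4 * (C + 1))" for j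
  have \<eta>: "\<eta> j > 0" for j using \<epsilon> by (simp add: \<eta>_def)
  have \<delta>: "\<delta> j > 0" for j unfolding \<delta>_def using \<eta>[of j] C(1) by (intro divide_pos_pos mult_pos_pos zero_less_power) auto
  let ?K = "skeleton_paths mass_partitions \<delta>"
  note K = skeleton_paths_compact_closed[OF compact_mass_partitions, of \<delta>, OF \<delta>]
  have "1 - \<epsilon> \<le> measure (tree_marks_measure (N n)) {\<omega> \<in> space (tree_marks_measure (N n)). fragmentation (N n) (b n) \<omega> \<in> ?K}"
    if n: "n \<in> {n. 0 < b n}" for n
  proof -
    let ?M = "tree_marks_measure (N n)" and ?Y = "fragmentation (N n) (b n)"
    interpret M: prob_space ?M by (rule prob_space_tree_marks[OF assms(1)])
    have bn: "b n > 0" using n by simp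
    have meas: "?Y \<in> ?M \<rightarrow>\<^sub>M borel_sets_of (skorohod_J1 mass_partitions)"
      by (rule measurable_fragmentation[OF assms(1)])
    have "\<exists>B. B \<in> sets ?M \<and> measure ?M B \<le> \<eta> j \<and> (\<forall>\<omega>\<in>space ?M - B. partitionable (?Y \<omega>) (\<delta> j) j)" for j
      by (rule fragmentation_level_bound[OF assms(1) bn C(1) \<eta>[of j] C(2), of j])
        (unfold \<delta>_def, blast)
    then obtain B where B: "\<And>j. B j \<in> sets ?M" "\<And>j. measure ?M (B j) \<le> \<eta> j"
      "\<And>j \<omega>. \<omega> \<in> space ?M - B j \<Longrightarrow> partitionable (?Y \<omega>) (\<delta> j) j"
      by metis
    let ?G = "{\<omega> \<in> space ?M. ?Y \<omega> \<in> ?K}"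
    have sp: "space (borel_sets_of (skorohod_J1 mass_partitions)) = cadlag mass_partitions"
      unfolding borel_sets_of_def topspace_skorohod_J1[symmetric]
      by (rule space_measure_of) (use openin_subset in blast)
    have "cadlag mass_partitions - ?K \<in> sets (borel_sets_of (skorohod_J1 mass_partitions))"
    proof -
      have "openin (skorohod_J1 mass_partitions) (cadlag mass_partitions - ?K)"
        using K(2) unfolding closedin_def topspace_skorohod_J1 by blast
      moreover have "{G. openin (skorohod_J1 mass_partitions) G} \<subseteq> Pow (topspace (skorohod_J1 mass_partitions))"
        using openin_subset by blast
      ultimately show ?thesis unfolding borel_sets_of_def by (simp add: sets_measure_of)
    qed
    then have "space (borel_sets_of (skorohod_J1 mass_partitions)) - (cadlag mass_partitions - ?K)
        \<in> sets (borel_sets_of (skorohod_J1 mass_partitions))"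
      by (rule sets.compl_sets)
    moreover have "cadlag mass_partitions - (cadlag mass_partitions - ?K) = ?K"
      unfolding skeleton_paths_def by blast
    ultimately have "?K \<in> sets (borel_sets_of (skorohod_J1 mass_partitions))" by (simp add: sp)
    from measurable_sets[OF meas this] have G: "?G \<in> sets ?M" by (simp add: vimage_def Int_def conj_commute)
    have cad: "?Y \<omega> \<in> cadlag mass_partitions" if "\<omega> \<in> space ?M" for \<omega>
      using measurable_space[OF meas that] unfolding sp .
    have "space ?M - ?G \<subseteq> (\<Union>j. B j)"
    proof
      fix \<omega> assume \<omega>: "\<omega> \<in> space ?M - ?G"
      show "\<omega> \<in> (\<Union>j. B j)"
      proof (rule ccontr)
        assume neg: "\<omega> \<notin> (\<Union>j. B j)"
        have "?Y \<omega> \<in> ?K"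
        proof (rule skeleton_pathsI)
          show "?Y \<omega> \<in> cadlag mass_partitions" using cad \<omega> by blast
        qed (rule B(3), use \<omega> neg in blast)
        then show False using \<omega> by blast
      qed
    qed
    then have "measure ?M (space ?M - ?G) \<le> measure ?M (\<Union>j. B j)"
      using B(1) by (intro M.finite_measure_mono) auto
    also have sums: "\<eta> sums \<epsilon>"
      unfolding \<eta>_def using sums_mult[OF power_half_series, of \<epsilon>] by simp
    have summ: "summable (\<lambda>j. measure ?M (B j))"
      by (rule summable_comparison_test'[OF sums_summable[OF sums], of 0]) (use B(2) in simp)
    have "measure ?M (\<Union>j. B j) \<le> (\<Sum>j. measure ?M (B j))"
      using B(1) summ by (intro M.finite_measure_subadditive_countably) auto
    also have "\<dots> \<le> (\<Sum>j. \<eta> j)" by (rule suminf_le[OF B(2) summ sums_summable[OF sums]])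
    also have "\<dots> = \<epsilon>" using sums by (rule sums_unique[symmetric])
    finally have "measure ?M (space ?M - ?G) \<le> \<epsilon>" .
    then show ?thesis using M.prob_compl[OF G] by linarith
  qed
  then show "\<exists>K. compactin (skorohod_J1 mass_partitions) K \<and> (\<forall>n\<in>{n. 0 < b n}.
      1 - \<epsilon> \<le> measure (tree_marks_measure (N n)) {\<omega> \<in> space (tree_marks_measure (N n)). fragmentation (N n) (b n) \<omega> \<in> K})"
    using K(1) by blast
qed

end
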